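(* Let $\alpha\in(0,1)$ and let $\{p_n\}_{n=1}^\infty$, $\{q_n\}_{n=1}^\infty$ be real sequences such that $a_n:=n^\alpha+p_n>0$ for all $n\in\mathbb N$ and $$\Big\{\frac{p_n}{n^{\alpha/2}}\Big\}_{n=1}^\infty,\ \Big\{\frac{q_n}{n^{\alpha/2}}\Big\}_{n=1}^\infty\in l^1 .$$ Put $b_n:=-2n^\alpha+q_n$, and let $\mathcal J$ be the Jacobi matrix with diagonal entries $b_1,b_2,\dots$ and off-diagonal entries $a_1,a_2,\dots$. Fix $0<r<R<\infty$ and let $\Omega_0:=\{\lambda\in\mathbb C: r<|\lambda|<R\}\setminus\mathbb R_-$, with $\overline\Omega_0$ its closure containing both sides of the cut along $\mathbb R_-$ (see context). For $\lambda\in\overline\Omega_0$ put $$\eta_n^-(\lambda):=1+\frac{\lambda}{2n^\alpha}+\frac{\alpha}{4n}-\frac{\sqrt\lambda}{n^{\alpha/2}}\sqrt{1+\frac{\lambda}{4n^\alpha}+\frac{\alpha}{\lambda n^{1-\alpha}}},$$ where the branches of the square roots are chosen so that they are positive for positive $\lambda$. Then there exists $N_0\in\mathbb N$, with $\eta_n^-(\lambda)\ne0$ for all $\lambda\in\overline\Omega_0$ and $n\geqslant N_0$, such that the following holds. (1) For every $\lambda\in\overline\Omega_0$ the equation $$a_{n-1}u_{n-1}+b_nu_n+a_nu_{n+1}=\lambda u_n,\qquad n\geqslant2, \qquad ( * )$$ has a solution $u^-(\lambda)=\{u_n^-(\lambda)\}_{n=1}^\infty$ with the asymptotics $$u_n^-(\lambda)=\Big(\prod_{l=N_0}^n\eta_l^-(\lambda)\Big)(1+o(1)),\qquad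 n\to\infty,$$ uniform in $\lambda\in\overline\Omega_0$; for every $n$ the function $u_n^-$ is analytic in $\Omega_0$ and continuous in $\overline\Omega_0$. (2) For $\lambda\in[-R,-r]$ (upper side of the cut) there exists a nonzero limit $$H(\lambda):=\lim_{n\to\infty}n^{\alpha/4}\prod_{l=N_0}^n|\eta_l^-(\lambda)|,$$ which is continuous in $\lambda$. (3) For $\lambda\in[-R,-r]$ the sequence $u^+(\lambda)=\{u_n^+(\lambda)\}_{n=1}^\infty$ with $u_n^+(\lambda):=\overline{u_n^-(\lambda)}$ is another solution of $( * )$, and the Wronskian is nonzero: $$W\{u^+(\lambda),u^-(\lambda)\}=-2i\sqrt{-\lambda}\,H^2(\lambda).$$ (4) The orthogonal polynomials of the first kind $P_n$ associated with $\mathcal J$ can be expressed as $$P_n(\lambda)=\Psi(\lambda)u_n^+(\lambda)+\overline{\Psi(\lambda)}\,u_n^-(\lambda),\qquad \lambda\in[-R,-r],\ n\in\mathbb N,$$ where $$\Psi(\lambda)=\frac{u_0^-(\lambda)}{2i\sqrt{-\lambda}\,H^2(\lambda)},\qquad u_0^-(\lambda):=(\lambda-b_1)u_1^-(\lambda)-a_1u_2^-(\lambda).$$ (5) The spectral density of $\mathcal J$ is given by $$\rho'(\lambda)=\frac{1}{4\pi\sqrt{-\lambda}\,|\Psi(\lambda)|^2H^2(\lambda)}=\frac{\sqrt{-\lambda}\,H^2(\lambda)}{\pi|u_0^-(\lambda)|^2},\qquad \lambda\in[-R,-r].$$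
   Context: A Jacobi matrix with diagonal entries $b_n\in\mathbb R$ and off-diagonal entries $a_n>0$ ($n\geqslant1$) is the symmetric tridiagonal matrix with $(\mathcal J)_{n,n}=b_n$, $(\mathcal J)_{n,n+1}=(\mathcal J)_{n+1,n}=a_n$, and all other entries zero. It defines an operator in $l^2(\mathbb N)$, the closure of its action on finitely supported sequences, which under the stated hypotheses is self-adjoint by the Carleman condition $\sum_n 1/a_n=\infty$. Let $\mathcal E$ be its projection-valued spectral measure and $e_1$ the first standard basis vector. The (scalar) spectral measure is $\rho:=(\mathcal E e_1,e_1)$, and the spectral density $\rho'$ is its derivative with respect to Lebesgue measure, which exists and is finite almost everywhere; formulas for $\rho'$ are to be understood for almost all $\lambda$ in the indicated set. The orthogonal polynomials of the first kind $P_n(\lambda)$ are the solution of $a_{n-1}u_{n-1}+b_nu_n+a_nu_{n+1}=\lambda u_n$, $n\geqslant2$, with $P_1(\lambda)=1$, $P_2(\lambda)=\frac{\lambda-b_1}{a_1}$. The Wronskian of two solutions $u,v$ of this equation is $W\{u,v\}:=a_n(u_nv_{n+1}-u_{n+1}v_n)$, which does not depend on $n\in\mathbb N$. $\mathbb R_-$ is the negative half-line. $\overline\Omega_0$ denotes the closure of $\Omega_0$ on the Riemann surface of $\sqrt\lambda$: the two sides of the cut along $\mathbb R_-$ are regarded as different, and both are included. Writing $[-R,-r]$ for values of $\lambda$ always means the upper side of the cut, so that there $\sqrt\lambda=i\sqrt{-\lambda}$ with $\sqrt{-\lambda}>0$. In the definition of $\eta_n^-$, $n\geqslant N_0$, both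 square roots are the branches analytic in $\Omega_0$ and continuous in $\overline\Omega_0$ that are positive for positive $\lambda$; $N_0$ is taken large enough that $1+\frac{\lambda}{4n^\alpha}+\frac{\alpha}{\lambda n^{1-\alpha}}$ does not vanish on $\overline\Omega_0$ for $n\geqslant N_0$, so that these branches are well defined. *)

theory Defs
  imports "HOL-Analysis.Analysis" "HOL-Probability.Distribution_Functions"
begin

section \<open>Jacobi operators\<close>

text \<open>
  Sequences are indexed by $n \ge 1$.  Elements of $l^2$ of the positive integers are functions on
  \<^typ>\<open>nat\<close> that vanish at the unused index 0.  The entries \<open>a 0\<close> and \<open>b 0\<close> of the
  coefficient sequences are never used.
\<close>

definition ell2 :: "(nat \<Rightarrow> complex) set" where
  "ell2 = {u. u 0 = 0 \<and> summable (\<lambda>n. (cmod (u n))\<^sup>2)}"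

definition ell2_inner :: "(nat \<Rightarrow> complex) \<Rightarrow> (nat \<Rightarrow> complex) \<Rightarrow> complex" where
  "ell2_inner u v = (\<Sum>n. u n * cnj (v n))"

definition ell2_norm :: "(nat \<Rightarrow> complex) \<Rightarrow> real" where
  "ell2_norm u = sqrt (\<Sum>n. (cmod (u n))\<^sup>2)"

definition ell2_tendsto :: "(nat \<Rightarrow> nat \<Rightarrow> complex) \<Rightarrow> (nat \<Rightarrow> complex) \<Rightarrow> bool" where
  "ell2_tendsto \<phi> u \<longleftrightarrow> (\<lambda>k. ell2_norm (\<lambda>n. \<phi> k n - u n)) \<longlonglongrightarrow> 0"

definition finitely_supported :: "(nat \<Rightarrow> complex) \<Rightarrow> bool" where
  "finitely_supported u \<longleftrightarrow> u 0 = 0 \<and> finite {n. u n \<noteq> 0}"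

definition jacobi_entry :: "(nat \<Rightarrow> real) \<Rightarrow> (nat \<Rightarrow> real) \<Rightarrow> nat \<Rightarrow> nat \<Rightarrow> real" where
  "jacobi_entry a b m n =
     (if m = n then b n else if n = Suc m then a m else if m = Suc n then a n else 0)"

definition jacobi_apply ::
    "(nat \<Rightarrow> real) \<Rightarrow> (nat \<Rightarrow> real) \<Rightarrow> (nat \<Rightarrow> complex) \<Rightarrow> nat \<Rightarrow> complex" where
  "jacobi_apply a b u n =
     (if n = 0 then 0 else \<Sum>m | u m \<noteq> 0. of_real (jacobi_entry a b n m) * u m)"

text \<open>The Jacobi operator, as a graph in the product of two copies of $l^2$.\<close>

definition jacobi_operator ::
    "(nat \<Rightarrow> real) \<Rightarrow> (nat \<Rightarrow> real) \<Rightarrow> ((nat \<Rightarrow> complex) \<times> (nat \<Rightarrow> complex)) set" where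
  "jacobi_operator a b =
     {(u, v). u \<in> ell2 \<and> v \<in> ell2 \<and>
        (\<exists>\<phi>. (\<forall>k. finitely_supported (\<phi> k)) \<and> ell2_tendsto \<phi> u \<and>
             ell2_tendsto (\<lambda>k. jacobi_apply a b (\<phi> k)) v)}"


section \<open>Projection-valued spectral measures\<close>

definition orthogonal_projection :: "((nat \<Rightarrow> complex) \<Rightarrow> nat \<Rightarrow> complex) \<Rightarrow> bool" where
  "orthogonal_projection T \<longleftrightarrow>
     (\<forall>u\<in>ell2. T u \<in> ell2 \<and> T (T u) = T u) \<and>
     (\<forall>u\<in>ell2. \<forall>v\<in>ell2. T (\<lambda>n. u n + v n) = (\<lambda>n. T u n + T v n)) \<and>
     (\<forall>u\<in>ell2. \<forall>c. T (\<lambda>n. c * u n) = (\<lambda>n. c * T u n)) \<and>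
     (\<forall>u\<in>ell2. \<forall>v\<in>ell2. ell2_inner (T u) v = ell2_inner u (T v))"

definition projection_valued_measure ::
    "(real set \<Rightarrow> (nat \<Rightarrow> complex) \<Rightarrow> nat \<Rightarrow> complex) \<Rightarrow> bool" where
  "projection_valued_measure E \<longleftrightarrow>
     (\<forall>B\<in>sets borel. orthogonal_projection (E B)) \<and>
     (\<forall>u\<in>ell2. E UNIV u = u) \<and>
     (\<forall>B. range B \<subseteq> sets borel \<longrightarrow> disjoint_family B \<longrightarrow>
        (\<forall>u\<in>ell2. ell2_tendsto (\<lambda>k n. \<Sum>i<k. E (B i) u n) (E (\<Union>i::nat. B i) u)))"

text \<open>The scalar measure $(E(\cdot)u, u)$; its values are real and nonnegative.\<close>

definition scalar_measure ::
    "(real set \<Rightarrow> (nat \<Rightarrow> complex) \<Rightarrow> nat \<Rightarrow> complex) \<Rightarrow> (nat \<Rightarrow> complex) \<Rightarrow> real measure" where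
  "scalar_measure E u =
     measure_of UNIV (sets borel) (\<lambda>B. ennreal (Re (ell2_inner (E B u) u)))"

text \<open>
  \<open>E\<close> is the spectral measure of the operator with graph \<open>A\<close>, that is, $A = \int x \, dE(x)$:
  the domain of $A$ consists of the $u$ with $\int x^2 \, d(Eu,u) < \infty$, and
  $(Au,u) = \int x \, d(Eu,u)$ there.  By polarization the quadratic form determines $A$.
\<close>

definition spectral_measure_of ::
    "(real set \<Rightarrow> (nat \<Rightarrow> complex) \<Rightarrow> nat \<Rightarrow> complex) \<Rightarrow>
     ((nat \<Rightarrow> complex) \<times> (nat \<Rightarrow> complex)) set \<Rightarrow> bool" where
  "spectral_measure_of E A \<longleftrightarrow>
     projection_valued_measure E \<and>
     (\<forall>u. u \<in> Domain A \<longleftrightarrow> u \<in> ell2 \<and> integrable (scalar_measure E u) (\<lambda>x. x\<^sup>2)) \<and>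
     (\<forall>(u, v)\<in>A. ell2_inner v u = of_real (integral\<^sup>L (scalar_measure E u) (\<lambda>x. x)))"

definition e1 :: "nat \<Rightarrow> complex" where
  "e1 n = (if n = 1 then 1 else 0)"


section \<open>The recurrence relation\<close>

definition jacobi_solution ::
    "(nat \<Rightarrow> real) \<Rightarrow> (nat \<Rightarrow> real) \<Rightarrow> complex \<Rightarrow> (nat \<Rightarrow> complex) \<Rightarrow> bool" where
  "jacobi_solution a b z u \<longleftrightarrow>
     (\<forall>n\<ge>2. of_real (a (n - 1)) * u (n - 1) + of_real (b n) * u n + of_real (a n) * u (n + 1)
             = z * u n)"

definition wronskian ::
    "(nat \<Rightarrow> real) \<Rightarrow> (nat \<Rightarrow> complex) \<Rightarrow> (nat \<Rightarrow> complex) \<Rightarrow> nat \<Rightarrow> complex" where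
  "wronskian a u v n = of_real (a n) * (u n * v (n + 1) - u (n + 1) * v n)"

fun orth_poly :: "(nat \<Rightarrow> real) \<Rightarrow> (nat \<Rightarrow> real) \<Rightarrow> nat \<Rightarrow> complex \<Rightarrow> complex" where
  "orth_poly a b 0 z = 0"
| "orth_poly a b (Suc 0) z = 1"
| "orth_poly a b (Suc (Suc 0)) z = (z - of_real (b 1)) / of_real (a 1)"
| "orth_poly a b (Suc (Suc (Suc n))) z =
     ((z - of_real (b (n + 2))) * orth_poly a b (Suc (Suc n)) z
       - of_real (a (n + 1)) * orth_poly a b (Suc n) z) / of_real (a (n + 2))"


section \<open>The closed slit annulus on the Riemann surface of the square root\<close>

definition slit_annulus :: "real \<Rightarrow> real \<Rightarrow> complex set" where
  "slit_annulus r R = {z. r < cmod z \<and> cmod z < R} - \<real>\<^sub>\<le>\<^sub>0"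

text \<open>
  Points of the Riemann surface of $\sqrt z$ are the pairs $(z, w)$ with $w^2 = z$.  The slit annulus
  is embedded by the principal root, which is positive for positive $z$, and its closure
  $\{(z, w) \mid w^2 = z,\ r \le |z| \le R,\ \mathrm{Re}\, w \ge 0\}$ contains both sides of the cut
  as different points.  On the closure, \<^const>\<open>fst\<close> is $z$ and \<^const>\<open>snd\<close> is $\sqrt z$.
\<close>

definition lift :: "complex \<Rightarrow> complex \<times> complex" where
  "lift z = (z, csqrt z)"

definition closed_slit_annulus :: "real \<Rightarrow> real \<Rightarrow> (complex \<times> complex) set" where
  "closed_slit_annulus r R = closure (lift ` slit_annulus r R)"

text \<open>The point over \<open>x < 0\<close> on the upper side of the cut.\<close>

definition upper :: "real \<Rightarrow> complex \<times> complex" where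
  "upper x = (of_real x, \<i> * of_real (sqrt (- x)))"

definition regular_on_surface :: "real \<Rightarrow> real \<Rightarrow> (complex \<times> complex \<Rightarrow> complex) \<Rightarrow> bool" where
  "regular_on_surface r R f \<longleftrightarrow>
     (\<lambda>z. f (lift z)) holomorphic_on slit_annulus r R \<and>
     continuous_on (closed_slit_annulus r R) f"

text \<open>
  The branch of $\sqrt{f}$ that is analytic in the slit annulus, continuous on the closure and
  positive for positive \<open>z\<close>.  If \<open>f\<close> has no zeros and such a branch exists, its values on the
  closed slit annulus are unique.
\<close>

definition is_sqrt_branch ::
    "real \<Rightarrow> real \<Rightarrow> (complex \<times> complex \<Rightarrow> complex) \<Rightarrow> (complex \<times> complex \<Rightarrow> complex) \<Rightarrow> bool" where
  "is_sqrt_branch r R f g \<longleftrightarrow>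
     regular_on_surface r R g \<and>
     (\<forall>p\<in>closed_slit_annulus r R. (g p)\<^sup>2 = f p) \<and>
     (\<forall>x\<in>{r..R}. g (lift (of_real x)) \<in> \<real> \<and> 0 < Re (g (lift (of_real x))))"

definition sqrt_branch ::
    "real \<Rightarrow> real \<Rightarrow> (complex \<times> complex \<Rightarrow> complex) \<Rightarrow> complex \<times> complex \<Rightarrow> complex" where
  "sqrt_branch r R f = (SOME g. is_sqrt_branch r R f g)"

definition radicand :: "real \<Rightarrow> nat \<Rightarrow> complex \<times> complex \<Rightarrow> complex" where
  "radicand \<alpha> n p =
     1 + fst p / of_real (4 * real n powr \<alpha>)
       + of_real \<alpha> / (fst p * of_real (real n powr (1 - \<alpha>)))"

definition eta_minus :: "real \<Rightarrow> real \<Rightarrow> real \<Rightarrow> nat \<Rightarrow> complex \<times> complex \<Rightarrow> complex" where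
  "eta_minus r R \<alpha> n p =
     1 + fst p / of_real (2 * real n powr \<alpha>) + of_real (\<alpha> / (4 * real n))
       - snd p / of_real (real n powr (\<alpha> / 2)) * sqrt_branch r R (radicand \<alpha> n) p"

end

theory Submission
  imports Defs "HOL-Complex_Analysis.Complex_Analysis" "HOL-Real_Asymp.Real_Asymp"
begin

text \<open>
  Write \<open>\<lambda> = w\<^sup>2\<close>.  Then \<open>\<eta>\<^sub>n\<close> is a function \<open>eta n w = A\<^sub>n - B\<^sub>n\<close>, and \<open>eta n (- w) = A\<^sub>n + B\<^sub>n\<close> is the other root
  of the characteristic equation of the recurrence, up to small errors.  The products \<open>Q\<^sub>n(\<plusminus>w)\<close> of these factors solve
  the recurrence up to residuals \<open>r\<^sub>n(\<plusminus>w)\<close> with \<open>\<Sum> \<bar>r\<^sub>n\<bar> n powr (-\<alpha>/2) < \<infinity>\<close>, uniformly in \<open>w\<close>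
  (\<open>residual_summable\<close>).  The unperturbed coefficients contribute a convergent power of \<open>n\<close>, by a
  cancellation between the drift of \<open>n powr (-\<alpha>/2)\<close> in \<open>B\<^sub>n\<close> and the factor \<open>1 - \<alpha>/(2n)\<close> in
  \<open>eta n w * eta n (- w)\<close>; the perturbations contribute exactly the two norms that are assumed to be finite.

  Three facts turn small residuals into an exact solution.  The product \<open>Q\<^sub>n(w) Q\<^sub>n(-w)\<close> is of the order
  \<open>n powr (-\<alpha>/2)\<close> (\<open>F_bounds\<close>).  For \<open>Re w \<ge> 0\<close> one has \<open>\<bar>eta n w\<bar> \<le> \<bar>eta n (- w)\<bar>\<close>
  (\<open>eta_le_eta_minus\<close>), so the modulus of \<open>T\<^sub>n = Q\<^sub>n(-w) / Q\<^sub>n(w)\<close> is nondecreasing.  The Wronskian of \<open>Q(w)\<close> and \<open>Q(-w)\<close>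
  has bounded variation and stays away from zero (\<open>Wr_step\<close>, \<open>Wr_lower\<close>).  Variation of constants gives
  \<open>u\<^sub>n = Q\<^sub>n v\<^sub>n\<close> with \<open>v\<^sub>n = 1 - \<Sum>k>n. K(n,k) r\<^sub>k v\<^sub>k\<close>.  The kernel is a sum of increments of \<open>T\<close> divided by the
  Wronskian, and summation by parts gives \<open>\<bar>K(n,k)\<bar> \<le> C k powr (-\<alpha>/2)\<close> (\<open>green_kernel_bound\<close>), also on the
  cut, where the sum of the moduli is too large.  The solution \<open>v\<close> is the uniform limit of the solutions
  of the equations truncated at \<open>k \<le> M\<close>.  Uniformity yields the asymptotics, analyticity and continuity.

  On the cut \<open>eta n (- w)\<close> is the complex conjugate of \<open>eta n w\<close>, so \<open>n powr (\<alpha>/2) * \<bar>Q\<^sub>n\<bar>\<^sup>2\<close> converges to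
  \<open>H\<^sup>2\<close>.  Since \<open>v\<^sub>n\<^sub>+\<^sub>1 - v\<^sub>n = o(n powr (-\<alpha>/2))\<close>, the Wronskian of the conjugate of \<open>u\<close> and \<open>u\<close> can be computed
  in the limit (\<open>wronskian_limit\<close>); the formula for the orthogonal polynomials is then linear algebra.

  For the spectral density, off the cut \<open>u\<^sub>n\<close> is \<open>O(n powr (-3))\<close>, so \<open>f = - u / u\<^sub>0\<close> lies in the
  domain of the operator and \<open>(J - z) f = e1\<close> (\<open>sol_in_operator\<close>).  The spectral measure is only given by
  its quadratic form; polarization on the cells of a fine partition of the line yields
  \<open>Im (f 1) = \<integral> Im (1 / (x - z)) d\<rho>\<close> (\<open>resolvent_Stieltjes\<close>).  As \<open>f 1 = - u\<^sub>1 / u\<^sub>0\<close> is continuous up to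
  the cut, Stieltjes inversion differentiates the distribution function, and the Wronskian evaluates the
  imaginary part of the boundary value as \<open>\<surd>-x H\<^sup>2 / \<bar>u\<^sub>0\<bar>\<^sup>2\<close>.
\<close>

section \<open>Square-summable sequences and the Jacobi operator\<close>

lemma ell2_summable: "u \<in> ell2 \<Longrightarrow> summable (\<lambda>n. (cmod (u n))\<^sup>2)"
  by (simp add: ell2_def)

lemma ell2_norm_sq: "u \<in> ell2 \<Longrightarrow> (ell2_norm u)\<^sup>2 = (\<Sum>n. (cmod (u n))\<^sup>2)"
  unfolding ell2_norm_def by (simp add: ell2_summable suminf_nonneg)

lemma ell2_norm_nonneg: "u \<in> ell2 \<Longrightarrow> 0 \<le> ell2_norm u"
  unfolding ell2_norm_def by (simp add: ell2_summable suminf_nonneg)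

text \<open>
  This bound, summed over the entries, takes the place of the triangle inequality: only convergence to
  zero of norms of sums is needed.
\<close>

lemma norm_sq_add_le: "(cmod (x + y))\<^sup>2 \<le> 2 * (cmod x)\<^sup>2 + 2 * (cmod y)\<^sup>2"
proof -
  have "(cmod (x + y))\<^sup>2 \<le> (cmod x + cmod y)\<^sup>2"
    by (intro power_mono norm_triangle_ineq) auto
  also have "\<dots> \<le> 2 * (cmod x)\<^sup>2 + 2 * (cmod y)\<^sup>2"
    using sum_squares_bound[of "cmod x" "cmod y"] by (simp add: power2_sum)
  finally show ?thesis .
qed

lemma ell2_add:
  assumes "u \<in> ell2" "v \<in> ell2"
  shows "(\<lambda>n. u n + v n) \<in> ell2"
    and "(ell2_norm (\<lambda>n. u n + v n))\<^sup>2 \<le> 2 * (ell2_norm u)\<^sup>2 + 2 * (ell2_norm v)\<^sup>2"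
proof -
  have s: "summable (\<lambda>n. 2 * (cmod (u n))\<^sup>2 + 2 * (cmod (v n))\<^sup>2)"
    using assms by (intro summable_add summable_mult ell2_summable)
  have s': "summable (\<lambda>n. (cmod (u n + v n))\<^sup>2)"
    by (rule summable_comparison_test'[OF s, of 0]) (use norm_sq_add_le in auto)
  show 1: "(\<lambda>n. u n + v n) \<in> ell2"
    using assms s' by (simp add: ell2_def)
  show "(ell2_norm (\<lambda>n. u n + v n))\<^sup>2 \<le> 2 * (ell2_norm u)\<^sup>2 + 2 * (ell2_norm v)\<^sup>2"
    unfolding ell2_norm_sq[OF 1] ell2_norm_sq[OF assms(1)] ell2_norm_sq[OF assms(2)]
    using suminf_le[OF norm_sq_add_le s' s] assms
    by (simp add: suminf_add[symmetric] suminf_mult ell2_summable summable_mult)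
qed

lemma ell2_scale:
  assumes "u \<in> ell2"
  shows "(\<lambda>n. c * u n) \<in> ell2" "(ell2_norm (\<lambda>n. c * u n))\<^sup>2 = (cmod c)\<^sup>2 * (ell2_norm u)\<^sup>2"
proof -
  show 1: "(\<lambda>n. c * u n) \<in> ell2"
    using assms by (auto simp: ell2_def norm_mult power_mult_distrib intro!: summable_mult)
  show "(ell2_norm (\<lambda>n. c * u n))\<^sup>2 = (cmod c)\<^sup>2 * (ell2_norm u)\<^sup>2"
    unfolding ell2_norm_sq[OF 1] ell2_norm_sq[OF assms]
    using assms by (simp add: norm_mult power_mult_distrib suminf_mult ell2_summable)
qed

lemma ell2_diff: "u \<in> ell2 \<Longrightarrow> v \<in> ell2 \<Longrightarrow> (\<lambda>n. u n - v n) \<in> ell2"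
  using ell2_add(1)[of u "\<lambda>n. (-1) * v n"] ell2_scale(1)[of v "-1"] by simp

lemma ell2_e1: "e1 \<in> ell2"
  unfolding ell2_def e1_def
  by (auto intro!: summable_finite[of "{1}"] split: if_splits)

lemma ell2_inner_summable:
  assumes "u \<in> ell2" "v \<in> ell2"
  shows "summable (\<lambda>n. u n * cnj (v n))"
proof -
  have s: "summable (\<lambda>n. (cmod (u n))\<^sup>2 + (cmod (v n))\<^sup>2)"
    using assms by (intro summable_add ell2_summable)
  show ?thesis
  proof (rule summable_comparison_test'[OF s, of 0])
    fix n
    show "norm (u n * cnj (v n)) \<le> (cmod (u n))\<^sup>2 + (cmod (v n))\<^sup>2"
      using sum_squares_bound[of "cmod (u n)" "cmod (v n)"]
        mult_nonneg_nonneg[OF norm_ge_zero[of "u n"] norm_ge_zero[of "v n"]]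
      unfolding norm_mult complex_mod_cnj by linarith
  qed
qed

lemma ell2_inner_add_left:
  "\<lbrakk>u \<in> ell2; v \<in> ell2; w \<in> ell2\<rbrakk> \<Longrightarrow>
    ell2_inner (\<lambda>n. u n + v n) w = ell2_inner u w + ell2_inner v w"
  unfolding ell2_inner_def
  by (simp add: suminf_add ell2_inner_summable ring_distribs)

lemma ell2_inner_scale_left:
  "\<lbrakk>u \<in> ell2; w \<in> ell2\<rbrakk> \<Longrightarrow> ell2_inner (\<lambda>n. c * u n) w = c * ell2_inner u w"
  unfolding ell2_inner_def
  by (simp add: suminf_mult ell2_inner_summable mult.assoc)

lemma ell2_inner_cnj:
  assumes "u \<in> ell2" "v \<in> ell2"
  shows "cnj (ell2_inner u v) = ell2_inner v u"
proof -
  have "(\<lambda>n. u n * cnj (v n)) sums ell2_inner u v"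
    unfolding ell2_inner_def using ell2_inner_summable[OF assms] by (rule summable_sums)
  then have "(\<lambda>n. cnj (u n * cnj (v n))) sums cnj (ell2_inner u v)"
    by (simp only: sums_cnj)
  then show ?thesis
    unfolding ell2_inner_def[of v u] by (simp add: sums_iff mult.commute)
qed

lemma ell2_inner_add_right:
  assumes "u \<in> ell2" "v \<in> ell2" "w \<in> ell2"
  shows "ell2_inner w (\<lambda>n. u n + v n) = ell2_inner w u + ell2_inner w v"
  using arg_cong[OF ell2_inner_add_left[OF assms], of cnj] assms
  by (simp add: ell2_inner_cnj ell2_add)

lemma ell2_inner_scale_right:
  assumes "u \<in> ell2" "w \<in> ell2"
  shows "ell2_inner w (\<lambda>n. c * u n) = cnj c * ell2_inner w u"
  using arg_cong[OF ell2_inner_scale_left[OF assms, of c], of cnj] assms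
  by (simp add: ell2_inner_cnj ell2_scale)

lemma ell2_inner_self: "u \<in> ell2 \<Longrightarrow> ell2_inner u u = of_real ((ell2_norm u)\<^sup>2)"
  unfolding ell2_inner_def
  by (simp add: ell2_norm_sq complex_norm_square[symmetric] suminf_of_real ell2_summable
      del: of_real_power)

lemma ell2_inner_bound:
  assumes "u \<in> ell2" "v \<in> ell2"
  shows "cmod (ell2_inner u v) \<le> ell2_norm u * ell2_norm v"
proof -
  have p: "cmod (\<Sum>n<k. u n * cnj (v n)) \<le> ell2_norm u * ell2_norm v" for k
  proof -
    have "cmod (\<Sum>n<k. u n * cnj (v n)) \<le> (\<Sum>n<k. \<bar>cmod (u n)\<bar> * \<bar>cmod (v n)\<bar>)"
      by (rule sum_norm_le) (simp add: norm_mult)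
    also have "\<dots> \<le> L2_set (\<lambda>n. cmod (u n)) {..<k} * L2_set (\<lambda>n. cmod (v n)) {..<k}"
      by (rule L2_set_mult_ineq)
    also have "\<dots> \<le> ell2_norm u * ell2_norm v"
      unfolding L2_set_def ell2_norm_def using assms
      by (intro mult_mono real_sqrt_le_mono sum_le_suminf real_sqrt_ge_zero)
        (auto simp: ell2_summable suminf_nonneg sum_nonneg)
    finally show ?thesis .
  qed
  have "(\<lambda>k. \<Sum>n<k. u n * cnj (v n)) \<longlonglongrightarrow> ell2_inner u v"
    unfolding ell2_inner_def using ell2_inner_summable[OF assms] by (rule summable_LIMSEQ)
  then have "(\<lambda>k. cmod (\<Sum>n<k. u n * cnj (v n))) \<longlonglongrightarrow> cmod (ell2_inner u v)"
    by (rule tendsto_norm)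
  then show ?thesis
    by (rule LIMSEQ_le_const2) (use p in auto)
qed

lemma ell2_inner_tendsto:
  assumes "\<And>k. \<phi> k \<in> ell2" "u \<in> ell2" "v \<in> ell2" "ell2_tendsto \<phi> u"
  shows "(\<lambda>k. ell2_inner (\<phi> k) v) \<longlonglongrightarrow> ell2_inner u v"
proof -
  have "(\<lambda>k. ell2_norm (\<lambda>n. \<phi> k n - u n) * ell2_norm v) \<longlonglongrightarrow> 0"
    using tendsto_mult_left_zero[OF assms(4)[unfolded ell2_tendsto_def]] .
  moreover have "cmod (ell2_inner (\<phi> k) v - ell2_inner u v)
      \<le> ell2_norm (\<lambda>n. \<phi> k n - u n) * ell2_norm v" for k
  proof -
    have "ell2_inner (\<phi> k) v - ell2_inner u v = ell2_inner (\<lambda>n. \<phi> k n - u n) v"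
      using ell2_inner_add_left[OF ell2_diff[OF assms(1)[of k] assms(2)] assms(2,3)] by simp
    then show ?thesis
      using ell2_inner_bound[OF ell2_diff[OF assms(1)[of k] assms(2)] assms(3)] by simp
  qed
  ultimately have "(\<lambda>k. ell2_inner (\<phi> k) v - ell2_inner u v) \<longlonglongrightarrow> 0"
    using Lim_null_comparison[of "\<lambda>k. ell2_inner (\<phi> k) v - ell2_inner u v"
        "\<lambda>k. ell2_norm (\<lambda>n. \<phi> k n - u n) * ell2_norm v"] by simp
  then show ?thesis
    by (rule LIM_zero_cancel)
qed

lemma ell2_tendsto_iff_sq:
  assumes "\<And>k. \<phi> k \<in> ell2" "u \<in> ell2"
  shows "ell2_tendsto \<phi> u \<longleftrightarrow> (\<lambda>k. (ell2_norm (\<lambda>n. \<phi> k n - u n))\<^sup>2) \<longlonglongrightarrow> 0"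
  unfolding ell2_tendsto_def
proof
  assume "(\<lambda>k. ell2_norm (\<lambda>n. \<phi> k n - u n)) \<longlonglongrightarrow> 0"
  from tendsto_power[OF this, of 2]
  show "(\<lambda>k. (ell2_norm (\<lambda>n. \<phi> k n - u n))\<^sup>2) \<longlonglongrightarrow> 0" by simp
next
  assume "(\<lambda>k. (ell2_norm (\<lambda>n. \<phi> k n - u n))\<^sup>2) \<longlonglongrightarrow> 0"
  from tendsto_real_sqrt[OF this]
  show "(\<lambda>k. ell2_norm (\<lambda>n. \<phi> k n - u n)) \<longlonglongrightarrow> 0"
    using ell2_norm_nonneg[OF ell2_diff[OF assms]] by simp
qed

lemma ell2_tendsto_lincomb:
  assumes "\<And>k. \<phi> k \<in> ell2" "u \<in> ell2" "ell2_tendsto \<phi> u"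
    and "\<And>k. \<psi> k \<in> ell2" "v \<in> ell2" "ell2_tendsto \<psi> v"
  shows "ell2_tendsto (\<lambda>k n. \<phi> k n + c * \<psi> k n) (\<lambda>n. u n + c * v n)"
proof -
  note m = ell2_add(1)[OF assms(1) ell2_scale(1)[OF assms(4)], of _ c]
    ell2_add(1)[OF assms(2) ell2_scale(1)[OF assms(5)], of c]
  have d: "(\<lambda>n. \<phi> k n - u n) \<in> ell2" "(\<lambda>n. \<psi> k n - v n) \<in> ell2" for k
    by (auto intro: ell2_diff assms)
  have lim: "(\<lambda>k. 2 * (ell2_norm (\<lambda>n. \<phi> k n - u n))\<^sup>2
      + 2 * ((cmod c)\<^sup>2 * (ell2_norm (\<lambda>n. \<psi> k n - v n))\<^sup>2)) \<longlonglongrightarrow> 0"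
    using assms(3)[unfolded ell2_tendsto_iff_sq[OF assms(1,2)]]
      assms(6)[unfolded ell2_tendsto_iff_sq[OF assms(4,5)]]
    by (auto intro!: tendsto_add_zero tendsto_mult_right_zero)
  show ?thesis
    unfolding ell2_tendsto_iff_sq[OF m]
  proof (rule real_tendsto_sandwich[OF _ _ tendsto_const lim])
    show "\<forall>\<^sub>F k in sequentially. (ell2_norm (\<lambda>n. \<phi> k n + c * \<psi> k n - (u n + c * v n)))\<^sup>2
        \<le> 2 * (ell2_norm (\<lambda>n. \<phi> k n - u n))\<^sup>2
          + 2 * ((cmod c)\<^sup>2 * (ell2_norm (\<lambda>n. \<psi> k n - v n))\<^sup>2)"
    proof (rule always_eventually, rule allI)
      fix k
      have e: "(\<lambda>n. \<phi> k n + c * \<psi> k n - (u n + c * v n)) = (\<lambda>n. (\<phi> k n - u n) + c * (\<psi> k n - v n))"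
        by (auto simp: algebra_simps)
      show "(ell2_norm (\<lambda>n. \<phi> k n + c * \<psi> k n - (u n + c * v n)))\<^sup>2
        \<le> 2 * (ell2_norm (\<lambda>n. \<phi> k n - u n))\<^sup>2
          + 2 * ((cmod c)\<^sup>2 * (ell2_norm (\<lambda>n. \<psi> k n - v n))\<^sup>2)"
        using ell2_add(2)[OF d(1)[of k] ell2_scale(1)[OF d(2)[of k], of c]] ell2_scale(2)[OF d(2)[of k], of c]
        unfolding e by linarith
    qed
  qed auto
qed

lemma finitely_supported_ell2: "finitely_supported u \<Longrightarrow> u \<in> ell2"
  unfolding finitely_supported_def ell2_def
  by (auto intro!: summable_finite[of "{n. u n \<noteq> 0}"])

lemma jacobi_apply_Suc:
  assumes "finitely_supported u" "n \<ge> 1"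
  shows "jacobi_apply a b u n
    = of_real (b n) * u n + of_real (a n) * u (Suc n) + of_real (a (n - 1)) * u (n - 1)"
proof -
  let ?S = "{m. u m \<noteq> 0}"
  have fin: "finite ?S" and u0: "u 0 = 0"
    using assms by (auto simp: finitely_supported_def)
  have "jacobi_apply a b u n = (\<Sum>m\<in>?S \<union> {n - 1, n, Suc n}. of_real (jacobi_entry a b n m) * u m)"
    unfolding jacobi_apply_def using assms fin
    by (auto intro!: sum.mono_neutral_left)
  also have "\<dots> = (\<Sum>m\<in>{n - 1, n, Suc n}. of_real (jacobi_entry a b n m) * u m)"
    using fin assms by (intro sum.mono_neutral_right) (auto simp: jacobi_entry_def)
  also have "\<dots> = of_real (b n) * u n + of_real (a n) * u (Suc n) + of_real (a (n - 1)) * u (n - 1)"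
  proof -
    obtain m where m: "n = Suc m" using assms(2) by (cases n) auto
    show ?thesis unfolding m by (simp add: jacobi_entry_def)
  qed
  finally show ?thesis .
qed

lemma jacobi_apply_0 [simp]: "jacobi_apply a b u 0 = 0"
  by (simp add: jacobi_apply_def)

lemma finitely_supported_lincomb:
  assumes "finitely_supported u" "finitely_supported v"
  shows "finitely_supported (\<lambda>n. u n + c * v n)"
  using assms unfolding finitely_supported_def
  by (auto intro: finite_subset[of _ "{n. u n \<noteq> 0} \<union> {n. v n \<noteq> 0}"])

lemma finitely_supported_jacobi_apply:
  assumes "finitely_supported u"
  shows "finitely_supported (jacobi_apply a b u)"
proof -
  let ?S = "{m. u m \<noteq> 0}"
  have "finite ?S" using assms by (simp add: finitely_supported_def)
  moreover have "{n. jacobi_apply a b u n \<noteq> 0} \<subseteq> ?S \<union> (\<lambda>m. m - 1) ` ?S \<union> Suc ` ?S"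
  proof
    fix n assume "n \<in> {n. jacobi_apply a b u n \<noteq> 0}"
    then have n: "jacobi_apply a b u n \<noteq> 0" by simp
    then have n1: "n \<ge> 1" by (cases n) auto
    from n have "u n \<noteq> 0 \<or> u (Suc n) \<noteq> 0 \<or> u (n - 1) \<noteq> 0"
      unfolding jacobi_apply_Suc[OF assms n1] by auto
    moreover have "n = Suc (n - 1)" "n = Suc n - 1" using n1 by auto
    ultimately show "n \<in> ?S \<union> (\<lambda>m. m - 1) ` ?S \<union> Suc ` ?S" by blast
  qed
  ultimately show ?thesis
    unfolding finitely_supported_def by (auto intro: finite_subset)
qed

lemma jacobi_apply_lincomb:
  assumes "finitely_supported u" "finitely_supported v"
  shows "jacobi_apply a b (\<lambda>n. u n + c * v n)
    = (\<lambda>n. jacobi_apply a b u n + c * jacobi_apply a b v n)"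
proof
  fix n show "jacobi_apply a b (\<lambda>n. u n + c * v n) n
    = jacobi_apply a b u n + c * jacobi_apply a b v n"
    using assms finitely_supported_lincomb[OF assms]
    by (cases "n = 0") (simp_all add: jacobi_apply_Suc algebra_simps)
qed

text \<open>
  Polarization evaluates the form of the operator at such combinations.
\<close>

lemma jacobi_operator_lincomb:
  assumes "(f, v) \<in> jacobi_operator a b" "(g, w) \<in> jacobi_operator a b"
  shows "(\<lambda>n. f n + c * g n, \<lambda>n. v n + c * w n) \<in> jacobi_operator a b"
proof -
  from assms obtain \<phi> \<psi> where
    1: "f \<in> ell2" "v \<in> ell2" "\<And>k. finitely_supported (\<phi> k)" "ell2_tendsto \<phi> f"
      "ell2_tendsto (\<lambda>k. jacobi_apply a b (\<phi> k)) v" and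
    2: "g \<in> ell2" "w \<in> ell2" "\<And>k. finitely_supported (\<psi> k)" "ell2_tendsto \<psi> g"
      "ell2_tendsto (\<lambda>k. jacobi_apply a b (\<psi> k)) w"
    unfolding jacobi_operator_def by auto
  have "ell2_tendsto (\<lambda>k n. \<phi> k n + c * \<psi> k n) (\<lambda>n. f n + c * g n)"
    using 1 2 by (intro ell2_tendsto_lincomb) (auto intro: finitely_supported_ell2)
  moreover have "ell2_tendsto (\<lambda>k n. jacobi_apply a b (\<phi> k) n + c * jacobi_apply a b (\<psi> k) n)
      (\<lambda>n. v n + c * w n)"
    using 1 2 by (intro ell2_tendsto_lincomb)
      (auto intro: finitely_supported_ell2 finitely_supported_jacobi_apply)
  ultimately have "(\<forall>k. finitely_supported (\<lambda>n. \<phi> k n + c * \<psi> k n)) \<and>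
      ell2_tendsto (\<lambda>k n. \<phi> k n + c * \<psi> k n) (\<lambda>n. f n + c * g n) \<and>
      ell2_tendsto (\<lambda>k. jacobi_apply a b (\<lambda>n. \<phi> k n + c * \<psi> k n)) (\<lambda>n. v n + c * w n)"
    using 1(3) 2(3) by (simp add: finitely_supported_lincomb jacobi_apply_lincomb)
  moreover have "(\<lambda>n. f n + c * g n) \<in> ell2" "(\<lambda>n. v n + c * w n) \<in> ell2"
    using 1 2 by (auto intro: ell2_add(1) ell2_scale(1))
  ultimately show ?thesis
    unfolding jacobi_operator_def mem_Collect_eq case_prod_conv
    by (intro conjI) (assumption+, rule exI)
qed

section \<open>Projection-valued measures\<close>

lemma ell2_norm_eq_0:
  assumes "u \<in> ell2" "ell2_norm u = 0"
  shows "u = (\<lambda>n. 0)"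
proof
  fix n
  have "(\<Sum>n. (cmod (u n))\<^sup>2) = 0"
    using ell2_norm_sq[OF assms(1)] assms(2) by simp
  then show "u n = 0"
    using suminf_eq_zero_iff[OF ell2_summable[OF assms(1)]] by simp
qed

lemma ell2_zero: "(\<lambda>n. 0) \<in> ell2" "ell2_norm (\<lambda>n. 0) = 0"
  by (simp_all add: ell2_def ell2_norm_def)

lemma ell2_tendsto_const_unique:
  assumes "w \<in> ell2" "u \<in> ell2" "ell2_tendsto \<phi> u" "eventually (\<lambda>k. \<phi> k = w) sequentially"
  shows "w = u"
proof -
  have "(\<lambda>k. ell2_norm (\<lambda>n. w n - u n)) \<longlonglongrightarrow> 0"
    using assms(3)[unfolded ell2_tendsto_def]
    by (rule Lim_transform_eventually) (use assms(4) in \<open>auto elim: eventually_mono\<close>)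
  then have "ell2_norm (\<lambda>n. w n - u n) = 0"
    by (simp add: LIMSEQ_const_iff)
  from ell2_norm_eq_0[OF ell2_diff[OF assms(1,2)] this] show ?thesis
    by (auto simp: fun_eq_iff)
qed

locale pvm =
  fixes E :: "real set \<Rightarrow> (nat \<Rightarrow> complex) \<Rightarrow> nat \<Rightarrow> complex"
  assumes pvm: "projection_valued_measure E"
begin

lemma proj: "B \<in> sets borel \<Longrightarrow> orthogonal_projection (E B)"
  using pvm by (simp add: projection_valued_measure_def)

lemma E_ell2 [simp, intro]: "B \<in> sets borel \<Longrightarrow> u \<in> ell2 \<Longrightarrow> E B u \<in> ell2"
  using proj by (simp add: orthogonal_projection_def)

lemma E_idem: "B \<in> sets borel \<Longrightarrow> u \<in> ell2 \<Longrightarrow> E B (E B u) = E B u"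
  using proj by (simp add: orthogonal_projection_def)

lemma E_add: "B \<in> sets borel \<Longrightarrow> u \<in> ell2 \<Longrightarrow> v \<in> ell2 \<Longrightarrow>
    E B (\<lambda>n. u n + v n) = (\<lambda>n. E B u n + E B v n)"
  using proj[of B] unfolding orthogonal_projection_def by blast

lemma E_scale: "B \<in> sets borel \<Longrightarrow> u \<in> ell2 \<Longrightarrow> E B (\<lambda>n. c * u n) = (\<lambda>n. c * E B u n)"
  using proj[of B] unfolding orthogonal_projection_def by blast

lemma E_lincomb: "B \<in> sets borel \<Longrightarrow> u \<in> ell2 \<Longrightarrow> v \<in> ell2 \<Longrightarrow>
    E B (\<lambda>n. u n + c * v n) = (\<lambda>n. E B u n + c * E B v n)"
  by (simp add: E_add E_scale ell2_scale)

lemma E_sym: "B \<in> sets borel \<Longrightarrow> u \<in> ell2 \<Longrightarrow> v \<in> ell2 \<Longrightarrow>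
    ell2_inner (E B u) v = ell2_inner u (E B v)"
  using proj[of B] unfolding orthogonal_projection_def by blast

lemma E_UNIV: "u \<in> ell2 \<Longrightarrow> E UNIV u = u"
  using pvm by (simp add: projection_valued_measure_def)

lemma E_sums: "range B \<subseteq> sets borel \<Longrightarrow> disjoint_family B \<Longrightarrow> u \<in> ell2 \<Longrightarrow>
    ell2_tendsto (\<lambda>k n. \<Sum>i<k. E (B i) u n) (E (\<Union>i::nat. B i) u)"
  using pvm unfolding projection_valued_measure_def by blast

text \<open>
  The partial sums for the constant family of empty sets are the multiples \<open>k * E {} u\<close>, which converge only
  if \<open>E {} u = 0\<close>.
\<close>

lemma E_empty:
  assumes "u \<in> ell2"
  shows "E {} u = (\<lambda>n. 0)"
proof -
  let ?x = "E {} u"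
  have x: "?x \<in> ell2" using assms by auto
  have "ell2_tendsto (\<lambda>k n. \<Sum>i<k. ?x n) ?x"
    using E_sums[of "\<lambda>i. {}" u] assms by (simp add: disjoint_family_on_def)
  moreover have "(\<lambda>n. \<Sum>i<k. ?x n) \<in> ell2" for k :: nat
    using ell2_scale(1)[OF x, of "of_nat k"] by simp
  ultimately have "(\<lambda>k. (ell2_norm (\<lambda>n. (\<Sum>i<k. ?x n) - ?x n))\<^sup>2) \<longlonglongrightarrow> 0"
    using iffD1[OF ell2_tendsto_iff_sq[of "\<lambda>k n. \<Sum>i<k. ?x n" ?x, OF _ x]] by fast
  moreover have "(ell2_norm (\<lambda>n. (\<Sum>i<k. ?x n) - ?x n))\<^sup>2 = (real k - 1)\<^sup>2 * (ell2_norm ?x)\<^sup>2" for k :: nat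
  proof -
    have "(\<lambda>n. (\<Sum>i<k. ?x n) - ?x n) = (\<lambda>n. of_real (real k - 1) * ?x n)"
      by (auto simp: algebra_simps)
    then show ?thesis
      using ell2_scale(2)[OF x, of "of_real (real k - 1)"] by (simp only: norm_of_real power2_abs)
  qed
  ultimately have l: "(\<lambda>k. (real k - 1)\<^sup>2 * (ell2_norm ?x)\<^sup>2) \<longlonglongrightarrow> 0" by (simp only:)
  have "(ell2_norm ?x)\<^sup>2 \<le> 0"
  proof (rule LIMSEQ_le_const[OF l], intro exI allI impI)
    fix k :: nat assume "2 \<le> k"
    then have "1 \<le> (real k - 1)\<^sup>2" by (simp add: one_le_power)
    then show "(ell2_norm ?x)\<^sup>2 \<le> (real k - 1)\<^sup>2 * (ell2_norm ?x)\<^sup>2"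
      by (simp add: mult_le_cancel_right1)
  qed
  then show ?thesis using ell2_norm_eq_0[OF x] by simp
qed

lemma E_Un:
  assumes "B \<in> sets borel" "C \<in> sets borel" "B \<inter> C = {}" "u \<in> ell2"
  shows "E (B \<union> C) u = (\<lambda>n. E B u n + E C u n)"
proof -
  let ?F = "\<lambda>i::nat. if i = 0 then B else if i = 1 then C else {}"
  have U: "(\<Union>i. ?F i) = B \<union> C"
  proof
    show "B \<union> C \<subseteq> (\<Union>i. ?F i)"
    proof
      fix x assume "x \<in> B \<union> C"
      then have "x \<in> ?F 0 \<or> x \<in> ?F 1" by auto
      then show "x \<in> (\<Union>i. ?F i)" by blast
    qed
  qed (auto split: if_splits)
  have "ell2_tendsto (\<lambda>k n. \<Sum>i<k. E (?F i) u n) (E (\<Union>i. ?F i) u)"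
    using assms by (intro E_sums) (auto simp: disjoint_family_on_def)
  then have t: "ell2_tendsto (\<lambda>k n. \<Sum>i<k. E (?F i) u n) (E (B \<union> C) u)" unfolding U .
  have "(\<lambda>n. \<Sum>i<k. E (?F i) u n) = (\<lambda>n. E B u n + E C u n)" if "k \<ge> 2" for k
  proof
    fix n
    have "(\<Sum>i<k. E (?F i) u n) = (\<Sum>i\<in>{0,1}. E (?F i) u n)"
      using that assms(4) by (intro sum.mono_neutral_right) (auto simp: E_empty)
    then show "(\<Sum>i<k. E (?F i) u n) = E B u n + E C u n" by simp
  qed
  then have "eventually (\<lambda>k. (\<lambda>n. \<Sum>i<k. E (?F i) u n) = (\<lambda>n. E B u n + E C u n)) sequentially"
    unfolding eventually_sequentially by blast
  from ell2_tendsto_const_unique[OF _ _ t this] assms show ?thesis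
    by (metis E_ell2 ell2_add(1) sets.Un)
qed

text \<open>
  Let \<open>P\<close>, \<open>Q\<close> be the two projections.  Their sum is a projection, so \<open>P Q + Q P = 0\<close>.  Applied to a vector in
  the range of \<open>Q\<close> this is \<open>P Q = - Q P Q\<close>; another application of \<open>Q\<close> gives \<open>Q P Q = - Q P Q\<close>, hence \<open>P Q = 0\<close>.
\<close>

lemma E_disjoint:
  assumes "B \<in> sets borel" "C \<in> sets borel" "B \<inter> C = {}" "u \<in> ell2"
  shows "E B (E C u) = (\<lambda>n. 0)"
proof -
  let ?P = "E B" and ?Q = "E C"
  have PQ: "(\<lambda>n. ?P v n + ?Q v n) = E (B \<union> C) v" if "v \<in> ell2" for v
    using E_Un[OF assms(1-3) that] by simp
  have U: "B \<union> C \<in> sets borel" using assms by auto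
  have anti: "?P (?Q v) n + ?Q (?P v) n = 0" if v: "v \<in> ell2" for v n
  proof -
    let ?w = "\<lambda>n. ?P v n + ?Q v n"
    have w: "?w \<in> ell2" using assms v by (auto intro: ell2_add(1))
    have "(\<lambda>n. ?P ?w n + ?Q ?w n) = ?w"
      unfolding PQ[OF w] unfolding PQ[OF v] by (rule E_idem[OF U v])
    moreover have "?P ?w = (\<lambda>n. ?P v n + ?P (?Q v) n)" "?Q ?w = (\<lambda>n. ?Q (?P v) n + ?Q v n)"
      using assms v by (simp_all add: E_add E_idem)
    ultimately show ?thesis by (auto simp: fun_eq_iff algebra_simps)
  qed
  have Qu: "?Q u \<in> ell2" using assms by auto
  have e1: "?P (?Q u) n = - ?Q (?P (?Q u)) n" for n
    using anti[OF Qu, of n] assms by (simp add: E_idem eq_neg_iff_add_eq_0)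
  then have f: "?P (?Q u) = (\<lambda>n. (-1) * ?Q (?P (?Q u)) n)" by auto
  have "?Q (?P (?Q u)) = (\<lambda>n. (-1) * ?Q (?Q (?P (?Q u))) n)"
    by (subst f) (use assms in \<open>simp only: E_scale E_ell2\<close>)
  then have "?Q (?P (?Q u)) n = - ?Q (?P (?Q u)) n" for n
    using assms by (simp add: E_idem fun_eq_iff)
  then have "?Q (?P (?Q u)) n = 0" for n by simp
  then show ?thesis using e1 by auto
qed

lemma inner_E_self:
  assumes "B \<in> sets borel" "u \<in> ell2"
  shows "ell2_inner (E B u) u = of_real ((ell2_norm (E B u))\<^sup>2)"
proof -
  have "ell2_inner (E B u) u = ell2_inner (E B u) (E B u)"
    using E_sym[of B "E B u" u] assms by (simp add: E_idem)
  then show ?thesis using assms by (simp add: ell2_inner_self)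
qed

lemma sets_scalar [simp]: "sets (scalar_measure E u) = sets borel"
  unfolding scalar_measure_def using sets.sigma_sets_eq[of "borel :: real measure"]
  by (simp add: sets_measure_of_conv)

lemma space_scalar [simp]: "space (scalar_measure E u) = UNIV"
  unfolding scalar_measure_def by (simp add: space_measure_of_conv)

text \<open>
  Countable additivity of \<open>E\<close> in norm passes to the quadratic form by continuity of the inner product.
\<close>

lemma emeasure_scalar:
  assumes "B \<in> sets borel" "u \<in> ell2"
  shows "emeasure (scalar_measure E u) B = ennreal ((ell2_norm (E B u))\<^sup>2)"
proof -
  let ?\<mu> = "\<lambda>B. ennreal (Re (ell2_inner (E B u) u))"
  have "emeasure (scalar_measure E u) B = ?\<mu> B"
  proof (rule emeasure_measure_of[OF scalar_measure_def])
    show "positive (sets (scalar_measure E u)) ?\<mu>"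
      using assms(2) by (simp add: positive_def E_empty ell2_inner_def)
    show "countably_additive (sets (scalar_measure E u)) ?\<mu>"
    proof (rule countably_additiveI)
      fix A :: "nat \<Rightarrow> real set"
      assume A: "range A \<subseteq> sets (scalar_measure E u)" "disjoint_family A"
      then have Ab: "A i \<in> sets borel" for i by auto
      have UA: "(\<Union>i. A i) \<in> sets borel" using Ab by auto
      have m: "(\<lambda>n. \<Sum>i<k. E (A i) u n) \<in> ell2" for k
      proof (induction k)
        case (Suc k)
        then show ?case using ell2_add(1)[OF Suc E_ell2[OF Ab assms(2)]] by simp
      qed (simp add: ell2_zero)
      have "(\<lambda>k. ell2_inner (\<lambda>n. \<Sum>i<k. E (A i) u n) u) \<longlonglongrightarrow> ell2_inner (E (\<Union>i. A i) u) u"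
        using A Ab UA assms(2) m by (intro ell2_inner_tendsto E_sums) auto
      moreover have "ell2_inner (\<lambda>n. \<Sum>i<k. E (A i) u n) u = (\<Sum>i<k. ell2_inner (E (A i) u) u)" for k
      proof (induction k)
        case (Suc k)
        then show ?case
          using ell2_inner_add_left[OF m E_ell2[OF Ab assms(2)] assms(2), of k] by simp
      qed (simp add: ell2_inner_def)
      ultimately have "(\<lambda>i. ell2_inner (E (A i) u) u) sums ell2_inner (E (\<Union>i. A i) u) u"
        by (simp add: sums_def)
      then have s: "(\<lambda>i. Re (ell2_inner (E (A i) u) u)) sums Re (ell2_inner (E (\<Union>i. A i) u) u)"
        by (rule sums_Re)
      show "(\<Sum>i. ?\<mu> (A i)) = ?\<mu> (\<Union>i. A i)"
        using s Ab assms(2) by (intro suminf_ennreal_eq) (simp_all add: inner_E_self)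
    qed
  qed (use assms in auto)
  then show ?thesis using assms by (simp add: inner_E_self)
qed

lemma measure_scalar:
  "B \<in> sets borel \<Longrightarrow> u \<in> ell2 \<Longrightarrow> measure (scalar_measure E u) B = (ell2_norm (E B u))\<^sup>2"
  by (simp add: measure_def emeasure_scalar)

lemma finite_scalar: "u \<in> ell2 \<Longrightarrow> finite_measure (scalar_measure E u)"
  by (rule finite_measureI) (simp add: emeasure_scalar)

end

section \<open>The resolvent as a Stieltjes transform\<close>

context pvm begin

text \<open>
  On the range of \<open>E B\<close> the operator is multiplication by \<open>x0\<close> up to an error of size \<open>\<delta>\<close>.  Polarization expresses
  the left-hand side by the forms of the four vectors \<open>f + c * E B e\<close> with \<open>c\<^sup>4 = 1\<close>.  Outside \<open>B\<close> the four scalar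
  measures agree, so their contributions cancel, and on \<open>B\<close> the integrand \<open>x - x0\<close> is bounded by \<open>\<delta>\<close>.
\<close>

lemma spectral_localization:
  assumes sp: "spectral_measure_of E (jacobi_operator a b)"
    and fv: "(f, v) \<in> jacobi_operator a b" and e: "e \<in> ell2"
    and B: "B \<in> sets borel" "B \<subseteq> {x0 - \<delta>..x0 + \<delta>}" "\<delta> \<ge> 0"
  shows "cmod (ell2_inner v (E B e) - of_real x0 * ell2_inner f (E B e))
    \<le> 2 * \<delta> * ((ell2_norm (E B f))\<^sup>2 + (ell2_norm (E B e))\<^sup>2)"
proof -
  define h where "h = E B e"
  define \<Lambda> where "\<Lambda> = (ell2_norm (E B f))\<^sup>2 + (ell2_norm h)\<^sup>2"
  have h: "h \<in> ell2" and Eh: "E B h = h"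
    using B e by (auto simp: h_def E_idem)
  have f: "f \<in> ell2" and v: "v \<in> ell2" using fv by (auto simp: jacobi_operator_def)
  have Bc: "-B \<in> sets borel" using B by auto
  have hB: "E C h = (\<lambda>n. 0)" if "C \<in> sets borel" "C \<inter> B = {}" for C
    using E_disjoint[OF that(1) B(1) that(2) e] by (simp add: h_def)
  interpret mh: finite_measure "scalar_measure E h" using h by (rule finite_scalar)
  have "AE x in scalar_measure E h. x \<in> B"
  proof (rule AE_I)
    show "{x \<in> space (scalar_measure E h). x \<notin> B} \<subseteq> -B" by auto
    show "emeasure (scalar_measure E h) (- B) = 0"
      using Bc h hB[OF Bc] by (simp add: emeasure_scalar ell2_zero)
  qed (use Bc in auto)
  then have "AE x in scalar_measure E h. norm (x\<^sup>2) \<le> (\<bar>x0\<bar> + \<delta>)\<^sup>2"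
  proof (rule AE_mp, intro AE_I2 impI)
    fix x assume "x \<in> B"
    then have "\<bar>x\<bar> \<le> \<bar>x0\<bar> + \<delta>" using subsetD[OF B(2)] by fastforce
    then show "norm (x\<^sup>2) \<le> (\<bar>x0\<bar> + \<delta>)\<^sup>2"
      using power_mono[of "\<bar>x\<bar>" "\<bar>x0\<bar> + \<delta>" 2] by simp
  qed
  then have "integrable (scalar_measure E h) (\<lambda>x. x\<^sup>2)"
    by (intro mh.integrable_const_bound) (auto simp: measurable_cong_sets[OF sets_scalar refl])
  then obtain vh where vh: "(h, vh) \<in> jacobi_operator a b"
    using sp h unfolding spectral_measure_of_def by auto
  then have vh': "vh \<in> ell2" by (auto simp: jacobi_operator_def)
  define g where "g c = (\<lambda>n. f n + c * h n)" for c
  have g: "g c \<in> ell2" for c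
    unfolding g_def using f h by (intro ell2_add(1) ell2_scale(1))
  have gv: "(g c, \<lambda>n. v n + c * vh n) \<in> jacobi_operator a b" for c
    unfolding g_def by (rule jacobi_operator_lincomb[OF fv vh])
  define \<mu> where "\<mu> c = scalar_measure E (g c)" for c
  have sets\<mu>: "sets (\<mu> c) = sets borel" for c by (simp add: \<mu>_def)
  note [measurable_cong] = sets\<mu>
  have Bm [measurable]: "B \<in> sets borel" by fact
  have fin: "finite_measure (\<mu> c)" for c unfolding \<mu>_def using g by (rule finite_scalar)
  have int: "integrable (\<mu> c) (\<lambda>x. x)" for c
  proof -
    interpret finite_measure "\<mu> c" by (rule fin)
    have "g c \<in> Domain (jacobi_operator a b)" using gv by auto
    then have i2: "integrable (\<mu> c) (\<lambda>x. x\<^sup>2)"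
      using sp unfolding spectral_measure_of_def \<mu>_def by auto
    have "integrable (\<mu> c) (\<lambda>x. 1 + x\<^sup>2)" using i2 by (intro Bochner_Integration.integrable_add) auto
    then show ?thesis
    proof (rule Bochner_Integration.integrable_bound)
      have "\<bar>x\<bar> \<le> 1 + x\<^sup>2" for x :: real
        using zero_le_power2[of "\<bar>x\<bar> - 1"] zero_le_power2[of x] by (simp add: power2_diff)
      then show "AE x in \<mu> c. norm x \<le> norm (1 + x\<^sup>2)" by (auto intro!: AE_I2)
    qed simp
  qed
  have form: "ell2_inner (\<lambda>n. v n + c * vh n) (g c) = of_real (integral\<^sup>L (\<mu> c) (\<lambda>x. x))" for c
    using sp gv[of c] unfolding spectral_measure_of_def \<mu>_def by auto
  have mass: "ell2_inner (g c) (g c) = of_real (measure (\<mu> c) UNIV)" for c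
    using g by (simp add: ell2_inner_self \<mu>_def measure_scalar E_UNIV)
  \<comment> \<open>\<open>J\<close> and \<open>I\<close> are the parts of the shifted form outside and inside \<open>B\<close>.\<close>
  define J where "J c = integral\<^sup>L (\<mu> c) (\<lambda>x. indicator (-B) x * (x - x0))" for c
  define I where "I c = integral\<^sup>L (\<mu> c) (\<lambda>x. indicator B x * (x - x0))" for c
  have intx0: "integrable (\<mu> c) (\<lambda>x. x - x0)" for c
    using int finite_measure.integrable_const[OF fin] by (intro Bochner_Integration.integrable_diff)
  have split: "integral\<^sup>L (\<mu> c) (\<lambda>x. x) - x0 * measure (\<mu> c) UNIV = I c + J c" for c
  proof -
    interpret finite_measure "\<mu> c" by (rule fin)
    have sp: "space (\<mu> c) = UNIV" by (simp add: \<mu>_def)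
    have "integrable (\<mu> c) (\<lambda>x. indicator B x * (x - x0))"
      "integrable (\<mu> c) (\<lambda>x. indicator (-B) x * (x - x0))"
      using integrable_mult_indicator[OF _ intx0[of c], of B]
        integrable_mult_indicator[OF _ intx0[of c], of "-B"] Bm Bc by (simp_all add: sets\<mu>)
    then have "I c + J c = integral\<^sup>L (\<mu> c) (\<lambda>x. indicator B x * (x - x0) + indicator (-B) x * (x - x0))"
      unfolding I_def J_def by simp
    also have "\<dots> = integral\<^sup>L (\<mu> c) (\<lambda>x. x - x0)"
      by (intro Bochner_Integration.integral_cong) (auto simp: indicator_def)
    also have "\<dots> = integral\<^sup>L (\<mu> c) (\<lambda>x. x) - x0 * measure (\<mu> c) UNIV"
      using int by (simp add: sp)
    finally show ?thesis by simp
  qed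
  have Jc: "J c = J 0" for c
  proof -
    have "density (\<mu> c) (\<lambda>x. ennreal (indicator (-B) x)) = density (\<mu> 0) (\<lambda>x. ennreal (indicator (-B) x))"
    proof (rule measure_eqI)
      fix C assume "C \<in> sets (density (\<mu> c) (\<lambda>x. ennreal (indicator (-B) x)))"
      then have C: "C \<in> sets borel" by (simp add: sets\<mu>)
      then have m: "-B \<inter> C \<in> sets borel" using Bc by auto
      have *: "emeasure (density (\<mu> d) (\<lambda>x. ennreal (indicator (-B) x))) C
          = ennreal ((ell2_norm (E (-B \<inter> C) f))\<^sup>2)" for d
      proof -
        have "emeasure (density (\<mu> d) (\<lambda>x. ennreal (indicator (-B) x))) C = emeasure (\<mu> d) (-B \<inter> C)"
          unfolding ennreal_indicator using C Bc by (intro emeasure_restricted) (simp_all add: sets\<mu>)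
        also have "\<dots> = ennreal ((ell2_norm (E (-B \<inter> C) (g d)))\<^sup>2)"
          unfolding \<mu>_def using m g by (rule emeasure_scalar)
        also have "E (-B \<inter> C) (g d) = E (-B \<inter> C) f"
          unfolding g_def E_lincomb[OF m f h] using hB[OF m] by auto
        finally show ?thesis .
      qed
      show "emeasure (density (\<mu> c) (\<lambda>x. ennreal (indicator (-B) x))) C
          = emeasure (density (\<mu> 0) (\<lambda>x. ennreal (indicator (-B) x))) C"
        unfolding * ..
    qed (simp add: sets\<mu>)
    moreover have "J d = integral\<^sup>L (density (\<mu> d) (\<lambda>x. ennreal (indicator (-B) x))) (\<lambda>x. x - x0)" for d
      unfolding J_def using Bc by (subst integral_density) (auto simp: measurable_cong_sets[OF sets\<mu> refl])
    ultimately show ?thesis by simp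
  qed
  have Ic: "\<bar>I c\<bar> \<le> \<delta> * (2 * \<Lambda>)" if "cmod c = 1" for c
  proof -
    interpret finite_measure "\<mu> c" by (rule fin)
    have "\<bar>I c\<bar> \<le> integral\<^sup>L (\<mu> c) (\<lambda>x. \<delta> * indicator B x)"
      unfolding I_def real_norm_def[symmetric]
    proof (rule Bochner_Integration.integral_norm_bound_integral)
      show "integrable (\<mu> c) (\<lambda>x. indicator B x * (x - x0))"
        using integrable_mult_indicator[OF _ intx0[of c], of B] Bm by (simp add: sets\<mu>)
      show "norm (indicator B x * (x - x0)) \<le> \<delta> * indicator B x" for x
        using B by (auto simp: indicator_def abs_le_iff)
      show "integrable (\<mu> c) (\<lambda>x. \<delta> * indicator B x)"
        using Bm by (intro integrable_mult_right) (simp add: sets\<mu> integrable_indicator_iff less_top[symmetric])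
    qed
    also have "\<dots> = \<delta> * measure (\<mu> c) B"
      by (simp add: \<mu>_def)
    also have "measure (\<mu> c) B = (ell2_norm (E B (g c)))\<^sup>2"
      unfolding \<mu>_def using Bm g by (rule measure_scalar)
    also have "E B (g c) = (\<lambda>n. E B f n + c * h n)"
      unfolding g_def E_lincomb[OF Bm f h] Eh ..
    also have "(ell2_norm (\<lambda>n. E B f n + c * h n))\<^sup>2 \<le> 2 * \<Lambda>"
      using ell2_add(2)[OF E_ell2[OF Bm f] ell2_scale(1)[OF h, of c]] ell2_scale(2)[OF h, of c] that
      by (simp add: \<Lambda>_def)
    finally show ?thesis using B(3) by (simp add: mult_left_mono)
  qed
  \<comment> \<open>Polarization: weighting with \<open>c\<close> keeps only the term that is conjugate-linear in \<open>h\<close>.\<close>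
  let ?X = "\<lambda>c. of_real (I c + J 0) :: complex"
  have X: "?X c = ell2_inner (\<lambda>n. v n + c * vh n) (g c) - of_real x0 * ell2_inner (g c) (g c)" for c
    unfolding form mass by (simp add: split[symmetric] Jc[symmetric, of c])
  have expand: "ell2_inner (\<lambda>n. y n + c * z n) (g c)
      = ell2_inner y f + c * ell2_inner z f + cnj c * ell2_inner y h + c * cnj c * ell2_inner z h"
    if "y \<in> ell2" "z \<in> ell2" for y z c
    unfolding g_def using that f h
    by (simp add: ell2_inner_add_left ell2_inner_add_right ell2_inner_scale_left
        ell2_inner_scale_right ell2_add ell2_scale algebra_simps)
  have expand': "ell2_inner (g c) (g c)
      = ell2_inner f f + c * ell2_inner h f + cnj c * ell2_inner f h + c * cnj c * ell2_inner h h" for c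
    using expand[OF f h] by (simp add: g_def)
  have "1 * ?X 1 + \<i> * ?X \<i> + (-1) * ?X (-1) + (-\<i>) * ?X (-\<i>)
      = 4 * (ell2_inner v h - of_real x0 * ell2_inner f h)"
    unfolding X expand[OF v vh'] expand' by (simp add: algebra_simps)
  also have "1 * ?X 1 + \<i> * ?X \<i> + (-1) * ?X (-1) + (-\<i>) * ?X (-\<i>)
      = of_real (I 1) + \<i> * of_real (I \<i>) + (-1) * of_real (I (-1)) + (-\<i>) * of_real (I (-\<i>))"
    by (simp add: algebra_simps)
  finally have "4 * (ell2_inner v h - of_real x0 * ell2_inner f h)
      = of_real (I 1) + \<i> * of_real (I \<i>) + (-1) * of_real (I (-1)) + (-\<i>) * of_real (I (-\<i>))" ..
  then have "4 * cmod (ell2_inner v h - of_real x0 * ell2_inner f h)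
      = cmod (of_real (I 1) + \<i> * of_real (I \<i>) + (-1) * of_real (I (-1)) + (-\<i>) * of_real (I (-\<i>)))"
    by (simp only: norm_mult[symmetric] flip: norm_numeral[where 'a=complex])
  also have "\<dots> \<le> \<bar>I 1\<bar> + \<bar>I \<i>\<bar> + \<bar>I (-1)\<bar> + \<bar>I (-\<i>)\<bar>"
    by (intro norm_triangle_le add_mono) (simp_all add: norm_mult)
  also have "\<dots> \<le> \<delta> * (2 * \<Lambda>) + \<delta> * (2 * \<Lambda>) + \<delta> * (2 * \<Lambda>) + \<delta> * (2 * \<Lambda>)"
    by (intro add_mono Ic) auto
  finally show ?thesis by (simp add: h_def[symmetric] \<Lambda>_def[symmetric] mult_ac)
qed

text \<open>
  The form of the operator takes real values.
\<close>

lemma nonreal_not_eigenvalue: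
  assumes sp: "spectral_measure_of E (jacobi_operator a b)"
    and fv: "(f, \<lambda>n. z * f n) \<in> jacobi_operator a b" and "Im z \<noteq> 0"
  shows "f = (\<lambda>n. 0)"
proof -
  have f: "f \<in> ell2" using fv by (auto simp: jacobi_operator_def)
  have "ell2_inner (\<lambda>n. z * f n) f = of_real (integral\<^sup>L (scalar_measure E f) (\<lambda>x. x))"
    using sp fv unfolding spectral_measure_of_def by auto
  then have "z * of_real ((ell2_norm f)\<^sup>2) = of_real (integral\<^sup>L (scalar_measure E f) (\<lambda>x. x))"
    using f by (simp only: ell2_inner_scale_left ell2_inner_self)
  from arg_cong[OF this, of Im] have "Im z * (ell2_norm f)\<^sup>2 = 0"
    by (simp del: of_real_power)
  then show ?thesis using assms(3) ell2_norm_eq_0[OF f] by simp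
qed

end

lemma Im_inverse_eq: "Im (1 / (of_real x - z)) = Im z / (cmod (of_real x - z))\<^sup>2"
  by (simp add: Im_divide cmod_power2)

context pvm begin

text \<open>
  Let \<open>v = z f + e1\<close>.  If \<open>B\<close> lies within \<open>\<delta>\<close> of \<open>x0\<close>, localization says that \<open>(f, E B e1)\<close> is
  \<open>(E B e1, e1) / (x0 - z)\<close> up to \<open>\<delta>\<close> times the masses of \<open>B\<close> under the scalar measures of \<open>f\<close> and \<open>e1\<close>.
  These masses are additive, so the errors over a partition of \<open>[-M, M)\<close> into cells of length \<open>\<delta>\<close> add up to
  \<open>O(\<delta>)\<close>.  Then \<open>\<delta>\<close> tends to zero and \<open>M\<close> to infinity.
\<close>

lemma resolvent_Stieltjes:
  assumes sp: "spectral_measure_of E (jacobi_operator a b)"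
    and fz: "(f, \<lambda>n. z * f n + e1 n) \<in> jacobi_operator a b" and z: "Im z > 0"
  shows "Im (f 1) = integral\<^sup>L (scalar_measure E e1) (\<lambda>x. Im (1 / (of_real x - z)))"
proof -
  have f: "f \<in> ell2" using fz by (auto simp: jacobi_operator_def)
  define y where "y = Im z"
  have y: "y > 0" using z by (simp add: y_def)
  define \<mu> where "\<mu> = scalar_measure E e1"
  interpret finite_measure \<mu> unfolding \<mu>_def by (rule finite_scalar[OF ell2_e1])
  have sets\<mu>: "sets \<mu> = sets borel" and sp\<mu>: "space \<mu> = UNIV" by (simp_all add: \<mu>_def)
  note ms = measurable_cong_sets[OF sets\<mu> refl]
  define k where "k x = Im (1 / (of_real x - z))" for x :: real
  have dist: "cmod (of_real x - z) \<ge> y" for x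
    using abs_Im_le_cmod[of "of_real x - z"] y by (simp add: y_def)
  have nz: "of_real x - z \<noteq> 0" for x :: real using dist[of x] y by auto
  have kb: "\<bar>k x\<bar> \<le> 1 / y" for x
  proof -
    have "\<bar>k x\<bar> \<le> cmod (1 / (of_real x - z))" unfolding k_def by (rule abs_Im_le_cmod)
    also have "\<dots> \<le> 1 / y" using dist[of x] y by (simp add: norm_divide frac_le)
    finally show ?thesis .
  qed
  have kdiff: "\<bar>k x - k x'\<bar> \<le> \<bar>x - x'\<bar> / y\<^sup>2" for x x'
  proof -
    have "k x - k x' = Im (1 / (of_real x - z) - 1 / (of_real x' - z))" by (simp add: k_def)
    then have "\<bar>k x - k x'\<bar> \<le> cmod (1 / (of_real x - z) - 1 / (of_real x' - z))"
      using abs_Im_le_cmod by presburger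
    also have "1 / (of_real x - z) - 1 / (of_real x' - z)
        = of_real (x' - x) / ((of_real x - z) * (of_real x' - z))"
      using nz[of x] nz[of x'] by (simp add: field_simps)
    also have "cmod \<dots> \<le> \<bar>x - x'\<bar> / (y * y)"
      unfolding norm_divide norm_mult norm_of_real
      using dist[of x] dist[of x'] y by (intro frac_le mult_mono) (auto simp: abs_minus_commute)
    finally show ?thesis by (simp add: power2_eq_square)
  qed
  have km [measurable]: "k \<in> borel_measurable borel"
  proof (intro borel_measurable_continuous_onI)
    show "continuous_on UNIV k" unfolding k_def using nz by (intro continuous_intros) auto
  qed
  have kint: "integrable \<mu> k"
    using kb by (intro integrable_const_bound[of _ "1 / y"]) (auto simp: ms)
  have kintB: "integrable \<mu> (\<lambda>x. indicator B x * k x)" if "B \<in> sets borel" for B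
    using integrable_mult_indicator[OF _ kint, of B] that by (simp add: sets\<mu>)
  \<comment> \<open>\<open>\<nu> B\<close> is the discrepancy on \<open>B\<close>, and \<open>L B\<close> the mass that controls it.\<close>
  define \<nu> where "\<nu> B = Im (ell2_inner f (E B e1)) - integral\<^sup>L \<mu> (\<lambda>x. indicator B x * k x)" for B
  define L where "L B = (ell2_norm (E B f))\<^sup>2 + (ell2_norm (E B e1))\<^sup>2" for B
  have L_alt: "L B = measure (scalar_measure E f) B + measure \<mu> B" if "B \<in> sets borel" for B
    unfolding L_def \<mu>_def using that f ell2_e1 by (simp add: measure_scalar)
  have L_nonneg: "L B \<ge> 0" for B by (simp add: L_def)
  define C where "C = 2 / y + 1 / y\<^sup>2"
  have Cpos: "C > 0" using y by (simp add: C_def add_pos_pos)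
  have \<nu>_small: "\<bar>\<nu> B\<bar> \<le> C * \<delta> * L B"
    if B: "B \<in> sets borel" "B \<subseteq> {x0 - \<delta>..x0 + \<delta>}" "\<delta> \<ge> 0" for B x0 \<delta>
  proof -
    let ?h = "E B e1" and ?m = "measure \<mu> B"
    have h: "?h \<in> ell2" using B ell2_e1 by auto
    have m: "ell2_inner e1 ?h = of_real ?m"
      using E_sym[OF B(1) ell2_e1 ell2_e1] inner_E_self[OF B(1) ell2_e1] B
      by (simp add: \<mu>_def measure_scalar ell2_e1)
    have "cmod (ell2_inner (\<lambda>n. z * f n + e1 n) ?h - of_real x0 * ell2_inner f ?h) \<le> 2 * \<delta> * L B"
      unfolding L_def by (rule spectral_localization[OF sp fz ell2_e1 B])
    also have "ell2_inner (\<lambda>n. z * f n + e1 n) ?h - of_real x0 * ell2_inner f ?h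
        = of_real ?m - (of_real x0 - z) * ell2_inner f ?h"
      using f h ell2_e1 by (simp add: ell2_inner_add_left ell2_inner_scale_left ell2_scale m algebra_simps)
    finally have 1: "cmod (of_real ?m - (of_real x0 - z) * ell2_inner f ?h) \<le> 2 * \<delta> * L B" .
    have "of_real ?m / (of_real x0 - z) - ell2_inner f ?h
        = (of_real ?m - (of_real x0 - z) * ell2_inner f ?h) / (of_real x0 - z)"
      using nz[of x0] by (simp add: field_simps)
    then have "cmod (of_real ?m / (of_real x0 - z) - ell2_inner f ?h) \<le> (2 * \<delta> * L B) / y"
      unfolding norm_divide using 1 dist[of x0] y L_nonneg[of B] B(3)
      by (simp add: norm_divide frac_le)
    then have 2: "\<bar>?m * k x0 - Im (ell2_inner f ?h)\<bar> \<le> (2 * \<delta> * L B) / y"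
      using abs_Im_le_cmod[of "of_real ?m / (of_real x0 - z) - ell2_inner f ?h"]
      by (simp add: k_def Im_divide)
    have "integral\<^sup>L \<mu> (\<lambda>x. indicator B x * k x0) = ?m * k x0"
      using B by (simp add: sets\<mu> sp\<mu>)
    moreover have "integrable \<mu> (\<lambda>x. indicator B x * k x0)"
      using B by (intro integrable_mult_left) (simp add: sets\<mu> sp\<mu> integrable_indicator_iff less_top[symmetric])
    ultimately have "integral\<^sup>L \<mu> (\<lambda>x. indicator B x * k x) - ?m * k x0
        = integral\<^sup>L \<mu> (\<lambda>x. indicator B x * k x - indicator B x * k x0)"
      using kintB[OF B(1)] by (simp add: sp\<mu>)
    also have "\<bar>\<dots>\<bar> \<le> integral\<^sup>L \<mu> (\<lambda>x. (\<delta> / y\<^sup>2) * indicator B x)"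
      unfolding real_norm_def[symmetric]
    proof (rule Bochner_Integration.integral_norm_bound_integral)
      show "integrable \<mu> (\<lambda>x. indicator B x * k x - indicator B x * k x0)"
        using kintB[OF B(1)] \<open>integrable \<mu> (\<lambda>x. indicator B x * k x0)\<close> by simp
      show "integrable \<mu> (\<lambda>x. (\<delta> / y\<^sup>2) * indicator B x)"
        using B by (intro integrable_mult_right) (simp add: sets\<mu> sp\<mu> integrable_indicator_iff less_top[symmetric])
      show "norm (indicator B x * k x - indicator B x * k x0) \<le> (\<delta> / y\<^sup>2) * indicator B x" for x
      proof (cases "x \<in> B")
        case True
        then have "x \<in> {x0 - \<delta>..x0 + \<delta>}" using B(2) by auto
        then have "\<bar>x - x0\<bar> / y\<^sup>2 \<le> \<delta> / y\<^sup>2" by (intro divide_right_mono) auto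
        then show ?thesis using kdiff[of x x0] True by simp
      qed simp
    qed
    also have "\<dots> = (\<delta> / y\<^sup>2) * ?m" using B by (simp add: sets\<mu> sp\<mu>)
    also have "\<dots> \<le> (\<delta> / y\<^sup>2) * L B"
      using L_alt[OF B(1)] B(3) by (intro mult_left_mono) auto
    finally have "\<bar>integral\<^sup>L \<mu> (\<lambda>x. indicator B x * k x) - ?m * k x0\<bar> \<le> (\<delta> / y\<^sup>2) * L B" .
    moreover have "C * \<delta> * L B = (2 * \<delta> * L B) / y + (\<delta> / y\<^sup>2) * L B"
      by (simp add: C_def algebra_simps)
    ultimately show ?thesis using 2 unfolding \<nu>_def by linarith
  qed
  have \<nu>_Un: "\<nu> (A \<union> B) = \<nu> A + \<nu> B"
    if "A \<in> sets borel" "B \<in> sets borel" "A \<inter> B = {}" for A B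
  proof -
    have "integral\<^sup>L \<mu> (\<lambda>x. indicator (A \<union> B) x * k x)
        = integral\<^sup>L \<mu> (\<lambda>x. indicator A x * k x + indicator B x * k x)"
      using that by (intro Bochner_Integration.integral_cong) (auto simp: indicator_def)
    also have "\<dots> = integral\<^sup>L \<mu> (\<lambda>x. indicator A x * k x) + integral\<^sup>L \<mu> (\<lambda>x. indicator B x * k x)"
      using kintB that by simp
    finally show ?thesis
      unfolding \<nu>_def using that f ell2_e1 by (simp add: E_Un ell2_inner_add_right)
  qed
  have L_Un: "L (A \<union> B) = L A + L B"
    if "A \<in> sets borel" "B \<in> sets borel" "A \<inter> B = {}" for A B
  proof -
    interpret mf: finite_measure "scalar_measure E f" using f by (rule finite_scalar)
    show ?thesis
      using that mf.finite_measure_Union[of A B] finite_measure_Union[of A B]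
      by (simp add: L_alt sets\<mu>)
  qed
  have grid: "\<bar>\<nu> {c..<c + real n * \<delta>}\<bar> \<le> C * \<delta> * L {c..<c + real n * \<delta>}" if "\<delta> > 0" for c \<delta> n
  proof (induction n)
    case 0
    then show ?case using \<nu>_small[of "{}" 0 \<delta>] that by simp
  next
    case (Suc n)
    let ?A = "{c..<c + real n * \<delta>}" and ?B = "{c + real n * \<delta>..<c + real (Suc n) * \<delta>}"
    have "c \<le> c + real n * \<delta>" "c + real n * \<delta> \<le> c + real (Suc n) * \<delta>"
      using that by (simp_all add: algebra_simps)
    then have U: "{c..<c + real (Suc n) * \<delta>} = ?A \<union> ?B" "?A \<inter> ?B = {}"
      by (rule ivl_disj_un_two(3)[symmetric], intro ivl_disj_int_two(3))
    have "\<bar>\<nu> ?B\<bar> \<le> C * \<delta> * L ?B"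
      using that by (intro \<nu>_small[of _ "c + real n * \<delta>"]) (auto simp: algebra_simps)
    then show ?case
      unfolding U(1) using \<nu>_Un[OF _ _ U(2)] L_Un[OF _ _ U(2)] Suc by (simp add: distrib_left)
  qed
  have Lb: "L B \<le> L UNIV" if "B \<in> sets borel" for B
    using L_Un[of B "-B"] that L_nonneg[of "-B"] by simp
  have \<nu>0: "\<nu> {-M..<M} = 0" if M: "M > 0" for M
  proof -
    have "\<bar>\<nu> {-M..<M}\<bar> \<le> C * (2 * M) * L UNIV * (1 / real (Suc n))" for n
    proof -
      have "\<bar>\<nu> {-M..<-M + real (Suc n) * (2 * M / real (Suc n))}\<bar>
          \<le> C * (2 * M / real (Suc n)) * L {-M..<-M + real (Suc n) * (2 * M / real (Suc n))}"
        using M by (intro grid) simp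
      also have "-M + real (Suc n) * (2 * M / real (Suc n)) = M" by (simp add: field_simps)
      also have "C * (2 * M / real (Suc n)) * L {-M..<M} \<le> C * (2 * M / real (Suc n)) * L UNIV"
        using Cpos M by (intro mult_left_mono Lb) auto
      finally show ?thesis by (simp add: field_simps)
    qed
    moreover have "(\<lambda>n. C * (2 * M) * L UNIV * (1 / real (Suc n))) \<longlonglongrightarrow> 0"
      by (rule tendsto_mult_right_zero) real_asymp
    ultimately have "\<bar>\<nu> {-M..<M}\<bar> \<le> 0"
      by (intro LIMSEQ_le_const[of "\<lambda>n. C * (2 * M) * L UNIV * (1 / real (Suc n))"]) auto
    then show ?thesis by simp
  qed
  define I where "I i = {- real (Suc i)..<real (Suc i)}" for i
  have Im: "I i \<in> sets borel" for i by (simp add: I_def)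
  have lim0: "(\<lambda>i. measure \<mu> (- I i)) \<longlonglongrightarrow> 0"
  proof -
    have "(\<lambda>i. measure \<mu> (- I i)) \<longlonglongrightarrow> measure \<mu> (\<Inter>i. - I i)"
    proof (rule finite_Lim_measure_decseq)
      show "range (\<lambda>i. - I i) \<subseteq> sets \<mu>" using Im by (auto simp: sets\<mu>)
      show "decseq (\<lambda>i. - I i)" unfolding decseq_def I_def by auto
    qed
    moreover have "(\<Inter>i. - I i) = {}"
    proof -
      have "\<exists>i. x \<in> I i" for x
      proof -
        obtain i where "\<bar>x\<bar> < real i" using reals_Archimedean2 by blast
        then show ?thesis by (intro exI[of _ i]) (auto simp: I_def)
      qed
      then show ?thesis by auto
    qed
    ultimately show ?thesis by simp
  qed
  have bnd: "\<bar>\<nu> UNIV\<bar> \<le> ell2_norm f * sqrt (measure \<mu> (- I i)) + (1 / y) * measure \<mu> (- I i)" for i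
  proof -
    let ?N = "- I i"
    have N: "?N \<in> sets borel" using Im by auto
    have "\<nu> UNIV = \<nu> (I i) + \<nu> ?N"
      using \<nu>_Un[OF Im[of i] N] by simp
    also have "\<nu> (I i) = 0" unfolding I_def by (rule \<nu>0) simp
    finally have u: "\<nu> UNIV = \<nu> ?N" by simp
    have p1: "\<bar>Im (ell2_inner f (E ?N e1))\<bar> \<le> ell2_norm f * ell2_norm (E ?N e1)"
      using ell2_inner_bound[OF f E_ell2[OF N ell2_e1]] abs_Im_le_cmod order_trans by blast
    have p2: "ell2_norm (E ?N e1) = sqrt (measure \<mu> ?N)"
      unfolding \<mu>_def measure_scalar[OF N ell2_e1]
      using ell2_norm_nonneg[OF E_ell2[OF N ell2_e1]] by simp
    have p3: "\<bar>integral\<^sup>L \<mu> (\<lambda>x. indicator ?N x * k x)\<bar> \<le> (1 / y) * measure \<mu> ?N"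
    proof -
      have "\<bar>integral\<^sup>L \<mu> (\<lambda>x. indicator ?N x * k x)\<bar> \<le> integral\<^sup>L \<mu> (\<lambda>x. (1 / y) * indicator ?N x)"
        unfolding real_norm_def[symmetric]
      proof (rule Bochner_Integration.integral_norm_bound_integral)
        show "integrable \<mu> (\<lambda>x. indicator ?N x * k x)" by (rule kintB[OF N])
        show "integrable \<mu> (\<lambda>x. (1 / y) * indicator ?N x)"
          using N by (intro integrable_mult_right) (simp add: sets\<mu> sp\<mu> integrable_indicator_iff less_top[symmetric])
        show "norm (indicator ?N x * k x) \<le> (1 / y) * indicator ?N x" for x
          using kb[of x] by (auto simp: indicator_def)
      qed
      also have "\<dots> = (1 / y) * measure \<mu> ?N" using N by (simp add: sets\<mu> sp\<mu>)
      finally show ?thesis .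
    qed
    show ?thesis unfolding u unfolding \<nu>_def using p1[unfolded p2] p3 by linarith
  qed
  have "(\<lambda>i. ell2_norm f * sqrt (measure \<mu> (- I i)) + (1 / y) * measure \<mu> (- I i)) \<longlonglongrightarrow> 0"
    using tendsto_real_sqrt[OF lim0]
    by (intro tendsto_add_zero tendsto_mult_right_zero lim0) simp
  then have "\<bar>\<nu> UNIV\<bar> \<le> 0" by (rule LIMSEQ_le_const) (use bnd in blast)
  then have "Im (ell2_inner f e1) = integral\<^sup>L \<mu> k"
    unfolding \<nu>_def using ell2_e1 by (simp add: E_UNIV)
  moreover have "ell2_inner f e1 = f 1"
    unfolding ell2_inner_def e1_def using suminf_finite[of "{1}" "\<lambda>n. f n * cnj (if n = 1 then 1 else 0)"]
    by simp
  ultimately show ?thesis by (simp add: \<mu>_def k_def[abs_def])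
qed

end

section \<open>Stieltjes inversion\<close>

lemma has_real_derivative_arctan_kernel:
  fixes y t x :: real
  assumes "y > 0"
  shows "((\<lambda>x. arctan ((x - t) / y)) has_real_derivative (y / ((x - t)\<^sup>2 + y\<^sup>2))) (at x within S)"
proof -
  have "((\<lambda>x. arctan ((x - t) / y)) has_real_derivative (inverse (1 + ((x - t) / y)\<^sup>2) * (1 / y))) (at x within S)"
    using assms by (intro DERIV_arctan[THEN DERIV_chain2]) (auto intro!: derivative_eq_intros)
  moreover have "inverse (1 + ((x - t) / y)\<^sup>2) * (1 / y) = y / ((x - t)\<^sup>2 + y\<^sup>2)"
    using assms by (simp add: divide_simps) (simp add: power2_eq_square algebra_simps)
  ultimately show ?thesis by simp
qed

lemma arctan_scaled_tendsto:
  fixes s :: real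
  shows "((\<lambda>n. arctan (s / (1 / real (Suc n)))) \<longlongrightarrow> pi / 2 * sgn s) sequentially"
proof -
  consider "s = 0" | "s > 0" | "s < 0" by linarith
  then show ?thesis
  proof cases
    case 2
    then have "((\<lambda>n. arctan (s / (1 / real (Suc n)))) \<longlongrightarrow> pi / 2) sequentially" by real_asymp
    then show ?thesis using 2 by simp
  next
    case 3
    then have "((\<lambda>n. arctan (s / (1 / real (Suc n)))) \<longlongrightarrow> - (pi / 2)) sequentially" by real_asymp
    then show ?thesis using 3 by simp
  qed simp
qed

text \<open>
  By Tonelli's theorem, integration of \<open>G x' y\<close> over \<open>x'\<close> in \<open>[c, c']\<close> gives the integral of a difference of
  arctangents.  As \<open>y\<close> tends to zero this difference tends to \<open>\<pi>\<close> times the indicator of \<open>(c, c']\<close>, except at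
  the end points, which carry no mass because \<open>y * G c y\<close> dominates the mass of \<open>{c}\<close>.  The bound on
  \<open>G - L\<close> thus becomes a bound on the increments of the distribution function.
\<close>

lemma (in finite_borel_measure) Stieltjes_inversion_deriv:
  fixes L x :: real
  defines "G \<equiv> \<lambda>x y. integral\<^sup>L M (\<lambda>t. y / ((t - x)\<^sup>2 + y\<^sup>2))"
  assumes lim: "\<And>e. e > 0 \<Longrightarrow> \<exists>d>0. \<forall>x' y. \<bar>x' - x\<bar> < d \<and> 0 < y \<and> y < d \<longrightarrow> \<bar>G x' y - L\<bar> < e"
  shows "(cdf M has_real_derivative L / pi) (at x)"
proof -
  have ms: "sets M = sets borel" and sp: "space M = UNIV"
    using M_is_borel borel_UNIV by auto
  note [measurable_cong] = ms
  have kb: "\<bar>y / ((t - x')\<^sup>2 + y\<^sup>2)\<bar> \<le> 1 / y" if "y > 0" for t x' y :: real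
  proof -
    have "y / ((t - x')\<^sup>2 + y\<^sup>2) \<le> y / y\<^sup>2"
      using that by (intro divide_left_mono) (auto intro!: mult_pos_pos add_nonneg_pos)
    also have "\<dots> = 1 / y" by (simp add: power2_eq_square)
    finally show ?thesis using that by simp
  qed
  have kint: "integrable M (\<lambda>t. y / ((t - x')\<^sup>2 + y\<^sup>2))" if "y > 0" for x' y
    using kb[OF that] by (intro integrable_const_bound[of _ "1 / y"]) auto
  have main: "\<exists>d>0. \<forall>c c'. x - d < c \<and> c < c' \<and> c' < x + d \<longrightarrow>
      \<bar>pi * (cdf M c' - cdf M c) - L * (c' - c)\<bar> \<le> e * (c' - c)" if e: "e > 0" for e
  proof -
    obtain d where d: "d > 0"
      and dG: "\<And>x' y. \<bar>x' - x\<bar> < d \<Longrightarrow> 0 < y \<Longrightarrow> y < d \<Longrightarrow> \<bar>G x' y - L\<bar> < e"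
      using lim[OF e] by blast
    \<comment> \<open>At \<open>t = c\<close> the kernel of \<open>G c y\<close> is \<open>1 / y\<close>, so \<open>{c}\<close> has mass at most \<open>y * G c y\<close>.\<close>
    have atom: "measure M {c} = 0" if cx: "\<bar>c - x\<bar> < d" for c
    proof -
      have "measure M {c} \<le> y * (L + e)" if y: "0 < y" "y < d" for y
      proof -
        have "(1 / y) * measure M {c} = integral\<^sup>L M (\<lambda>t. (1 / y) * indicator {c} t)"
          by (simp add: sp)
        also have "\<dots> \<le> G c y" unfolding G_def
        proof (rule integral_mono)
          show "integrable M (\<lambda>t. (1 / y) * indicator {c} t)"
            by (intro integrable_mult_right) (simp add: ms integrable_indicator_iff less_top[symmetric])
          show "integrable M (\<lambda>t. y / ((t - c)\<^sup>2 + y\<^sup>2))" by (rule kint[OF y(1)])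
          show "(1 / y) * indicator {c} t \<le> y / ((t - c)\<^sup>2 + y\<^sup>2)" for t
            using y by (auto simp: indicator_def power2_eq_square)
        qed
        also have "\<dots> \<le> L + e" using dG[OF cx y] by (simp add: abs_less_iff)
        finally show ?thesis using y by (simp add: field_simps)
      qed
      note b = this
      have "(\<lambda>n. (d / real (n + 2)) * (L + e)) \<longlonglongrightarrow> 0" by real_asymp
      moreover have "measure M {c} \<le> (d / real (n + 2)) * (L + e)" for n
        using d by (intro b divide_pos_pos) (auto simp: divide_less_eq add_pos_nonneg)
      ultimately have "measure M {c} \<le> 0"
        by (intro LIMSEQ_le_const[of "\<lambda>n. (d / real (n + 2)) * (L + e)"]) auto
      then show ?thesis using measure_nonneg[of M "{c}"] by linarith
    qed
    have "\<bar>pi * (cdf M c' - cdf M c) - L * (c' - c)\<bar> \<le> e * (c' - c)"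
      if c: "x - d < c" "c < c'" "c' < x + d" for c c'
    proof -
      define \<Phi> where "\<Phi> y = integral\<^sup>L M (\<lambda>t. arctan ((c' - t) / y) - arctan ((c - t) / y))" for y
      have nonneg: "0 \<le> arctan ((c' - t) / y) - arctan ((c - t) / y)" if "y > 0" for t y
        using c that by (simp add: arctan_monotone' divide_right_mono)
      have ab: "\<bar>arctan s\<bar> \<le> pi / 2" for s 
        using arctan_lbound[of s] arctan_ubound[of s] unfolding abs_le_iff by linarith
      have ab2: "\<bar>arctan s - arctan s'\<bar> \<le> pi" for s s' using ab[of s] ab[of s'] by linarith
      have \<Phi>int: "integrable M (\<lambda>t. arctan ((c' - t) / y) - arctan ((c - t) / y))" for y
        using ab2 by (intro integrable_const_bound[of _ pi]) auto
      have inner: "(\<integral>\<^sup>+x'. ennreal (y / ((t - x')\<^sup>2 + y\<^sup>2)) * indicator {c..c'} x' \<partial>lborel)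
          = ennreal (arctan ((c' - t) / y) - arctan ((c - t) / y))" if y: "y > 0" for t y
        using c y
        by (intro nn_integral_FTC_Icc)
          (auto intro!: has_real_derivative_arctan_kernel[THEN DERIV_cong] simp: power2_commute)
      have GI: "(\<integral>\<^sup>+x'. ennreal (G x' y) * indicator {c..c'} x' \<partial>lborel) = ennreal (\<Phi> y)" if y: "y > 0" for y
      proof -
        interpret p: pair_sigma_finite lborel M
          by (intro pair_sigma_finite.intro lborel.sigma_finite_measure_axioms sigma_finite_measure_axioms)
        have "(\<integral>\<^sup>+x'. ennreal (G x' y) * indicator {c..c'} x' \<partial>lborel)
          = (\<integral>\<^sup>+x'. (\<integral>\<^sup>+t. ennreal (y / ((t - x')\<^sup>2 + y\<^sup>2)) * indicator {c..c'} x' \<partial>M) \<partial>lborel)"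
        proof (intro nn_integral_cong)
          fix x'
          have "ennreal (G x' y) = (\<integral>\<^sup>+t. ennreal (y / ((t - x')\<^sup>2 + y\<^sup>2)) \<partial>M)"
            unfolding G_def using y
            by (intro nn_integral_eq_integral[symmetric] kint) auto
          then show "ennreal (G x' y) * indicator {c..c'} x'
            = (\<integral>\<^sup>+t. ennreal (y / ((t - x')\<^sup>2 + y\<^sup>2)) * indicator {c..c'} x' \<partial>M)"
            by (simp add: nn_integral_multc)
        qed
        also have "\<dots> = (\<integral>\<^sup>+t. (\<integral>\<^sup>+x'. ennreal (y / ((t - x')\<^sup>2 + y\<^sup>2)) * indicator {c..c'} x' \<partial>lborel) \<partial>M)"
          by (rule p.Fubini'[symmetric]) measurable
        also have "\<dots> = (\<integral>\<^sup>+t. ennreal (arctan ((c' - t) / y) - arctan ((c - t) / y)) \<partial>M)"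
          by (simp add: inner[OF y])
        also have "\<dots> = ennreal (\<Phi> y)"
          unfolding \<Phi>_def using nonneg[OF y] by (intro nn_integral_eq_integral \<Phi>int) auto
        finally show ?thesis .
      qed
      have \<Phi>b: "\<bar>\<Phi> y - L * (c' - c)\<bar> \<le> e * (c' - c)" if y: "0 < y" "y < d" for y
      proof -
        have \<Phi>0: "0 \<le> \<Phi> y" unfolding \<Phi>_def using nonneg[OF y(1)] by (intro integral_nonneg_AE) auto
        have G0: "0 \<le> G x' y" for x' unfolding G_def using y by (intro integral_nonneg_AE) auto
        have b: "L - e \<le> G x' y" "G x' y \<le> L + e" if "x' \<in> {c..c'}" for x'
          using dG[of x' y] that c y by (auto simp: abs_less_iff)
        have len: "(\<integral>\<^sup>+x'. ennreal K * indicator {c..c'} x' \<partial>lborel) = ennreal K * ennreal (c' - c)" for K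
          using c by (simp add: nn_integral_cmult_indicator)
        have LE: "0 \<le> L + e" using b(2)[of c] G0[of c] c by auto
        have "ennreal (\<Phi> y) \<le> (\<integral>\<^sup>+x'. ennreal (L + e) * indicator {c..c'} x' \<partial>lborel)"
          unfolding GI[OF y(1), symmetric]
          using b(2) by (intro nn_integral_mono) (auto simp: indicator_def intro!: ennreal_leI)
        then have 1: "\<Phi> y \<le> (L + e) * (c' - c)"
          unfolding len using c LE by (simp add: ennreal_mult[symmetric])
        have "(\<integral>\<^sup>+x'. ennreal (L - e) * indicator {c..c'} x' \<partial>lborel) \<le> ennreal (\<Phi> y)"
          unfolding GI[OF y(1), symmetric]
          using b(1) by (intro nn_integral_mono) (auto simp: indicator_def intro!: ennreal_leI)
        then have "ennreal (L - e) * ennreal (c' - c) \<le> ennreal (\<Phi> y)" unfolding len .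
        have 2: "(L - e) * (c' - c) \<le> \<Phi> y"
        proof (cases "L - e \<ge> 0")
          case True
          then show ?thesis using \<open>ennreal (L - e) * ennreal (c' - c) \<le> ennreal (\<Phi> y)\<close> c \<Phi>0
            by (simp add: ennreal_mult[symmetric])
        next
          case False
          then have "(L - e) * (c' - c) \<le> 0" using c by (intro mult_nonpos_nonneg) auto
          then show ?thesis using \<Phi>0 by linarith
        qed
        show ?thesis using 1 2 by (simp add: abs_le_iff algebra_simps)
      qed
      have dct: "(\<lambda>n. \<Phi> (1 / real (Suc n))) \<longlonglongrightarrow>
          integral\<^sup>L M (\<lambda>t. pi / 2 * sgn (c' - t) - pi / 2 * sgn (c - t))"
        unfolding \<Phi>_def
      proof (rule integral_dominated_convergence[where w = "\<lambda>_. pi"])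
        show "AE t in M. (\<lambda>n. arctan ((c' - t) / (1 / real (Suc n))) - arctan ((c - t) / (1 / real (Suc n))))
          \<longlonglongrightarrow> pi / 2 * sgn (c' - t) - pi / 2 * sgn (c - t)"
          by (intro AE_I2 tendsto_diff arctan_scaled_tendsto)
      qed (use ab2 in auto)
      have nullc: "AE t in M. t \<noteq> c" "AE t in M. t \<noteq> c'"
      proof -
        have "measure M {c} = 0" "measure M {c'} = 0" by (intro atom; use c in auto)+
        then show "AE t in M. t \<noteq> c" "AE t in M. t \<noteq> c'"
          by (auto intro: AE_I[of _ _ "{c}"] AE_I[of _ _ "{c'}"] simp: emeasure_eq_measure)
      qed
      have "integral\<^sup>L M (\<lambda>t. pi / 2 * sgn (c' - t) - pi / 2 * sgn (c - t))
          = integral\<^sup>L M (\<lambda>t. pi * indicator {c<..c'} t)"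
      proof (rule integral_cong_AE)
        show "AE t in M. pi / 2 * sgn (c' - t) - pi / 2 * sgn (c - t) = pi * indicator {c<..c'} t"
          using nullc by eventually_elim (use c in \<open>auto simp: sgn_if indicator_def\<close>)
      qed measurable
      also have "\<dots> = pi * (cdf M c' - cdf M c)"
        using cdf_diff_eq[OF c(2)] by (simp add: sp)
      finally have "(\<lambda>n. \<Phi> (1 / real (Suc n))) \<longlonglongrightarrow> pi * (cdf M c' - cdf M c)" using dct by simp
      then have l: "(\<lambda>n. \<bar>\<Phi> (1 / real (Suc n)) - L * (c' - c)\<bar>) \<longlonglongrightarrow> \<bar>pi * (cdf M c' - cdf M c) - L * (c' - c)\<bar>"
        by (intro tendsto_intros)
      have "eventually (\<lambda>n. 1 / real (Suc n) < d) sequentially"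
        using d by real_asymp
      then have "eventually (\<lambda>n. \<bar>\<Phi> (1 / real (Suc n)) - L * (c' - c)\<bar> \<le> e * (c' - c)) sequentially"
        by eventually_elim (intro \<Phi>b, auto)
      then show ?thesis by (rule tendsto_upperbound[OF l]) simp
    qed
    then show ?thesis using d by blast
  qed
  show ?thesis
    unfolding has_field_derivative_iff
  proof (rule LIM_I)
    fix e :: real assume e: "e > 0"
    obtain d where d: "d > 0" and b: "\<And>c c'. x - d < c \<Longrightarrow> c < c' \<Longrightarrow> c' < x + d \<Longrightarrow>
      \<bar>pi * (cdf M c' - cdf M c) - L * (c' - c)\<bar> \<le> e * (c' - c)"
      using main[OF e] by blast
    have "norm ((cdf M w - cdf M x) / (w - x) - L / pi) < e" if w: "w \<noteq> x" "norm (w - x) < d" for w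
    proof -
      have "\<bar>pi * (cdf M w - cdf M x) - L * (w - x)\<bar> \<le> e * \<bar>w - x\<bar>"
      proof (cases "w > x")
        case True
        then show ?thesis using b[of x w] w d by (simp add: abs_less_iff)
      next
        case False
        then have "\<bar>pi * (cdf M x - cdf M w) - L * (x - w)\<bar> \<le> e * (x - w)"
          using b[of w x] w d by (simp add: abs_less_iff)
        moreover have "pi * (cdf M w - cdf M x) - L * (w - x) = - (pi * (cdf M x - cdf M w) - L * (x - w))"
          by (simp add: algebra_simps)
        ultimately show ?thesis using False by (simp only: abs_minus_cancel) simp
      qed
      moreover have "(cdf M w - cdf M x) / (w - x) - L / pi
          = (pi * (cdf M w - cdf M x) - L * (w - x)) / (pi * (w - x))"
        using w by (simp add: field_simps)
      moreover have "norm ((pi * (cdf M w - cdf M x) - L * (w - x)) / (pi * (w - x)))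
          = \<bar>pi * (cdf M w - cdf M x) - L * (w - x)\<bar> / (pi * \<bar>w - x\<bar>)"
        by (simp only: real_norm_def abs_divide abs_mult) simp
      ultimately have "norm ((cdf M w - cdf M x) / (w - x) - L / pi) \<le> e * \<bar>w - x\<bar> / (pi * \<bar>w - x\<bar>)"
        by (simp only:) (intro divide_right_mono, auto)
      also have "\<dots> = e / pi" using w by simp
      also have "\<dots> < e" using e pi_gt3 by (simp add: divide_less_eq)
      finally show ?thesis .
    qed
    then show "\<exists>s>0. \<forall>w. w \<noteq> x \<and> norm (w - x) < s \<longrightarrow>
        norm ((cdf M w - cdf M x) / (w - x) - L / pi) < e"
      using d by blast
  qed
qed

lemma (in pvm) finite_borel_measure_scalar:
  assumes "u \<in> ell2"
  shows "finite_borel_measure (scalar_measure E u)"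
  using finite_scalar[OF assms] by (simp add: finite_borel_measure_def finite_borel_measure_axioms_def)

section \<open>Uniform power bounds\<close>

lemma powr_one_plus_expansion:
  fixes e :: real
  shows "\<exists>C\<ge>0. \<forall>x. \<bar>x\<bar> \<le> 1/2 \<longrightarrow> \<bar>(1 + x) powr e - 1 - e * x\<bar> \<le> C * x\<^sup>2"
proof -
  define K where "K = max ((1/2) powr (e - 2)) ((3/2) powr (e - 2))"
  have K: "(1 + t) powr (e - 2) \<le> K" if "\<bar>t\<bar> \<le> 1/2" for t
  proof (cases "e - 2 \<ge> 0")
    case True
    then have "(1 + t) powr (e - 2) \<le> (3/2) powr (e - 2)" using that by (intro powr_mono2) auto
    then show ?thesis by (simp add: K_def)
  next
    case False
    then have "(1 + t) powr (e - 2) \<le> (1/2) powr (e - 2)" using that by (intro powr_mono2') auto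
    then show ?thesis by (simp add: K_def)
  qed
  have K0: "K \<ge> 0" by (simp add: K_def le_max_iff_disj)
  define C where "C = \<bar>e * (e - 1)\<bar> * K / 2"
  have "\<bar>(1 + x) powr e - 1 - e * x\<bar> \<le> C * x\<^sup>2" if x: "\<bar>x\<bar> \<le> 1/2" for x
  proof -
    define diff :: "nat \<Rightarrow> real \<Rightarrow> real" where "diff = (\<lambda>m t. if m = 0 then (1 + t) powr e else if m = 1 then e * (1 + t) powr (e - 1)
        else e * (e - 1) * (1 + t) powr (e - 2))"
    have "\<exists>t. \<bar>t\<bar> \<le> \<bar>x\<bar> \<and> (1 + x) powr e = (\<Sum>m<(2::nat). diff m 0 / fact m * x ^ m) + diff 2 t / fact 2 * x ^ 2"
    proof (rule Maclaurin_bi_le)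
      show "diff 0 = (\<lambda>x. (1 + x) powr e)" by (simp add: diff_def fun_eq_iff)
      show "\<forall>m t. m < 2 \<and> \<bar>t\<bar> \<le> \<bar>x\<bar> \<longrightarrow> DERIV (diff m) t :> diff (Suc m) t"
      proof (intro allI impI)
        fix m :: nat and t assume mt: "m < 2 \<and> \<bar>t\<bar> \<le> \<bar>x\<bar>"
        then have t: "1 + t > 0" using x by linarith
        consider "m = 0" | "m = 1" using mt by linarith
        then show "DERIV (diff m) t :> diff (Suc m) t"
        proof cases
          case 1
          then show ?thesis using t unfolding diff_def by (auto intro!: derivative_eq_intros)
        next
          case 2
          then show ?thesis using t unfolding diff_def by (auto intro!: derivative_eq_intros)
        qed
      qed
    qed
    then obtain t where t: "\<bar>t\<bar> \<le> \<bar>x\<bar>"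
      and eq: "(1 + x) powr e = 1 + e * x + e * (e - 1) * (1 + t) powr (e - 2) / 2 * x\<^sup>2"
      by (auto simp: diff_def numeral_2_eq_2)
    have "\<bar>(1 + x) powr e - 1 - e * x\<bar> = \<bar>e * (e - 1)\<bar> * (1 + t) powr (e - 2) / 2 * x\<^sup>2"
      unfolding eq by (simp add: abs_mult)
    also have "\<dots> \<le> \<bar>e * (e - 1)\<bar> * K / 2 * x\<^sup>2"
      using K[of t] t x by (intro mult_right_mono divide_right_mono mult_left_mono) auto
    finally show ?thesis by (simp add: C_def)
  qed
  then show ?thesis using K0 by (intro exI[of _ C]) (auto simp: C_def)
qed

text \<open>
  The relation \<open>f n w = O(n powr e)\<close>, uniformly in \<open>w \<in> W\<close>.
\<close>

definition upow :: "complex set \<Rightarrow> (nat \<Rightarrow> complex \<Rightarrow> complex) \<Rightarrow> real \<Rightarrow> bool" where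
  "upow W f e \<longleftrightarrow> (\<exists>C\<ge>0. \<forall>\<^sub>F n in sequentially. \<forall>w\<in>W. cmod (f n w) \<le> C * real n powr e)"

lemma upowI:
  assumes "C \<ge> 0" "\<And>n w. n \<ge> N \<Longrightarrow> w \<in> W \<Longrightarrow> cmod (f n w) \<le> C * real n powr e"
  shows "upow W f e"
  unfolding upow_def eventually_sequentially using assms by blast

lemma upowE:
  assumes "upow W f e"
  obtains C N where "C \<ge> 0" "N \<ge> 1" "\<And>n w. n \<ge> N \<Longrightarrow> w \<in> W \<Longrightarrow> cmod (f n w) \<le> C * real n powr e"
proof -
  from assms obtain C N where "C \<ge> 0" "\<And>n w. n \<ge> N \<Longrightarrow> w \<in> W \<Longrightarrow> cmod (f n w) \<le> C * real n powr e"
    unfolding upow_def eventually_sequentially by blast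
  then show ?thesis by (intro that[of C "max N 1"]) auto
qed

lemma upow_mono:
  assumes "upow W f e" "e \<le> e'"
  shows "upow W f e'"
proof -
  obtain C N where C: "C \<ge> 0" "N \<ge> 1" "\<And>n w. n \<ge> N \<Longrightarrow> w \<in> W \<Longrightarrow> cmod (f n w) \<le> C * real n powr e"
    using upowE[OF assms(1)] by blast
  show ?thesis
  proof (rule upowI[of C N])
    fix n w assume n: "n \<ge> N" "w \<in> W"
    have "C * real n powr e \<le> C * real n powr e'"
      using C(1,2) n assms(2) by (intro mult_left_mono powr_mono) auto
    then show "cmod (f n w) \<le> C * real n powr e'" using C(3)[OF n] by linarith
  qed fact
qed

lemma upow_add:
  assumes "upow W f e" "upow W g e"
  shows "upow W (\<lambda>n w. f n w + g n w) e"
proof -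
  obtain C N where C: "C \<ge> 0" "N \<ge> 1" "\<And>n w. n \<ge> N \<Longrightarrow> w \<in> W \<Longrightarrow> cmod (f n w) \<le> C * real n powr e"
    using upowE[OF assms(1)] by blast
  obtain C' N' where C': "C' \<ge> 0" "N' \<ge> 1" "\<And>n w. n \<ge> N' \<Longrightarrow> w \<in> W \<Longrightarrow> cmod (g n w) \<le> C' * real n powr e"
    using upowE[OF assms(2)] by blast
  show ?thesis
    using C C' by (intro upowI[of "C + C'" "max N N'"])
      (auto simp: distrib_right intro!: norm_triangle_le add_mono)
qed

lemma upow_mult:
  assumes "upow W f e" "upow W g e'"
  shows "upow W (\<lambda>n w. f n w * g n w) (e + e')"
proof -
  obtain C N where C: "C \<ge> 0" "N \<ge> 1" "\<And>n w. n \<ge> N \<Longrightarrow> w \<in> W \<Longrightarrow> cmod (f n w) \<le> C * real n powr e"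
    using upowE[OF assms(1)] by blast
  obtain C' N' where C': "C' \<ge> 0" "N' \<ge> 1" "\<And>n w. n \<ge> N' \<Longrightarrow> w \<in> W \<Longrightarrow> cmod (g n w) \<le> C' * real n powr e'"
    using upowE[OF assms(2)] by blast
  show ?thesis
  proof (rule upowI[of "C * C'" "max N N'"])
    fix n w assume n: "n \<ge> max N N'" "w \<in> W"
    have "cmod (f n w * g n w) \<le> (C * real n powr e) * (C' * real n powr e')"
      unfolding norm_mult using n C C' by (intro mult_mono) auto
    then show "cmod (f n w * g n w) \<le> C * C' * real n powr (e + e')"
      by (simp add: powr_add mult_ac)
  qed (use C C' in auto)
qed

lemma upow_cong:
  assumes "upow W f e" "\<And>n w. n \<ge> N \<Longrightarrow> w \<in> W \<Longrightarrow> cmod (g n w) \<le> cmod (f n w)"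
  shows "upow W g e"
proof -
  obtain C N' where C: "C \<ge> 0" "N' \<ge> 1" "\<And>n w. n \<ge> N' \<Longrightarrow> w \<in> W \<Longrightarrow> cmod (f n w) \<le> C * real n powr e"
    using upowE[OF assms(1)] by blast
  show ?thesis
    using C by (intro upowI[of C "max N N'"]) (auto intro!: order_trans[OF assms(2)])
qed

lemma upow_uminus: "upow W f e \<Longrightarrow> upow W (\<lambda>n w. - f n w) e"
  unfolding upow_def by simp

lemma upow_diff: "upow W f e \<Longrightarrow> upow W g e \<Longrightarrow> upow W (\<lambda>n w. f n w - g n w) e"
  using upow_add[OF _ upow_uminus, of W f e g] by simp

lemma upow_powr: "upow W (\<lambda>n w. of_real (real n powr e)) e"
  by (rule upowI[of 1 0]) auto

lemma upow_of_real:
  assumes "C \<ge> 0" "\<And>n. n \<ge> N \<Longrightarrow> \<bar>f n\<bar> \<le> C * real n powr e"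
  shows "upow W (\<lambda>n w. of_real (f n)) e"
  by (rule upowI[of C N]) (use assms in auto)

lemma upow_bounded:
  assumes "\<And>w. w \<in> W \<Longrightarrow> cmod (\<phi> w) \<le> C"
  shows "upow W (\<lambda>n w. \<phi> w) 0"
proof (rule upowI[of "\<bar>C\<bar>" 1])
  fix n w assume n: "n \<ge> (1::nat)" "w \<in> W"
  have "cmod (\<phi> w) \<le> \<bar>C\<bar>" using assms[OF n(2)] by linarith
  then show "cmod (\<phi> w) \<le> \<bar>C\<bar> * real n powr 0" using n(1) by simp
qed simp

lemma upow_const: "upow W (\<lambda>n w. c) 0"
  by (rule upow_bounded[of W _ "cmod c"]) simp

lemma upow_cmult: "upow W f e \<Longrightarrow> upow W (\<lambda>n w. c * f n w) e"
  using upow_mult[OF upow_const] by fastforce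

lemma upow_eventually_small:
  assumes "upow W f e" "e < 0" "\<epsilon> > 0"
  shows "\<forall>\<^sub>F n in sequentially. \<forall>w\<in>W. cmod (f n w) \<le> \<epsilon>"
proof -
  obtain C N where C: "C \<ge> 0" "N \<ge> 1" "\<And>n w. n \<ge> N \<Longrightarrow> w \<in> W \<Longrightarrow> cmod (f n w) \<le> C * real n powr e"
    using upowE[OF assms(1)] by blast
  have "(\<lambda>n. real n powr e) \<longlonglongrightarrow> 0"
    by (rule tendsto_neg_powr[OF assms(2) filterlim_real_sequentially])
  then have "(\<lambda>n. C * real n powr e) \<longlonglongrightarrow> 0" by (rule tendsto_mult_right_zero)
  then have "\<forall>\<^sub>F n in sequentially. C * real n powr e < \<epsilon>"
    using assms(3) by (rule order_tendstoD)
  then show ?thesis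
    using eventually_ge_at_top[of N]
  proof eventually_elim
    case (elim n)
    show ?case
    proof
      fix w assume "w \<in> W"
      from C(3)[OF elim(2) this] elim(1) show "cmod (f n w) \<le> \<epsilon>" by linarith
    qed
  qed
qed

lemma upow_shift:
  assumes "upow W f e"
  shows "upow W (\<lambda>n w. f (Suc n) w) e"
proof -
  obtain C N where C: "C \<ge> 0" "N \<ge> 1" "\<And>n w. n \<ge> N \<Longrightarrow> w \<in> W \<Longrightarrow> cmod (f n w) \<le> C * real n powr e"
    using upowE[OF assms(1)] by blast
  show ?thesis
  proof (rule upowI[of "C * max 1 (2 powr e)" N])
    fix n w assume n: "n \<ge> N" "w \<in> W"
    have n1: "n \<ge> 1" using n(1) C(2) by simp
    have "real (Suc n) powr e \<le> max 1 (2 powr e) * real n powr e"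
    proof (cases "e \<ge> 0")
      case True
      then have "real (Suc n) powr e \<le> (2 * real n) powr e" using n1 by (intro powr_mono2) auto
      also have "\<dots> = 2 powr e * real n powr e" by (simp add: powr_mult)
      also have "\<dots> \<le> max 1 (2 powr e) * real n powr e" by (intro mult_right_mono) auto
      finally show ?thesis .
    next
      case False
      then have "real (Suc n) powr e \<le> 1 * real n powr e" using n1 by (simp add: powr_mono2')
      also have "\<dots> \<le> max 1 (2 powr e) * real n powr e" by (intro mult_right_mono) auto
      finally show ?thesis .
    qed
    then have "C * real (Suc n) powr e \<le> C * (max 1 (2 powr e) * real n powr e)"
      using C(1) by (rule mult_left_mono)
    moreover have "cmod (f (Suc n) w) \<le> C * real (Suc n) powr e" using C(3)[of "Suc n" w] n by simp
    ultimately show "cmod (f (Suc n) w) \<le> C * max 1 (2 powr e) * real n powr e"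
      by (simp only: mult.assoc)
  qed (use C in auto)
qed

lemma upow_powr_expansion:
  shows "upow W (\<lambda>n w. of_real ((1 + 1 / real n) powr e - 1 - e / real n)) (-2)"
    and "upow W (\<lambda>n w. of_real ((1 - 1 / real n) powr e - 1 + e / real n)) (-2)"
proof -
  obtain C where C: "C \<ge> 0" "\<And>x. \<bar>x\<bar> \<le> 1/2 \<Longrightarrow> \<bar>(1 + x) powr e - 1 - e * x\<bar> \<le> C * x\<^sup>2"
    using powr_one_plus_expansion[of e] by blast
  have p: "(1 / real n)\<^sup>2 = real n powr (-2)" if "n \<ge> 2" for n
    using that by (simp add: powr_minus powr_numeral power_divide divide_simps)
  have s: "\<bar>1 / real n\<bar> \<le> 1/2" if "n \<ge> 2" for n using that by (simp add: divide_simps)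
  show "upow W (\<lambda>n w. of_real ((1 + 1 / real n) powr e - 1 - e / real n)) (-2)"
    by (rule upow_of_real[of C 2]) (use C(1) C(2)[OF s] in \<open>simp_all add: p[symmetric]\<close>)
  show "upow W (\<lambda>n w. of_real ((1 - 1 / real n) powr e - 1 + e / real n)) (-2)"
  proof (rule upow_of_real[of C 2])
    fix n :: nat assume n: "n \<ge> 2"
    show "\<bar>(1 - 1 / real n) powr e - 1 + e / real n\<bar> \<le> C * real n powr (-2)"
      using C(2)[of "- (1 / real n)"] s[OF n] p[OF n] by simp
  qed fact
qed

lemma upow_inverse_n: "upow W (\<lambda>n w. of_real (1 / real n)) (-1)"
  by (rule upow_of_real[of 1 1]) (simp_all add: powr_minus divide_simps)

lemma upow_powr_diff: "upow W (\<lambda>n w. of_real (real (Suc n) powr e - real n powr e)) (e - 1)"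
proof -
  have "upow W (\<lambda>n w. of_real ((1 + 1 / real n) powr e - 1 - e / real n) + of_real e * of_real (1 / real n)) (-1)"
    by (intro upow_add upow_mono[OF upow_powr_expansion(1)] upow_mono[OF upow_mult[OF upow_const upow_inverse_n]]) auto
  from upow_mult[OF upow_powr this, of e]
  have "upow W (\<lambda>n w. of_real (real n powr e) * (of_real ((1 + 1 / real n) powr e - 1 - e / real n)
      + of_real e * of_real (1 / real n))) (e - 1)" by simp
  then show ?thesis
  proof (rule upow_cong[of _ _ _ 1])
    fix n :: nat and w :: complex assume n: "n \<ge> 1"
    have "real (Suc n) = real n * (1 + 1 / real n)"
      using n by (simp add: field_simps)
    then have "real (Suc n) powr e = (real n * (1 + 1 / real n)) powr e" by simp
    also have "\<dots> = real n powr e * (1 + 1 / real n) powr e"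
      by (simp add: powr_mult)
    finally have "of_real (real (Suc n) powr e - real n powr e)
        = of_real (real n powr e) * (of_real ((1 + 1 / real n) powr e - 1 - e / real n)
      + of_real e * of_real (1 / real n) :: complex)"
      by (simp add: algebra_simps)
    then show "cmod (of_real (real (Suc n) powr e - real n powr e))
        \<le> cmod (of_real (real n powr e) * (of_real ((1 + 1 / real n) powr e - 1 - e / real n)
      + of_real e * of_real (1 / real n)))" by simp
  qed
qed

section \<open>The approximate solutions and their residuals\<close>

text \<open>
  The radicand and the two terms of \<open>\<eta>\<^sub>n\<close> as functions of \<open>w = \<surd>\<lambda>\<close>.  The radicand depends on \<open>w\<^sup>2\<close> only, so \<open>w \<mapsto> - w\<close>
  exchanges the two characteristic roots \<open>A - B\<close> and \<open>A + B\<close>.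
\<close>

definition wkb_radicand :: "real \<Rightarrow> nat \<Rightarrow> complex \<Rightarrow> complex" where
  "wkb_radicand \<alpha> n w = 1 + w\<^sup>2 * of_real (real n powr (-\<alpha>)) / 4 + of_real \<alpha> / w\<^sup>2 * of_real (real n powr (\<alpha> - 1))"

definition wkbA :: "real \<Rightarrow> nat \<Rightarrow> complex \<Rightarrow> complex" where
  "wkbA \<alpha> n w = 1 + w\<^sup>2 * of_real (real n powr (-\<alpha>)) / 2 + of_real (\<alpha> / (4 * real n))"

definition wkbB :: "real \<Rightarrow> nat \<Rightarrow> complex \<Rightarrow> complex" where
  "wkbB \<alpha> n w = w * of_real (real n powr (-\<alpha>/2)) * csqrt (wkb_radicand \<alpha> n w)"

definition eta :: "real \<Rightarrow> nat \<Rightarrow> complex \<Rightarrow> complex" where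
  "eta \<alpha> n w = wkbA \<alpha> n w - wkbB \<alpha> n w"

text \<open>
  The product of the two characteristic roots.
\<close>

definition wkbD :: "real \<Rightarrow> nat \<Rightarrow> complex \<Rightarrow> complex" where
  "wkbD \<alpha> n w = 1 - of_real (\<alpha> / (2 * real n)) + of_real (\<alpha> / (4 * real n)) * w\<^sup>2 * of_real (real n powr (-\<alpha>))
     + of_real ((\<alpha> / (4 * real n))\<^sup>2)"

lemma wkb_radicand_minus [simp]: "wkb_radicand \<alpha> n (- w) = wkb_radicand \<alpha> n w" by (simp add: wkb_radicand_def)
lemma wkbA_minus [simp]: "wkbA \<alpha> n (- w) = wkbA \<alpha> n w" by (simp add: wkbA_def)
lemma wkbB_minus [simp]: "wkbB \<alpha> n (- w) = - wkbB \<alpha> n w" by (simp add: wkbB_def)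
lemma wkbD_minus [simp]: "wkbD \<alpha> n (- w) = wkbD \<alpha> n w" by (simp add: wkbD_def)
lemma eta_minus_w: "eta \<alpha> n (- w) = wkbA \<alpha> n w + wkbB \<alpha> n w" by (simp add: eta_def)

lemma wkbB_squared:
  assumes "w \<noteq> 0" "n \<ge> 1"
  shows "(wkbB \<alpha> n w)\<^sup>2 = w\<^sup>2 * of_real (real n powr (-\<alpha>)) + (w\<^sup>2 * of_real (real n powr (-\<alpha>)))\<^sup>2 / 4
      + of_real (\<alpha> / real n)"
proof -
  have 1: "(of_real (real n powr (-\<alpha>/2)) :: complex)\<^sup>2 = of_real (real n powr (-\<alpha>))"
  proof -
    have "(real n powr (-\<alpha>/2))\<^sup>2 = real n powr (-\<alpha>)"
      by (simp add: power2_eq_square powr_add[symmetric])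
    then show ?thesis by (metis of_real_power)
  qed
  have 2: "(of_real (real n powr (-\<alpha>)) :: complex) * of_real (real n powr (\<alpha> - 1)) = of_real (1 / real n)"
  proof -
    have "real n powr (-\<alpha>) * real n powr (\<alpha> - 1) = real n powr (-\<alpha> + (\<alpha> - 1))"
      by (simp only: powr_add)
    also have "\<dots> = 1 / real n" using assms(2) by (simp add: powr_minus_divide)
    finally have "real n powr (-\<alpha>) * real n powr (\<alpha> - 1) = 1 / real n" .
    then show ?thesis by (metis of_real_mult)
  qed
  have "(wkbB \<alpha> n w)\<^sup>2 = w\<^sup>2 * of_real (real n powr (-\<alpha>)) * wkb_radicand \<alpha> n w"
    unfolding wkbB_def power_mult_distrib 1 by simp
  also have "\<dots> = w\<^sup>2 * of_real (real n powr (-\<alpha>)) + (w\<^sup>2 * of_real (real n powr (-\<alpha>)))\<^sup>2 / 4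
      + of_real \<alpha> * (of_real (real n powr (-\<alpha>)) * of_real (real n powr (\<alpha> - 1)))"
    using assms(1) unfolding wkb_radicand_def by (simp add: field_simps power2_eq_square)
  also have "\<dots> = w\<^sup>2 * of_real (real n powr (-\<alpha>)) + (w\<^sup>2 * of_real (real n powr (-\<alpha>)))\<^sup>2 / 4
      + of_real (\<alpha> / real n)"
    unfolding 2 by simp
  finally show ?thesis .
qed

lemma eta_mult_eta_minus:
  assumes "w \<noteq> 0" "n \<ge> 1"
  shows "eta \<alpha> n w * eta \<alpha> n (- w) = wkbD \<alpha> n w"
proof -
  have "eta \<alpha> n w * eta \<alpha> n (- w) = (wkbA \<alpha> n w)\<^sup>2 - (wkbB \<alpha> n w)\<^sup>2"
    unfolding eta_minus_w eta_def by (simp add: power2_eq_square algebra_simps)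
  also have "\<dots> = wkbD \<alpha> n w"
  proof -
    define y where "y = w\<^sup>2 * of_real (real n powr (-\<alpha>))"
    define c :: complex where "c = of_real (\<alpha> / (4 * real n))"
    have "of_real (\<alpha> / real n) = 4 * c" "of_real (\<alpha> / (2 * real n)) = 2 * c"
      "of_real ((\<alpha> / (4 * real n))\<^sup>2) = c\<^sup>2"
      by (simp_all add: c_def)
    then show ?thesis
      unfolding wkbB_squared[OF assms] wkbA_def wkbD_def y_def[symmetric] c_def[symmetric]
        mult.assoc[of c "w\<^sup>2"]
      by (simp add: power2_eq_square algebra_simps)
  qed
  finally show ?thesis .
qed

locale wkb =
  fixes \<alpha> wmin wmax :: real
  assumes \<alpha>: "0 < \<alpha>" "\<alpha> < 1" and wmin: "0 < wmin"
begin

definition W where "W = {w. wmin \<le> cmod w \<and> cmod w \<le> wmax}"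

lemma W_nz: "w \<in> W \<Longrightarrow> w \<noteq> 0" using wmin by (auto simp: W_def)
lemma W_minus: "w \<in> W \<Longrightarrow> - w \<in> W" by (auto simp: W_def)

lemma upow_w: "upow W (\<lambda>n w. w) 0"
  by (rule upow_bounded[of W _ wmax]) (auto simp: W_def)

lemma upow_inverse_w2: "upow W (\<lambda>n w. 1 / w\<^sup>2) 0"
proof (rule upow_bounded[of W _ "1 / wmin\<^sup>2"])
  fix w assume "w \<in> W"
  then show "cmod (1 / w\<^sup>2) \<le> 1 / wmin\<^sup>2"
    using wmin by (auto simp: W_def norm_divide norm_power intro!: frac_le power_mono)
qed

lemma upow_w2: "upow W (\<lambda>n w. w\<^sup>2) 0"
  using upow_mult[OF upow_w upow_w] by (simp add: power2_eq_square)

definition \<beta> where "\<beta> = min \<alpha> (1 - \<alpha>)"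
lemma \<beta>: "\<beta> > 0" "\<beta> \<le> \<alpha>" "\<beta> \<le> 1 - \<alpha>" using \<alpha> by (auto simp: \<beta>_def)

lemma upow_radicand: "upow W (\<lambda>n w. wkb_radicand \<alpha> n w - 1) (- \<beta>)"
proof -
  have 1: "upow W (\<lambda>n w. (1/4) * (w\<^sup>2 * of_real (real n powr (-\<alpha>)))) (- \<alpha>)"
    using upow_cmult[OF upow_mult[OF upow_w2 upow_powr[of W "-\<alpha>"]], of "1/4"] by simp
  have 2: "upow W (\<lambda>n w. of_real \<alpha> * (1 / w\<^sup>2 * of_real (real n powr (\<alpha> - 1)))) (\<alpha> - 1)"
    using upow_cmult[OF upow_mult[OF upow_inverse_w2 upow_powr[of W "\<alpha> - 1"]], of "of_real \<alpha>"] by simp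
  from upow_add[OF upow_mono[OF 1] upow_mono[OF 2], of "-\<beta>"] \<beta> show ?thesis
    by (simp add: wkb_radicand_def)
qed

lemma wkb_radicand_close: "\<forall>\<^sub>F n in sequentially. \<forall>w\<in>W. cmod (wkb_radicand \<alpha> n w - 1) \<le> 1/2"
  using upow_eventually_small[OF upow_radicand, of "1/2"] \<beta> by simp

lemma csqrt_near_1:
  assumes "cmod (x - 1) \<le> 1/2"
  shows "1/2 \<le> Re (csqrt x)" "cmod (csqrt x) \<le> 2" "x \<noteq> 0"
proof -
  have "\<bar>Re (x - 1)\<bar> \<le> 1/2" by (rule order_trans[OF abs_Re_le_cmod assms])
  then have r: "Re x \<ge> 1/2" unfolding minus_complex.sel one_complex.sel by linarith
  have r0: "Re (csqrt x) \<ge> 0" using Re_csqrt by simp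
  have "(Re (csqrt x))\<^sup>2 = (cmod x + Re x) / 2"
    using complex_Re_le_cmod[of x] r by simp
  then have "(1/2)\<^sup>2 \<le> (Re (csqrt x))\<^sup>2"
    using complex_Re_le_cmod[of x] r by (simp add: power2_eq_square)
  then show "1/2 \<le> Re (csqrt x)" using r0 by (rule power2_le_imp_le)
  have "cmod x \<le> cmod (x - 1) + 1" using norm_triangle_ineq[of "x - 1" 1] by simp
  then have "(cmod (csqrt x))\<^sup>2 \<le> 2\<^sup>2" using assms by (simp add: norm_power[symmetric])
  then show "cmod (csqrt x) \<le> 2" by (rule power2_le_imp_le) simp
  show "x \<noteq> 0" using r by auto
qed

lemma upow_csqrt: "upow W (\<lambda>n w. csqrt (wkb_radicand \<alpha> n w)) 0"
proof -
  obtain N where "\<And>n w. n \<ge> N \<Longrightarrow> w \<in> W \<Longrightarrow> cmod (wkb_radicand \<alpha> n w - 1) \<le> 1/2"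
    using wkb_radicand_close unfolding eventually_sequentially by blast
  then show ?thesis
    using csqrt_near_1(2) by (intro upowI[of 2 "max N 1"]) auto
qed

lemma upow_wkbB: "upow W (wkbB \<alpha>) (- \<alpha>/2)"
  using upow_mult[OF upow_mult[OF upow_w upow_powr[of W "-\<alpha>/2"]] upow_csqrt]
  by (simp add: wkbB_def[abs_def])

lemma upow_c: "upow W (\<lambda>n w. of_real (\<alpha> / (4 * real n))) (-1)"
  using upow_cmult[OF upow_inverse_n, where c = "of_real (\<alpha>/4)"] by simp

lemma upow_wkbA: "upow W (\<lambda>n w. wkbA \<alpha> n w - 1) (-\<alpha>)"
proof -
  have 1: "upow W (\<lambda>n w. (1/2) * (w\<^sup>2 * of_real (real n powr (-\<alpha>)))) (- \<alpha>)"
    using upow_cmult[OF upow_mult[OF upow_w2 upow_powr[of W "-\<alpha>"]], of "1/2"] by simp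
  from upow_add[OF 1 upow_mono[OF upow_c]] \<alpha> show ?thesis
    by (simp add: wkbA_def)
qed

lemma upow_wkbA_0: "upow W (wkbA \<alpha>) 0"
  using upow_add[OF upow_mono[OF upow_wkbA, of 0] upow_const[of W 1]] \<alpha> by simp

lemma upow_eta_1: "upow W (\<lambda>n w. eta \<alpha> n w - 1) (-\<alpha>/2)"
  using upow_diff[OF upow_mono[OF upow_wkbA] upow_wkbB] \<alpha> by (simp add: eta_def algebra_simps)

lemma eta_close: "\<epsilon> > 0 \<Longrightarrow> \<forall>\<^sub>F n in sequentially. \<forall>w\<in>W. cmod (eta \<alpha> n w - 1) \<le> \<epsilon>"
  using upow_eventually_small[OF upow_eta_1] \<alpha> by simp

lemma upow_wkbD: "upow W (\<lambda>n w. wkbD \<alpha> n w - 1 + of_real (\<alpha> / (2 * real n))) (-1-\<alpha>)"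
proof -
  have 1: "upow W (\<lambda>n w. of_real (\<alpha> / (4 * real n)) * (w\<^sup>2 * of_real (real n powr (-\<alpha>)))) (-1-\<alpha>)"
    using upow_mult[OF upow_c upow_mult[OF upow_w2 upow_powr[of W "-\<alpha>"]]] by simp
  have 2: "upow W (\<lambda>n w. of_real (\<alpha> / (4 * real n)) * of_real (\<alpha> / (4 * real n))) (-2)"
    using upow_mult[OF upow_c upow_c] by simp
  show ?thesis
    using upow_add[OF 1 upow_mono[OF 2]] \<alpha> by (simp add: wkbD_def power2_eq_square mult.assoc)
qed

lemma upow_wkbD_1: "upow W (\<lambda>n w. wkbD \<alpha> n w - 1) (-1)"
  using upow_diff[OF upow_mono[OF upow_wkbD, of "-1"] upow_cmult[OF upow_inverse_n, where c = "of_real (\<alpha>/2)"]] \<alpha>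
  by simp

lemma wkbD_close: "\<epsilon> > 0 \<Longrightarrow> \<forall>\<^sub>F n in sequentially. \<forall>w\<in>W. cmod (wkbD \<alpha> n w - 1) \<le> \<epsilon>"
  using upow_eventually_small[OF upow_wkbD_1] by simp

lemma upow_inverse_near_1:
  assumes "\<forall>\<^sub>F n in sequentially. \<forall>w\<in>W. cmod (f n w - 1) \<le> 1/2"
  shows "upow W (\<lambda>n w. 1 / f n w) 0"
proof -
  obtain N where N: "\<And>n w. n \<ge> N \<Longrightarrow> w \<in> W \<Longrightarrow> cmod (f n w - 1) \<le> 1/2"
    using assms unfolding eventually_sequentially by blast
  show ?thesis
  proof (rule upowI[of 2 "max N 1"])
    fix n w assume n: "n \<ge> max N 1" "w \<in> W"
    have "1 \<le> cmod (f n w) + cmod (f n w - 1)"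
      using norm_triangle_ineq4[of "f n w" "f n w - 1"] by simp
    then have "1/2 \<le> cmod (f n w)" using N[of n w] n by simp
    then show "cmod (1 / f n w) \<le> 2 * real n powr 0"
      using n by (simp add: norm_divide divide_simps)
  qed simp
qed

text \<open>
  Since \<open>1 / eta n w = eta n (- w) / D\<^sub>n\<close>, this is the quotient by which \<open>((n-1)/n) powr \<alpha> / eta n w\<close> differs
  from \<open>eta n (- w)\<close>.  The \<open>1 - \<alpha>/n\<close> of the numerator against the \<open>1 - \<alpha>/(2n)\<close> of \<open>D\<^sub>n\<close> leaves \<open>1 - \<alpha>/(2n)\<close>.
\<close>

lemma upow_kappa:
  "upow W (\<lambda>n w. of_real ((1 - 1 / real n) powr \<alpha>) / wkbD \<alpha> n w - 1 + of_real (\<alpha> / (2 * real n))) (-1-\<alpha>)"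
proof -
  let ?c = "\<lambda>n. of_real (\<alpha> / (2 * real n)) :: complex"
  have c: "upow W (\<lambda>n w. ?c n) (-1)"
    using upow_cmult[OF upow_inverse_n, where c = "of_real (\<alpha>/2)"] by simp
  have 1: "upow W (\<lambda>n w. of_real ((1 - 1 / real n) powr \<alpha> - 1 + \<alpha> / real n)) (-1-\<alpha>)"
    using upow_mono[OF upow_powr_expansion(2)] \<alpha> by simp
  have 2: "upow W (\<lambda>n w. (1 - ?c n) * (wkbD \<alpha> n w - 1 + ?c n)) (-1-\<alpha>)"
    using upow_mult[OF upow_diff[OF upow_const[of W 1] upow_mono[OF c]] upow_wkbD] by simp
  have 3: "upow W (\<lambda>n w. ?c n * ?c n) (-1-\<alpha>)"
    using upow_mono[OF upow_mult[OF c c]] \<alpha> by simp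
  have 4: "upow W (\<lambda>n w. of_real ((1 - 1 / real n) powr \<alpha> - 1 + \<alpha> / real n)
      - ((1 - ?c n) * (wkbD \<alpha> n w - 1 + ?c n)) - ?c n * ?c n) (-1-\<alpha>)"
    by (intro upow_diff 1 2 3)
  have 5: "upow W (\<lambda>n w. (of_real ((1 - 1 / real n) powr \<alpha> - 1 + \<alpha> / real n)
      - ((1 - ?c n) * (wkbD \<alpha> n w - 1 + ?c n)) - ?c n * ?c n) * (1 / wkbD \<alpha> n w)) (-1-\<alpha>)"
    using upow_mult[OF 4 upow_inverse_near_1[OF wkbD_close]] by simp
  obtain N where N: "\<And>n w. n \<ge> N \<Longrightarrow> w \<in> W \<Longrightarrow> cmod (wkbD \<alpha> n w - 1) \<le> 1/2"
    using wkbD_close[of "1/2"] unfolding eventually_sequentially by auto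
  show ?thesis
  proof (rule upow_cong[OF 5, of N])
    fix n w assume nw: "n \<ge> N" "w \<in> W"
    then have nz: "wkbD \<alpha> n w \<noteq> 0" using N[OF nw] by auto
    have d: "of_real (\<alpha> / real n) = 2 * ?c n" by simp
    have "of_real ((1 - 1 / real n) powr \<alpha>) / wkbD \<alpha> n w - 1 + ?c n
      = (of_real ((1 - 1 / real n) powr \<alpha> - 1 + \<alpha> / real n)
      - ((1 - ?c n) * (wkbD \<alpha> n w - 1 + ?c n)) - ?c n * ?c n) * (1 / wkbD \<alpha> n w)"
      unfolding of_real_add of_real_diff d using nz by (simp add: divide_simps del: of_real_divide) (simp add: algebra_simps del: of_real_divide)
    then show "cmod (of_real ((1 - 1 / real n) powr \<alpha>) / wkbD \<alpha> n w - 1 + ?c n)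
      \<le> cmod ((of_real ((1 - 1 / real n) powr \<alpha> - 1 + \<alpha> / real n)
      - ((1 - ?c n) * (wkbD \<alpha> n w - 1 + ?c n)) - ?c n * ?c n) * (1 / wkbD \<alpha> n w))" by simp
  qed
qed

end

context wkb begin

text \<open>
  The sum of two neighbouring roots has modulus at least one, so their difference is bounded by the difference
  of the radicands.
\<close>

lemma upow_csqrt_diff: "upow W (\<lambda>n w. csqrt (wkb_radicand \<alpha> (Suc n) w) - csqrt (wkb_radicand \<alpha> n w)) (-1-\<beta>)"
proof -
  have 1: "upow W (\<lambda>n w. (w\<^sup>2 / 4) * of_real (real (Suc n) powr (-\<alpha>) - real n powr (-\<alpha>))) (-\<alpha>-1)"
    using upow_mult[OF upow_cmult[OF upow_w2, of "1/4"] upow_powr_diff[of W "-\<alpha>"]] by simp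
  have 2: "upow W (\<lambda>n w. (of_real \<alpha> * (1 / w\<^sup>2)) * of_real (real (Suc n) powr (\<alpha> - 1) - real n powr (\<alpha> - 1))) (\<alpha>-1-1)"
    using upow_mult[OF upow_cmult[OF upow_inverse_w2, of "of_real \<alpha>"] upow_powr_diff[of W "\<alpha>-1"]] by simp
  have 3: "upow W (\<lambda>n w. wkb_radicand \<alpha> (Suc n) w - wkb_radicand \<alpha> n w) (-1-\<beta>)"
    using upow_add[OF upow_mono[OF 1] upow_mono[OF 2], of "-1-\<beta>"] \<beta>
    by (simp add: wkb_radicand_def algebra_simps)
  obtain N where N: "\<And>n w. n \<ge> N \<Longrightarrow> w \<in> W \<Longrightarrow> cmod (wkb_radicand \<alpha> n w - 1) \<le> 1/2"
    using wkb_radicand_close unfolding eventually_sequentially by blast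
  show ?thesis
  proof (rule upow_cong[OF 3, of N])
    fix n w assume nw: "n \<ge> N" "w \<in> W"
    let ?s = "csqrt (wkb_radicand \<alpha> n w)" and ?t = "csqrt (wkb_radicand \<alpha> (Suc n) w)"
    have "Re ?s \<ge> 1/2" "Re ?t \<ge> 1/2"
      using csqrt_near_1(1)[OF N[OF nw]] csqrt_near_1(1)[OF N[of "Suc n" w]] nw by simp_all
    then have "1 \<le> Re (?t + ?s)" by simp
    then have 1: "1 \<le> cmod (?t + ?s)" using complex_Re_le_cmod order_trans by blast
    have "wkb_radicand \<alpha> (Suc n) w - wkb_radicand \<alpha> n w = ?t\<^sup>2 - ?s\<^sup>2" by simp
    also have "\<dots> = (?t - ?s) * (?t + ?s)" by (simp add: power2_eq_square algebra_simps)
    finally have "cmod (wkb_radicand \<alpha> (Suc n) w - wkb_radicand \<alpha> n w) = cmod (?t - ?s) * cmod (?t + ?s)"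
      by (simp only: norm_mult)
    moreover have "cmod (?t - ?s) * 1 \<le> cmod (?t - ?s) * cmod (?t + ?s)"
      using 1 by (rule mult_left_mono) simp
    ultimately show "cmod (?t - ?s) \<le> cmod (wkb_radicand \<alpha> (Suc n) w - wkb_radicand \<alpha> n w)" by simp
  qed
qed

lemma upow_h_expansion:
  "upow W (\<lambda>n w. of_real (real (Suc n) powr (-\<alpha>/2) - real n powr (-\<alpha>/2) + \<alpha> / (2 * real n) * real n powr (-\<alpha>/2)))
    (-\<alpha>/2 - 2)"
proof -
  have "upow W (\<lambda>n w. of_real (real n powr (-\<alpha>/2)) *
      of_real ((1 + 1 / real n) powr (-\<alpha>/2) - 1 - (-\<alpha>/2) / real n)) (-\<alpha>/2 + -2)"
    by (rule upow_mult[OF upow_powr upow_powr_expansion(1)])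
  then have "upow W (\<lambda>n w. of_real (real n powr (-\<alpha>/2)) *
      of_real ((1 + 1 / real n) powr (-\<alpha>/2) - 1 - (-\<alpha>/2) / real n)) (-\<alpha>/2 - 2)" by simp
  then show ?thesis
  proof (rule upow_cong[of _ _ _ 1])
    fix n :: nat and w :: complex assume n: "n \<ge> 1"
    have "real (Suc n) = real n * (1 + 1 / real n)"
      using n by (simp add: field_simps)
    then have "real (Suc n) powr (-\<alpha>/2) = (real n * (1 + 1 / real n)) powr (-\<alpha>/2)" by simp
    also have "\<dots> = real n powr (-\<alpha>/2) * (1 + 1 / real n) powr (-\<alpha>/2)"
      by (simp add: powr_mult)
    finally have "real (Suc n) powr (-\<alpha>/2) - real n powr (-\<alpha>/2) + \<alpha> / (2 * real n) * real n powr (-\<alpha>/2)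
      = real n powr (-\<alpha>/2) * ((1 + 1 / real n) powr (-\<alpha>/2) - 1 - (-\<alpha>/2) / real n)"
      by (simp add: algebra_simps)
    then show "cmod (of_real (real (Suc n) powr (-\<alpha>/2) - real n powr (-\<alpha>/2) + \<alpha> / (2 * real n) * real n powr (-\<alpha>/2)))
        \<le> cmod (of_real (real n powr (-\<alpha>/2)) * of_real ((1 + 1 / real n) powr (-\<alpha>/2) - 1 - (-\<alpha>/2) / real n))"
      by (simp only: of_real_mult[symmetric])
  qed
qed

text \<open>
  With this \<open>\<delta>\<close>, multiplication of the bound on the free residual by \<open>n powr (\<alpha>/2)\<close> leaves a summable power.
\<close>

definition \<delta> where "\<delta> = min (\<alpha>/2) (1 - \<alpha>)"
lemma \<delta>: "\<delta> > 0" "\<delta> \<le> \<alpha>/2" "\<delta> \<le> 1 - \<alpha>" using \<alpha> by (simp_all add: \<delta>_def min_def)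

text \<open>
  The residual for \<open>a\<^sub>n = n powr \<alpha>\<close> and \<open>b\<^sub>n = - 2 * n powr \<alpha>\<close>, divided by \<open>n powr \<alpha>\<close>.  By the definition of \<open>A\<^sub>n\<close>
  and \<open>upow_kappa\<close>, the terms of order \<open>n powr (-\<alpha>)\<close> and \<open>1/n\<close> cancel.  The terms of order \<open>n powr (-1-\<alpha>/2)\<close> are
  \<open>- (B\<^sub>n\<^sub>+\<^sub>1 - B\<^sub>n) - \<alpha>/(2n) * B\<^sub>n\<close>; as \<open>B\<^sub>n\<close> is \<open>n powr (-\<alpha>/2)\<close> times a slowly varying factor, they cancel too.
\<close>

lemma upow_free_residual:
  "upow W (\<lambda>n w. of_real ((1 - 1 / real n) powr \<alpha>) / eta \<alpha> n w - 2 - w\<^sup>2 * of_real (real n powr (-\<alpha>)) + eta \<alpha> (Suc n) w)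
    (-1-\<delta>-\<alpha>/2)"
proof -
  let ?e = "-1-\<delta>-\<alpha>/2"
  let ?c = "\<lambda>n. of_real (\<alpha> / (2 * real n)) :: complex"
  let ?k = "\<lambda>n w. of_real ((1 - 1 / real n) powr \<alpha>) / wkbD \<alpha> n w - 1 + ?c n"
  let ?H = "\<lambda>n. real n powr (-\<alpha>/2)"
  let ?S = "\<lambda>n w. csqrt (wkb_radicand \<alpha> n w)"
  have c: "upow W (\<lambda>n w. ?c n) (-1)"
    using upow_cmult[OF upow_inverse_n, where c = "of_real (\<alpha>/2)"] by simp
  have 1: "upow W (\<lambda>n w. ?c n * (wkbA \<alpha> n w - 1)) ?e"
    using upow_mono[OF upow_mult[OF c upow_wkbA]] \<delta> by simp
  have 2: "upow W (\<lambda>n w. ?k n w * (wkbA \<alpha> n w + wkbB \<alpha> n w)) ?e"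
  proof -
    have "upow W (\<lambda>n w. wkbA \<alpha> n w + wkbB \<alpha> n w) 0"
      using upow_add[OF upow_wkbA_0 upow_mono[OF upow_wkbB]] \<alpha> by simp
    from upow_mono[OF upow_mult[OF upow_kappa this]] show ?thesis using \<delta> by simp
  qed
  have 3: "upow W (\<lambda>n w. (w\<^sup>2 / 2) * of_real (real (Suc n) powr (-\<alpha>) - real n powr (-\<alpha>))) ?e"
    using upow_mono[OF upow_mult[OF upow_cmult[OF upow_w2, of "1/2"] upow_powr_diff[of W "-\<alpha>"]]] \<delta> by simp
  have 4: "upow W (\<lambda>n w. of_real (\<alpha>/4) * of_real (real (Suc n) powr (-1) - real n powr (-1))) ?e"
    using upow_mono[OF upow_cmult[OF upow_powr_diff[of W "-1"], where c = "of_real (\<alpha>/4)"]] \<delta> \<alpha> by simp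
  have 5: "upow W (\<lambda>n w. w * of_real (?H (Suc n)) * (?S (Suc n) w - ?S n w)) ?e"
  proof -
    have "upow W (\<lambda>n w. w * of_real (?H (Suc n)) * (?S (Suc n) w - ?S n w)) (0 + -\<alpha>/2 + (-1-\<beta>))"
      by (intro upow_mult upow_w upow_csqrt_diff upow_shift[OF upow_powr])
    from upow_mono[OF this] show ?thesis using \<delta> \<beta> by (simp add: \<beta>_def \<delta>_def min_def split: if_splits)
  qed
  have 6: "upow W (\<lambda>n w. w * ?S n w * of_real (?H (Suc n) - ?H n + \<alpha> / (2 * real n) * ?H n)) ?e"
  proof -
    have "upow W (\<lambda>n w. w * ?S n w * of_real (?H (Suc n) - ?H n + \<alpha> / (2 * real n) * ?H n)) (0 + 0 + (-\<alpha>/2 - 2))"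
      by (intro upow_mult upow_w upow_csqrt upow_h_expansion)
    from upow_mono[OF this] show ?thesis using \<delta> \<alpha> by simp
  qed
  have 7: "upow W (\<lambda>n w. - (?c n * (wkbA \<alpha> n w - 1)) + ?k n w * (wkbA \<alpha> n w + wkbB \<alpha> n w)
      + ((w\<^sup>2 / 2) * of_real (real (Suc n) powr (-\<alpha>) - real n powr (-\<alpha>))
        + of_real (\<alpha>/4) * of_real (real (Suc n) powr (-1) - real n powr (-1)))
      - (w * of_real (?H (Suc n)) * (?S (Suc n) w - ?S n w)
        + w * ?S n w * of_real (?H (Suc n) - ?H n + \<alpha> / (2 * real n) * ?H n))) ?e"
    by (intro upow_add upow_diff upow_uminus 1 2 3 4 5 6)
  obtain N where N: "\<And>n w. n \<ge> N \<Longrightarrow> w \<in> W \<Longrightarrow> cmod (wkbD \<alpha> n w - 1) \<le> 1/2"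
    using wkbD_close[of "1/2"] unfolding eventually_sequentially by auto
  show ?thesis
  proof (rule upow_cong[OF 7, of "max N 1"])
    fix n w assume nw: "n \<ge> max N 1" "w \<in> W"
    then have D: "wkbD \<alpha> n w \<noteq> 0" using N[of n w] by auto
    have ee: "eta \<alpha> n w * (wkbA \<alpha> n w + wkbB \<alpha> n w) = wkbD \<alpha> n w"
      using eta_mult_eta_minus[OF W_nz[OF nw(2)], of n \<alpha>] nw by (simp add: eta_minus_w)
    have "eta \<alpha> n w \<noteq> 0" using ee D by auto
    then have i: "1 / eta \<alpha> n w = (wkbA \<alpha> n w + wkbB \<alpha> n w) / wkbD \<alpha> n w"
      using ee D by (simp add: field_simps)
    have A: "2 * wkbA \<alpha> n w - 2 - w\<^sup>2 * of_real (real n powr (-\<alpha>)) = ?c n"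
      by (simp add: wkbA_def)
    have dA: "wkbA \<alpha> (Suc n) w - wkbA \<alpha> n w = (w\<^sup>2 / 2) * of_real (real (Suc n) powr (-\<alpha>) - real n powr (-\<alpha>))
        + of_real (\<alpha>/4) * of_real (real (Suc n) powr (-1) - real n powr (-1))"
    proof -
      have "real k powr (-1) = 1 / real k" for k :: nat by (cases "k = 0") (simp_all add: powr_minus_divide)
      then show ?thesis unfolding wkbA_def by (simp add: algebra_simps)
    qed
    have dB: "wkbB \<alpha> (Suc n) w - wkbB \<alpha> n w + ?c n * wkbB \<alpha> n w
        = w * of_real (?H (Suc n)) * (?S (Suc n) w - ?S n w)
        + w * ?S n w * of_real (?H (Suc n) - ?H n + \<alpha> / (2 * real n) * ?H n)"
      unfolding wkbB_def by (simp add: algebra_simps)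
    define \<kappa> where "\<kappa> = of_real ((1 - 1 / real n) powr \<alpha>) / wkbD \<alpha> n w"
    have "of_real ((1 - 1 / real n) powr \<alpha>) / eta \<alpha> n w = \<kappa> * (wkbA \<alpha> n w + wkbB \<alpha> n w)"
      using i unfolding \<kappa>_def by (metis divide_inverse mult.assoc mult.commute mult.left_commute mult_1 times_divide_eq_right)
    moreover have "eta \<alpha> (Suc n) w = wkbA \<alpha> n w - wkbB \<alpha> n w + (wkbA \<alpha> (Suc n) w - wkbA \<alpha> n w)
        - (wkbB \<alpha> (Suc n) w - wkbB \<alpha> n w)" by (simp add: eta_def)
    ultimately have "of_real ((1 - 1 / real n) powr \<alpha>) / eta \<alpha> n w - 2 - w\<^sup>2 * of_real (real n powr (-\<alpha>)) + eta \<alpha> (Suc n) w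
      = (\<kappa> - 1) * (wkbA \<alpha> n w + wkbB \<alpha> n w) + (2 * wkbA \<alpha> n w - 2 - w\<^sup>2 * of_real (real n powr (-\<alpha>)))
        + (wkbA \<alpha> (Suc n) w - wkbA \<alpha> n w) - (wkbB \<alpha> (Suc n) w - wkbB \<alpha> n w)"
      by (simp add: algebra_simps)
    also have "\<dots> = - (?c n * (wkbA \<alpha> n w - 1)) + (\<kappa> - 1 + ?c n) * (wkbA \<alpha> n w + wkbB \<alpha> n w)
      + (wkbA \<alpha> (Suc n) w - wkbA \<alpha> n w) - (wkbB \<alpha> (Suc n) w - wkbB \<alpha> n w + ?c n * wkbB \<alpha> n w)"
      unfolding A by (simp add: algebra_simps del: of_real_divide)
    finally show "cmod (of_real ((1 - 1 / real n) powr \<alpha>) / eta \<alpha> n w - 2 - w\<^sup>2 * of_real (real n powr (-\<alpha>)) + eta \<alpha> (Suc n) w)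
      \<le> cmod (- (?c n * (wkbA \<alpha> n w - 1)) + ?k n w * (wkbA \<alpha> n w + wkbB \<alpha> n w)
      + ((w\<^sup>2 / 2) * of_real (real (Suc n) powr (-\<alpha>) - real n powr (-\<alpha>))
        + of_real (\<alpha>/4) * of_real (real (Suc n) powr (-1) - real n powr (-1)))
      - (w * of_real (?H (Suc n)) * (?S (Suc n) w - ?S n w)
        + w * ?S n w * of_real (?H (Suc n) - ?H n + \<alpha> / (2 * real n) * ?H n)))"
      unfolding dA dB \<kappa>_def by simp
  qed
qed

end

locale perturbed_wkb = wkb +
  fixes p q a b :: "nat \<Rightarrow> real"
  assumes a_def: "\<And>n. n \<ge> 1 \<Longrightarrow> a n = real n powr \<alpha> + p n"
    and b_def: "\<And>n. n \<ge> 1 \<Longrightarrow> b n = - 2 * real n powr \<alpha> + q n"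
    and a_pos: "\<And>n. n \<ge> 1 \<Longrightarrow> a n > 0"
    and p_l1: "summable (\<lambda>n. \<bar>p n / real n powr (\<alpha> / 2)\<bar>)"
    and q_l1: "summable (\<lambda>n. \<bar>q n / real n powr (\<alpha> / 2)\<bar>)"
begin

text \<open>
  What remains of the recurrence when \<open>Q\<^sub>n = \<Prod>l\<le>n. eta l w\<close> is inserted and the result is divided by \<open>Q\<^sub>n\<close>.
\<close>

definition residual :: "nat \<Rightarrow> complex \<Rightarrow> complex" where
  "residual n w = of_real (a (n - 1)) / eta \<alpha> n w + of_real (b n) - w\<^sup>2 + of_real (a n) * eta \<alpha> (Suc n) w"

text \<open>
  The perturbations enter linearly, with the bounded factors \<open>1 / eta n w\<close> and \<open>eta (Suc n) w\<close>.
\<close>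

lemma residual_summable:
  "\<exists>g N. summable g \<and> (\<forall>n. 0 \<le> g n) \<and>
    (\<forall>n\<ge>N. \<forall>w\<in>W. cmod (residual n w) * real n powr (-\<alpha>/2) \<le> g n)"
proof -
  obtain C N1 where C: "C \<ge> 0" "N1 \<ge> 1"
    "\<And>n w. n \<ge> N1 \<Longrightarrow> w \<in> W \<Longrightarrow> cmod (of_real ((1 - 1 / real n) powr \<alpha>) / eta \<alpha> n w - 2
      - w\<^sup>2 * of_real (real n powr (-\<alpha>)) + eta \<alpha> (Suc n) w) \<le> C * real n powr (-1-\<delta>-\<alpha>/2)"
    using upowE[OF upow_free_residual] by blast
  obtain N2 where N2: "\<And>n w. n \<ge> N2 \<Longrightarrow> w \<in> W \<Longrightarrow> cmod (eta \<alpha> n w - 1) \<le> 1/2"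
    using eta_close[of "1/2"] unfolding eventually_sequentially by auto
  define P where "P n = \<bar>p n / real n powr (\<alpha> / 2)\<bar>" for n
  define Qs where "Qs n = \<bar>q n / real n powr (\<alpha> / 2)\<bar>" for n
  define g where "g n = C * real n powr (-1-\<delta>) + 2 * P (n - 1) + Qs n + 2 * P n" for n
  have g1: "summable (\<lambda>n. C * real n powr (-1-\<delta>))"
    using \<delta> by (intro summable_mult) (simp add: summable_real_powr_iff)
  have g2: "summable (\<lambda>n. 2 * P (n - 1))"
    using summable_mult[OF p_l1, of 2] summable_Suc_iff[of "\<lambda>n. 2 * P (n - 1)"]
    unfolding P_def[abs_def] by simp
  have gP: "summable (\<lambda>n. 2 * P n)" and gQ: "summable Qs"
    using summable_mult[OF p_l1, of 2] q_l1 unfolding P_def[abs_def] Qs_def[abs_def] .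
  have "summable g" unfolding g_def
    by (rule summable_add[OF summable_add[OF summable_add[OF g1 g2] gQ] gP])
  moreover have "0 \<le> g n" for n unfolding g_def P_def Qs_def using C(1) by simp
  moreover have "cmod (residual n w) * real n powr (-\<alpha>/2) \<le> g n" if n: "n \<ge> max N1 (max N2 2)" and w: "w \<in> W" for n w
  proof -
    have n2: "n \<ge> 2" using n by simp
    have eta: "1/2 \<le> cmod (eta \<alpha> n w)" "cmod (eta \<alpha> (Suc n) w) \<le> 2"
    proof -
      have "1 \<le> cmod (eta \<alpha> n w) + cmod (eta \<alpha> n w - 1)"
        using norm_triangle_ineq4[of "eta \<alpha> n w" "eta \<alpha> n w - 1"] by simp
      then show "1/2 \<le> cmod (eta \<alpha> n w)" using N2[of n w] n w by simp
      have "cmod (eta \<alpha> (Suc n) w) \<le> cmod (eta \<alpha> (Suc n) w - 1) + 1"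
        using norm_triangle_ineq[of "eta \<alpha> (Suc n) w - 1" 1] by simp
      then show "cmod (eta \<alpha> (Suc n) w) \<le> 2" using N2[of "Suc n" w] n w by simp
    qed
    let ?E = "of_real ((1 - 1 / real n) powr \<alpha>) / eta \<alpha> n w - 2 - w\<^sup>2 * of_real (real n powr (-\<alpha>)) + eta \<alpha> (Suc n) w"
    have nn: "real n powr \<alpha> * real n powr (-\<alpha>) = 1" using n2 by (simp add: powr_minus)
    have nn': "(of_real (real n powr \<alpha>) :: complex) * of_real (real n powr (-\<alpha>)) = 1"
      using arg_cong[OF nn, of complex_of_real] by (simp only: of_real_mult of_real_1)
    have n1: "real (n - 1) powr \<alpha> = real n powr \<alpha> * (1 - 1 / real n) powr \<alpha>"
    proof -
      have "real (n - 1) = real n * (1 - 1 / real n)" using n2 by (simp add: field_simps of_nat_diff)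
      then show ?thesis by (simp only: powr_mult)
    qed
    have "residual n w = of_real (real n powr \<alpha>) * ?E
        + (of_real (p (n - 1)) * (1 / eta \<alpha> n w) + of_real (q n) + of_real (p n) * eta \<alpha> (Suc n) w)"
    proof -
      let ?X = "complex_of_real (real n powr \<alpha>)"
      have f1: "of_real (a (n - 1)) = ?X * of_real ((1 - 1 / real n) powr \<alpha>) + of_real (p (n - 1))"
        using a_def[of "n - 1"] n2 n1 by (simp only: of_real_mult[symmetric] of_real_add[symmetric])
      have f2: "of_real (a n) = ?X + of_real (p n)" and f3: "of_real (b n) = - 2 * ?X + of_real (q n)"
        using a_def[of n] b_def[of n] n2 by simp_all
      have "?X * ?E = ?X * of_real ((1 - 1 / real n) powr \<alpha>) / eta \<alpha> n w
          - 2 * ?X - w\<^sup>2 * (?X * of_real (real n powr (-\<alpha>))) + ?X * eta \<alpha> (Suc n) w"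
        by (simp add: algebra_simps)
      then have f4: "?X * ?E = ?X * of_real ((1 - 1 / real n) powr \<alpha>) / eta \<alpha> n w
          - 2 * ?X - w\<^sup>2 + ?X * eta \<alpha> (Suc n) w"
        unfolding nn' by simp
      show ?thesis
        unfolding f4 residual_def f1 f2 f3 by (simp add: add_divide_distrib algebra_simps)
    qed
    then have "cmod (residual n w) \<le> cmod (of_real (real n powr \<alpha>) * ?E)
        + (cmod (of_real (p (n - 1)) * (1 / eta \<alpha> n w)) + cmod (of_real (q n)) + cmod (of_real (p n) * eta \<alpha> (Suc n) w))"
      by (simp only:) (intro norm_triangle_le add_mono order_refl)
    also have "\<dots> \<le> real n powr \<alpha> * (C * real n powr (-1-\<delta>-\<alpha>/2)) + (2 * \<bar>p (n - 1)\<bar> + \<bar>q n\<bar> + 2 * \<bar>p n\<bar>)"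
    proof (intro add_mono)
      show "cmod (of_real (real n powr \<alpha>) * ?E) \<le> real n powr \<alpha> * (C * real n powr (-1-\<delta>-\<alpha>/2))"
        unfolding norm_mult using C(3)[of n w] n w by (intro mult_mono) auto
      have "1 / cmod (eta \<alpha> n w) \<le> 2" using eta(1) by (simp add: divide_simps)
      then have "\<bar>p (n - 1)\<bar> * (1 / cmod (eta \<alpha> n w)) \<le> \<bar>p (n - 1)\<bar> * 2" by (intro mult_left_mono) auto
      then show "cmod (of_real (p (n - 1)) * (1 / eta \<alpha> n w)) \<le> 2 * \<bar>p (n - 1)\<bar>"
        by (simp add: norm_mult norm_divide)
      show "cmod (of_real (p n) * eta \<alpha> (Suc n) w) \<le> 2 * \<bar>p n\<bar>"
        using mult_left_mono[OF eta(2), of "\<bar>p n\<bar>"] by (simp add: norm_mult)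
    qed simp
    finally have "cmod (residual n w) * real n powr (-\<alpha>/2)
        \<le> (real n powr \<alpha> * (C * real n powr (-1-\<delta>-\<alpha>/2)) + (2 * \<bar>p (n - 1)\<bar> + \<bar>q n\<bar> + 2 * \<bar>p n\<bar>)) * real n powr (-\<alpha>/2)"
      by (rule mult_right_mono) simp
    also have "\<dots> = C * (real n powr \<alpha> * real n powr (-1-\<delta>-\<alpha>/2) * real n powr (-\<alpha>/2))
        + 2 * (\<bar>p (n - 1)\<bar> * real n powr (-\<alpha>/2)) + \<bar>q n\<bar> * real n powr (-\<alpha>/2) + 2 * (\<bar>p n\<bar> * real n powr (-\<alpha>/2))"
      by (simp add: algebra_simps)
    also have "real n powr \<alpha> * real n powr (-1-\<delta>-\<alpha>/2) * real n powr (-\<alpha>/2) = real n powr (-1-\<delta>)"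
      by (simp only: powr_add[symmetric]) simp
    also have "\<bar>p (n - 1)\<bar> * real n powr (-\<alpha>/2) \<le> P (n - 1)"
    proof -
      have "real n powr (-\<alpha>/2) \<le> real (n - 1) powr (-\<alpha>/2)" using n2 \<alpha> by (intro powr_mono2') auto
      then have "\<bar>p (n - 1)\<bar> * real n powr (-\<alpha>/2) \<le> \<bar>p (n - 1)\<bar> * real (n - 1) powr (-\<alpha>/2)"
        by (rule mult_left_mono) simp
      also have "\<dots> = P (n - 1)" by (simp add: P_def powr_minus_divide abs_divide)
      finally show ?thesis .
    qed
    also have "\<bar>q n\<bar> * real n powr (-\<alpha>/2) = Qs n" by (simp add: Qs_def powr_minus_divide abs_divide)
    also have "\<bar>p n\<bar> * real n powr (-\<alpha>/2) = P n" by (simp add: P_def powr_minus_divide abs_divide)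
    finally show ?thesis by (simp add: g_def)
  qed
  ultimately show ?thesis by blast
qed

end

section \<open>Comparison of the two characteristic roots\<close>

lemma csqrt_minus_1_bound:
  assumes "cmod (x - 1) \<le> 1/2"
  shows "cmod (csqrt x - 1) \<le> cmod (x - 1)"
proof -
  have "1 \<le> Re (csqrt x + 1)" using Re_csqrt[of x] by simp
  then have 1: "1 \<le> cmod (csqrt x + 1)" using complex_Re_le_cmod order_trans by blast
  have "x - 1 = (csqrt x - 1) * (csqrt x + 1)"
    using power2_csqrt[of x] by (simp add: algebra_simps power2_eq_square)
  then have "cmod (x - 1) = cmod (csqrt x - 1) * cmod (csqrt x + 1)"
    by (metis norm_mult)
  moreover have "cmod (csqrt x - 1) * 1 \<le> cmod (csqrt x - 1) * cmod (csqrt x + 1)"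
    using 1 by (rule mult_left_mono) simp
  ultimately show ?thesis by simp
qed

context wkb begin

text \<open>
  The claim is \<open>Re (B / A) \<ge> 0\<close>.  Let \<open>\<zeta> = B / (h A)\<close> with \<open>h = n powr (-\<alpha>/2)\<close>, which is close to \<open>w\<close>.  The square
  of \<open>B / A\<close> is a quadratic polynomial in \<open>1 / A\<close> with real coefficients, so \<open>Im (\<zeta>\<^sup>2)\<close> is a positive multiple of
  \<open>Im (w\<^sup>2)\<close>.  If \<open>Re \<zeta> < 0 \<le> Re w\<close>, the imaginary parts of \<open>\<zeta>\<close> and \<open>w\<close> cannot have the same strict sign, so
  \<open>\<bar>\<zeta> - w\<bar> \<ge> \<bar>w\<bar>\<close>, which contradicts closeness.
\<close>

lemma eta_le_eta_minus:
  "\<forall>\<^sub>F n in sequentially. \<forall>w\<in>W. 0 \<le> Re w \<longrightarrow> cmod (eta \<alpha> n w) \<le> cmod (eta \<alpha> n (- w))"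
proof -
  have e1: "\<forall>\<^sub>F n in sequentially. \<forall>w\<in>W. cmod (wkb_radicand \<alpha> n w - 1) \<le> 1/4"
    using upow_eventually_small[OF upow_radicand, of "1/4"] \<beta> by simp
  have e2: "\<forall>\<^sub>F n in sequentially. \<forall>w\<in>W. cmod (wkbA \<alpha> n w - 1) \<le> 1/4"
    using upow_eventually_small[OF upow_wkbA, of "1/4"] \<alpha> by simp
  show ?thesis
    using e1 e2 eventually_ge_at_top[of 2]
  proof eventually_elim
    case (elim n)
    show ?case
    proof (intro ballI impI)
      fix w assume w: "w \<in> W" and Rw: "0 \<le> Re w"
      define h where "h = real n powr (-\<alpha>/2)"
      define A where "A = wkbA \<alpha> n w"
      define S where "S = csqrt (wkb_radicand \<alpha> n w)"
      define B where "B = wkbB \<alpha> n w"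
      define c where "c = \<alpha> / (4 * real n)"
      define \<zeta> where "\<zeta> = w * S / A"
      have n2: "n \<ge> 2" using elim by simp
      have h: "h > 0" using n2 by (simp add: h_def)
      have h2: "h * h = real n powr (-\<alpha>)" by (simp add: h_def powr_add[symmetric])
      have c: "0 < c" "c \<le> 1/8"
      proof -
        show "0 < c" using \<alpha> n2 by (simp add: c_def)
        have "\<alpha> \<le> 1" "8 \<le> 4 * real n" using \<alpha> n2 by auto
        then show "c \<le> 1/8" unfolding c_def using \<alpha> by (intro frac_le) auto
      qed
      have A1: "cmod (A - 1) \<le> 1/4" using elim(2) w by (simp add: A_def)
      have S1: "cmod (S - 1) \<le> 1/4"
        using elim(1) w csqrt_minus_1_bound[of "wkb_radicand \<alpha> n w"] by (force simp: S_def)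
      have Aabs: "3/4 \<le> cmod A" using norm_triangle_ineq4[of A "A - 1"] A1 by simp
      have A0: "A \<noteq> 0" using Aabs by auto
      have "\<bar>Re (A - 1)\<bar> \<le> 1/4" by (rule order_trans[OF abs_Re_le_cmod A1])
      then have ReA: "3/4 \<le> Re A" unfolding minus_complex.sel one_complex.sel by linarith
      have w0: "w \<noteq> 0" using W_nz[OF w] .
      have B\<zeta>: "B = of_real h * A * \<zeta>"
        using A0 by (simp add: B_def wkbB_def S_def \<zeta>_def h_def)
      have near: "cmod (\<zeta> - w) < cmod w"
      proof -
        have "\<zeta> - w = w * ((S - A) / A)" using A0 by (simp add: \<zeta>_def field_simps)
        then have "cmod (\<zeta> - w) = cmod w * (cmod (S - A) / cmod A)" by (simp add: norm_mult norm_divide)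
        also have "cmod (S - A) / cmod A \<le> (1/2) / (3/4)"
          using norm_triangle_ineq4[of "S - 1" "A - 1"] A1 S1 Aabs by (intro frac_le) auto
        then have "cmod w * (cmod (S - A) / cmod A) \<le> cmod w * (2/3)" by (intro mult_left_mono) auto
        also have "\<dots> < cmod w" using w0 by simp
        finally show ?thesis .
      qed
      have D: "A\<^sup>2 - B\<^sup>2 = 1 - 4 * of_real c + 2 * of_real c * A - (of_real c)\<^sup>2"
      proof -
        define y where "y = w\<^sup>2 * of_real (real n powr (-\<alpha>))"
        have "of_real (\<alpha> / real n) = 4 * (of_real c :: complex)" by (simp add: c_def)
        then show ?thesis
          using wkbB_squared[OF w0, of n \<alpha>] n2
          unfolding A_def B_def wkbA_def y_def[symmetric] c_def[symmetric]
          by (simp add: power2_eq_square algebra_simps)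
      qed
      define V where "V = 1 / A"
      define k where "k = 1 - 4 * c - c\<^sup>2"
      have k: "k > 0"
      proof -
        have "c * c \<le> (1/8) * (1/8)" using c by (intro mult_mono) auto
        then show ?thesis using c by (simp add: k_def power2_eq_square)
      qed
      have V: "Re V = Re A / (cmod A)\<^sup>2" "Im V = - Im A / (cmod A)\<^sup>2"
        by (simp_all add: V_def Re_divide Im_divide cmod_power2)
      have ReV: "Re V > 0" using ReA A0 by (simp add: V)
      have "of_real (h * h) * \<zeta>\<^sup>2 = (B * V)\<^sup>2"
        unfolding B\<zeta> V_def using A0 by (simp add: power2_eq_square field_simps)
      also have "\<dots> = (A\<^sup>2 - (1 - 4 * of_real c + 2 * of_real c * A - (of_real c)\<^sup>2)) * V\<^sup>2"
        unfolding D[symmetric] by (simp add: power_mult_distrib)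
      also have "\<dots> = 1 - 2 * of_real c * V - of_real k * V\<^sup>2"
        unfolding V_def k_def using A0 by (simp add: power2_eq_square field_simps)
      finally have "Im (of_real (h * h) * \<zeta>\<^sup>2) = Im (1 - 2 * of_real c * V - of_real k * V\<^sup>2)" by simp
      then have "h * h * Im (\<zeta>\<^sup>2) = - 2 * c * Im V - k * (2 * Re V * Im V)"
        by (simp add: power2_eq_square)
      also have "\<dots> = (c + k * Re V) * (2 * Im A / (cmod A)\<^sup>2)"
        by (simp add: V(2) algebra_simps add_divide_distrib)
      also have "2 * Im A = h * h * Im (w\<^sup>2)"
        unfolding h2 A_def wkbA_def by (simp add: Im_divide_numeral)
      finally have "h * h * Im (\<zeta>\<^sup>2) = h * h * (((c + k * Re V) / (cmod A)\<^sup>2) * Im (w\<^sup>2))" by simp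
      note hh = this
      have "h * h \<noteq> 0" using h by simp
      from iffD1[OF mult_left_cancel[OF this] hh]
      have eq: "Im (\<zeta>\<^sup>2) = ((c + k * Re V) / (cmod A)\<^sup>2) * Im (w\<^sup>2)" .
      define K where "K = (c + k * Re V) / (cmod A)\<^sup>2"
      have K: "K > 0" unfolding K_def using c k ReV A0 by (intro divide_pos_pos add_pos_pos mult_pos_pos) auto
      have eq': "Re \<zeta> * Im \<zeta> = K * (Re w * Im w)"
      proof -
        have "2 * (Re \<zeta> * Im \<zeta>) = K * (2 * (Re w * Im w))"
          using eq unfolding K_def[symmetric] by (simp add: power2_eq_square mult_ac)
        then show ?thesis by simp
      qed
      have Re\<zeta>: "Re \<zeta> \<ge> 0"
      proof (rule ccontr)
        assume "\<not> Re \<zeta> \<ge> 0"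
        then have neg: "Re \<zeta> < 0" by simp
        have "Im \<zeta> * Im w \<le> 0"
        proof (cases "Re w = 0")
          case True
          then show ?thesis using eq' neg by simp
        next
          case False
          have "Re \<zeta> * (Im \<zeta> * Im w) = K * Re w * (Im w * Im w)" using eq' by (metis mult.assoc)
          also have "\<dots> \<ge> 0"
            by (rule mult_nonneg_nonneg[OF mult_nonneg_nonneg[OF less_imp_le[OF K] Rw] zero_le_square])
          finally have "0 \<le> Re \<zeta> * (Im \<zeta> * Im w)" .
          then show ?thesis using neg by (simp add: zero_le_mult_iff)
        qed
        moreover have "Re \<zeta> * Re w \<le> 0" using neg Rw by (intro mult_nonpos_nonneg) auto
        moreover have "(cmod (\<zeta> - w))\<^sup>2 = (Re \<zeta>)\<^sup>2 + (Im \<zeta>)\<^sup>2 - 2 * (Re \<zeta> * Re w)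
            - 2 * (Im \<zeta> * Im w) + (cmod w)\<^sup>2"
          unfolding cmod_power2 by (simp add: power2_eq_square algebra_simps)
        ultimately have "(cmod w)\<^sup>2 \<le> (cmod (\<zeta> - w))\<^sup>2"
          using zero_le_power2[of "Re \<zeta>"] zero_le_power2[of "Im \<zeta>"] by linarith
        then have "cmod w \<le> cmod (\<zeta> - w)" by (rule power2_le_imp_le) simp
        then show False using near by simp
      qed
      have "(cmod (A + B))\<^sup>2 - (cmod (A - B))\<^sup>2 = 4 * Re (B * cnj A)"
        unfolding cmod_power2 by (simp add: power2_eq_square algebra_simps)
      also have "B * cnj A = of_real (h * (cmod A)\<^sup>2) * \<zeta>"
        unfolding B\<zeta> using complex_norm_square[of A] by (simp add: algebra_simps)
      also have "Re (of_real (h * (cmod A)\<^sup>2) * \<zeta>) = h * (cmod A)\<^sup>2 * Re \<zeta>" by simp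
      finally have "(cmod (A + B))\<^sup>2 - (cmod (A - B))\<^sup>2 = 4 * (h * (cmod A)\<^sup>2 * Re \<zeta>)" .
      moreover have "0 \<le> h * (cmod A)\<^sup>2 * Re \<zeta>" using h Re\<zeta> by (intro mult_nonneg_nonneg) auto
      ultimately have "(cmod (A - B))\<^sup>2 \<le> (cmod (A + B))\<^sup>2" by linarith
      then have "cmod (A - B) \<le> cmod (A + B)" by (rule power2_le_imp_le) simp
      moreover have "eta \<alpha> n w = A - B" "eta \<alpha> n (- w) = A + B"
        unfolding eta_minus_w A_def B_def by (simp_all add: eta_def)
      ultimately show "cmod (eta \<alpha> n w) \<le> cmod (eta \<alpha> n (- w))" by simp
    qed
  qed
qed

text \<open>
  The relative increment of \<open>n powr (\<alpha>/2) * Q\<^sub>n(w) * Q\<^sub>n(-w)\<close> from \<open>n - 1\<close> to \<open>n\<close>.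
\<close>

definition product_drift :: "nat \<Rightarrow> complex \<Rightarrow> complex" where
  "product_drift n w = of_real ((1 - 1 / real n) powr (-\<alpha>/2)) * wkbD \<alpha> n w - 1"

text \<open>
  The factor \<open>(1 - 1/n) powr (-\<alpha>/2)\<close> compensates the leading correction \<open>1 - \<alpha>/(2n)\<close> of \<open>D\<^sub>n\<close>.
\<close>

lemma upow_product_drift: "upow W product_drift (-1-\<alpha>)"
proof -
  let ?c = "\<lambda>n. of_real (\<alpha> / (2 * real n)) :: complex"
  let ?P = "\<lambda>n. (1 - 1 / real n) powr (-\<alpha>/2)"
  have c: "upow W (\<lambda>n w. ?c n) (-1)"
    using upow_cmult[OF upow_inverse_n, where c = "of_real (\<alpha>/2)"] by simp
  have 1: "upow W (\<lambda>n w. of_real (?P n - 1 + (-\<alpha>/2) / real n) * wkbD \<alpha> n w) (-1-\<alpha>)"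
  proof -
    have "upow W (wkbD \<alpha>) 0"
      using upow_add[OF upow_mono[OF upow_wkbD_1, of 0] upow_const[of W 1]] by simp
    from upow_mono[OF upow_mult[OF upow_powr_expansion(2)[of W "-\<alpha>/2"] this]] show ?thesis using \<alpha> by simp
  qed
  have 2: "upow W (\<lambda>n w. (1 + ?c n) * (wkbD \<alpha> n w - 1 + ?c n)) (-1-\<alpha>)"
    using upow_mult[OF upow_add[OF upow_const[of W 1] upow_mono[OF c]] upow_wkbD] by simp
  have 3: "upow W (\<lambda>n w. ?c n * ?c n) (-1-\<alpha>)"
    using upow_mono[OF upow_mult[OF c c]] \<alpha> by simp
  have 4: "upow W (\<lambda>n w. of_real (?P n - 1 + (-\<alpha>/2) / real n) * wkbD \<alpha> n w
      + (1 + ?c n) * (wkbD \<alpha> n w - 1 + ?c n) - ?c n * ?c n) (-1-\<alpha>)"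
    by (intro upow_add upow_diff 1 2 3)
  show ?thesis
  proof (rule upow_cong[OF 4, of 0])
    fix n w
    have d: "of_real (?P n - 1 + (-\<alpha>/2) / real n) = of_real (?P n) - 1 - ?c n" by simp
    have "product_drift n w = of_real (?P n - 1 + (-\<alpha>/2) / real n) * wkbD \<alpha> n w
      + (1 + ?c n) * (wkbD \<alpha> n w - 1 + ?c n) - ?c n * ?c n"
      unfolding d product_drift_def by (simp add: algebra_simps del: of_real_divide)
    then show "cmod (product_drift n w) \<le> cmod (of_real (?P n - 1 + (-\<alpha>/2) / real n) * wkbD \<alpha> n w
      + (1 + ?c n) * (wkbD \<alpha> n w - 1 + ?c n) - ?c n * ?c n)" by simp
  qed
qed

end

section \<open>Truncated Volterra equations\<close>

text \<open>
  The Weierstrass test for a telescoping series.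
\<close>

lemma uniform_limit_telescope:
  fixes f :: "nat \<Rightarrow> 'x \<Rightarrow> complex"
  assumes g: "summable g" and d: "\<And>M x. M \<ge> N \<Longrightarrow> x \<in> X \<Longrightarrow> cmod (f (Suc M) x - f M x) \<le> g M"
  obtains l where "uniform_limit X f l sequentially"
proof -
  let ?f = "\<lambda>M x. if M < N then 0 else f (Suc M) x - f M x"
  have gN: "0 \<le> g M" if "M \<ge> N" "x \<in> X" for M x
    using d[OF that] norm_ge_zero order_trans by blast
  have "uniform_limit X (\<lambda>n x. \<Sum>M<n. ?f M x) (\<lambda>x. \<Sum>M. ?f M x) sequentially"
    using d gN by (intro Weierstrass_m_test_ev[OF _ g]) (auto simp: eventually_sequentially intro!: exI[of _ N])
  then have "uniform_limit X (\<lambda>n x. f N x + (\<Sum>M<n. ?f M x)) (\<lambda>x. f N x + (\<Sum>M. ?f M x)) sequentially"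
    by (intro uniform_limit_intros)
  moreover have "f N x + (\<Sum>M<n. ?f M x) = f n x" if "n \<ge> N" for n x
    using that
  proof (induction n rule: dec_induct)
    case (step n)
    then show ?case by (simp add: add.assoc[symmetric])
  qed (simp add: sum.neutral)
  ultimately have "uniform_limit X f (\<lambda>x. f N x + (\<Sum>M. ?f M x)) sequentially"
    by (rule_tac uniform_limit_cong[THEN iffD1, rotated 2])
      (auto simp: eventually_sequentially intro!: exI[of _ N])
  then show ?thesis by (rule that)
qed

text \<open>
  The product is the solution of the corresponding equation.
\<close>

lemma backward_Gronwall:
  fixes y g :: "nat \<Rightarrow> real"
  assumes y: "\<And>n. N \<le> n \<Longrightarrow> n \<le> M \<Longrightarrow> y n \<le> c + (\<Sum>k\<in>{n<..M}. g k * y k)"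
    and g: "\<And>k. 0 \<le> g k"
  shows "N \<le> n \<Longrightarrow> n \<le> M \<Longrightarrow> y n \<le> c * (\<Prod>k\<in>{n<..M}. 1 + g k)"
proof (induction "M - n" arbitrary: n rule: less_induct)
  case less
  have tele: "1 + (\<Sum>k\<in>{n<..M}. g k * (\<Prod>j\<in>{k<..M}. 1 + g j)) = (\<Prod>k\<in>{n<..M}. 1 + g k)" if "n \<le> M" for n
    using that
  proof (induction rule: inc_induct)
    case (step n)
    have i: "{n<..M} = insert (Suc n) {Suc n<..M}" using step by auto
    show ?case unfolding i using step by (simp add: algebra_simps)
  qed simp
  have "y n \<le> c + (\<Sum>k\<in>{n<..M}. g k * y k)" using y less.prems by blast
  also have "(\<Sum>k\<in>{n<..M}. g k * y k) \<le> (\<Sum>k\<in>{n<..M}. g k * (c * (\<Prod>j\<in>{k<..M}. 1 + g j)))"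
    using less g by (intro sum_mono mult_left_mono) auto
  also have "c + \<dots> = c * (1 + (\<Sum>k\<in>{n<..M}. g k * (\<Prod>j\<in>{k<..M}. 1 + g j)))"
    by (simp add: algebra_simps sum_distrib_left)
  also have "\<dots> = c * (\<Prod>k\<in>{n<..M}. 1 + g k)" using tele less.prems by simp
  finally show ?case by simp
qed

lemma prod_one_plus_le_exp_suminf:
  fixes g :: "nat \<Rightarrow> real"
  assumes "summable g" "\<And>k. 0 \<le> g k" "finite S"
  shows "(\<Prod>k\<in>S. 1 + g k) \<le> exp (\<Sum>k. g k)"
proof -
  have "(\<Prod>k\<in>S. 1 + g k) \<le> (\<Prod>k\<in>S. exp (g k))"
    using assms by (intro prod_mono) (auto simp: add_nonneg_nonneg)
  also have "\<dots> = exp (\<Sum>k\<in>S. g k)" using assms by (simp add: exp_sum)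
  also have "\<dots> \<le> exp (\<Sum>k. g k)" using assms by (simp add: sum_le_suminf)
  finally show ?thesis .
qed

lemma sum_tail_le:
  fixes g :: "nat \<Rightarrow> real"
  assumes "summable g" "\<And>k. 0 \<le> g k"
  shows "(\<Sum>k\<in>{n<..M}. g k) \<le> (\<Sum>k. g (k + Suc n))"
proof -
  have "(\<Sum>k\<in>{n<..M}. g k) = (\<Sum>k\<in>{..<M - n}. g (k + Suc n))"
    by (rule sum.reindex_bij_witness[of _ "\<lambda>k. k + Suc n" "\<lambda>k. k - Suc n"]) auto
  also have "\<dots> \<le> (\<Sum>k. g (k + Suc n))"
    using assms by (intro sum_le_suminf summable_ignore_initial_segment) auto
  finally show ?thesis .
qed

text \<open>
  The equation \<open>v n = 1 - \<Sum>k>n. K n k * v k\<close> cut off at \<open>k \<le> M\<close>.  Every value is a finite sum of products of kernel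
  values, so it inherits analyticity and continuity from the kernel.
\<close>

function volterra :: "(nat \<Rightarrow> nat \<Rightarrow> 'x \<Rightarrow> complex) \<Rightarrow> nat \<Rightarrow> nat \<Rightarrow> 'x \<Rightarrow> complex" where
  "volterra K M n x = 1 - (\<Sum>k\<in>{n<..M}. K n k x * volterra K M k x)"
  by auto
termination by (relation "Wellfounded.measure (\<lambda>(K, M, n, x). M - n)") auto

declare volterra.simps [simp del]

context
  fixes K :: "nat \<Rightarrow> nat \<Rightarrow> 'x \<Rightarrow> complex" and g :: "nat \<Rightarrow> real" and N :: nat and X :: "'x set"
  assumes g: "summable g" "\<And>k. 0 \<le> g k"
    and K: "\<And>n k x. N \<le> n \<Longrightarrow> n < k \<Longrightarrow> x \<in> X \<Longrightarrow> cmod (K n k x) \<le> g k"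
begin

lemma volterra_bound:
  assumes "N \<le> n" "x \<in> X"
  shows "cmod (volterra K M n x) \<le> exp (\<Sum>k. g k)"
proof (cases "n \<le> M")
  case True
  have "cmod (volterra K M n x) \<le> 1 * (\<Prod>k\<in>{n<..M}. 1 + g k)"
  proof (rule backward_Gronwall[where N = N])
    fix n assume n: "N \<le> n" "n \<le> M"
    have "cmod (volterra K M n x) \<le> 1 + cmod (\<Sum>k\<in>{n<..M}. K n k x * volterra K M k x)"
      by (subst volterra.simps) (rule order_trans[OF norm_triangle_ineq4], simp)
    also have "cmod (\<Sum>k\<in>{n<..M}. K n k x * volterra K M k x) \<le> (\<Sum>k\<in>{n<..M}. g k * cmod (volterra K M k x))"
      using n assms K by (intro sum_norm_le) (auto simp: norm_mult intro!: mult_right_mono)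
    finally show "cmod (volterra K M n x) \<le> 1 + (\<Sum>k\<in>{n<..M}. g k * cmod (volterra K M k x))" by simp
  qed (use g assms True in auto)
  also have "\<dots> \<le> exp (\<Sum>k. g k)" using prod_one_plus_le_exp_suminf[OF g] by simp
  finally show ?thesis .
next
  case False
  then have "volterra K M n x = 1" by (subst volterra.simps) simp
  moreover have "0 \<le> (\<Sum>k. g k)" using g by (rule suminf_nonneg)
  ultimately show ?thesis by simp
qed

text \<open>
  The difference of the two truncations solves the equation with \<open>- K n (Suc M) x\<close> in place of \<open>1\<close>.
\<close>

lemma volterra_step:
  assumes "N \<le> n" "n \<le> M" "x \<in> X"
  shows "cmod (volterra K (Suc M) n x - volterra K M n x) \<le> g (Suc M) * exp (\<Sum>k. g k)"
proof -
  let ?d = "\<lambda>k. volterra K (Suc M) k x - volterra K M k x"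
  have "cmod (?d n) \<le> g (Suc M) * (\<Prod>k\<in>{n<..M}. 1 + g k)"
  proof (rule backward_Gronwall[where N = N])
    fix n assume n: "N \<le> n" "n \<le> M"
    have i: "{n<..Suc M} = insert (Suc M) {n<..M}" using n by auto
    have one: "volterra K (Suc M) (Suc M) x = 1" by (subst volterra.simps) simp
    have "?d n = - (K n (Suc M) x) - (\<Sum>k\<in>{n<..M}. K n k x * ?d k)"
      by (subst volterra.simps, subst (2) volterra.simps)
        (simp add: i one sum_subtractf algebra_simps)
    then have "cmod (?d n) \<le> cmod (K n (Suc M) x) + cmod (\<Sum>k\<in>{n<..M}. K n k x * ?d k)"
      using norm_triangle_ineq4[of "- K n (Suc M) x" "\<Sum>k\<in>{n<..M}. K n k x * ?d k"] by simp
    also have "\<dots> \<le> g (Suc M) + (\<Sum>k\<in>{n<..M}. g k * cmod (?d k))"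
      using n assms K by (intro add_mono sum_norm_le) (auto simp: norm_mult intro!: mult_right_mono)
    finally show "cmod (?d n) \<le> g (Suc M) + (\<Sum>k\<in>{n<..M}. g k * cmod (?d k))" .
  qed (use g assms in auto)
  also have "\<dots> \<le> g (Suc M) * exp (\<Sum>k. g k)"
    using prod_one_plus_le_exp_suminf[OF g] g(2) by (intro mult_left_mono) auto
  finally show ?thesis .
qed

lemma volterra_minus_1:
  assumes "N \<le> n" "x \<in> X"
  shows "cmod (volterra K M n x - 1) \<le> exp (\<Sum>k. g k) * (\<Sum>k. g (k + Suc n))"
proof -
  have "volterra K M n x - 1 = - (\<Sum>k\<in>{n<..M}. K n k x * volterra K M k x)"
    by (subst volterra.simps) simp
  then have "cmod (volterra K M n x - 1) = cmod (\<Sum>k\<in>{n<..M}. K n k x * volterra K M k x)"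
    by (simp only: norm_minus_cancel)
  also have "\<dots> \<le> (\<Sum>k\<in>{n<..M}. g k * exp (\<Sum>k. g k))"
    using assms K volterra_bound by (intro sum_norm_le) (auto simp: norm_mult g intro!: mult_mono)
  also have "\<dots> = exp (\<Sum>k. g k) * (\<Sum>k\<in>{n<..M}. g k)"
    by (simp add: sum_distrib_left mult.commute)
  also have "(\<Sum>k\<in>{n<..M}. g k) \<le> (\<Sum>k. g (k + Suc n))"
    by (rule sum_tail_le) (use g in auto)
  finally show ?thesis by simp
qed

end

section \<open>Exact solutions near infinity\<close>

context perturbed_wkb begin

lemma a_lower: "\<forall>\<^sub>F n in sequentially. real n powr \<alpha> / 2 \<le> a n"
proof -
  have "(\<lambda>n. \<bar>p n / real n powr (\<alpha> / 2)\<bar>) \<longlonglongrightarrow> 0" using p_l1 by (rule summable_LIMSEQ_zero)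
  then have "\<forall>\<^sub>F n in sequentially. \<bar>p n / real n powr (\<alpha> / 2)\<bar> < 1/2"
    by (rule order_tendstoD) simp
  then show ?thesis
    using eventually_ge_at_top[of 1]
  proof eventually_elim
    case (elim n)
    have "\<bar>p n\<bar> < 1/2 * real n powr (\<alpha> / 2)"
      using elim by (simp add: abs_divide divide_less_eq)
    also have "\<dots> \<le> 1/2 * real n powr \<alpha>"
      using elim \<alpha> by (intro mult_left_mono powr_mono) auto
    finally show ?case using a_def[OF elim(2)] by (simp add: abs_less_iff)
  qed
qed

end

text \<open>
  Beyond \<open>N\<close> all estimates hold with explicit constants.  The bound on the tail of \<open>g\<close> keeps the products of the
  factors \<open>1 + product_drift\<close> away from zero.
\<close>

locale wkb_tail = perturbed_wkb +
  fixes N :: nat and g :: "nat \<Rightarrow> real"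
  assumes g: "summable g" "\<And>k. 0 \<le> g k" and N2: "N \<ge> 2"
    and g_tail: "(\<Sum>k. g (k + Suc N)) \<le> 1/2"
    and a_ge: "\<And>n. n \<ge> N \<Longrightarrow> real n powr \<alpha> / 2 \<le> a n"
    and wkb_radicand_N: "\<And>n w. n \<ge> N \<Longrightarrow> w \<in> W \<Longrightarrow> cmod (wkb_radicand \<alpha> n w - 1) \<le> 1/2"
    and eta_N: "\<And>n w. n \<ge> N \<Longrightarrow> w \<in> W \<Longrightarrow> cmod (eta \<alpha> n w - 1) \<le> 1/2"
    and D_N: "\<And>n w. n \<ge> N \<Longrightarrow> w \<in> W \<Longrightarrow> cmod (wkbD \<alpha> n w - 1) \<le> 1/2"
    and residual_N: "\<And>n w. n \<ge> N \<Longrightarrow> w \<in> W \<Longrightarrow> cmod (residual n w) * real n powr (-\<alpha>/2) \<le> g n"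
    and product_drift_N: "\<And>n w. n \<ge> N \<Longrightarrow> w \<in> W \<Longrightarrow> cmod (product_drift n w) \<le> g n"
    and eta_le: "\<And>n w. n \<ge> N \<Longrightarrow> w \<in> W \<Longrightarrow> 0 \<le> Re w \<Longrightarrow> cmod (eta \<alpha> n w) \<le> cmod (eta \<alpha> n (- w))"

lemma (in perturbed_wkb) exists_threshold: "\<exists>N g. wkb_tail \<alpha> wmin wmax p q a b N g"
proof -
  obtain g1 N1 where g1: "summable g1" "\<And>n. 0 \<le> g1 n"
    "\<And>n w. n \<ge> N1 \<Longrightarrow> w \<in> W \<Longrightarrow> cmod (residual n w) * real n powr (-\<alpha>/2) \<le> g1 n"
    using residual_summable by blast
  obtain C N2 where C: "C \<ge> 0" "N2 \<ge> 1" "\<And>n w. n \<ge> N2 \<Longrightarrow> w \<in> W \<Longrightarrow> cmod (product_drift n w) \<le> C * real n powr (-1-\<alpha>)"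
    using upowE[OF upow_product_drift] by blast
  define g where "g n = g1 n + C * real n powr (-1-\<alpha>)" for n
  have "summable (\<lambda>n. C * real n powr (-1-\<alpha>))"
    using \<alpha> by (intro summable_mult) (simp add: summable_real_powr_iff)
  then have g: "summable g" "\<And>k. 0 \<le> g k"
    unfolding g_def using g1(1,2) C(1) by (auto intro: summable_add)
  have "(\<lambda>n. \<Sum>k. g (k + n)) \<longlonglongrightarrow> 0"
    using suminf_exist_split2[OF g(1)] .
  then have "\<forall>\<^sub>F n in sequentially. (\<Sum>k. g (k + n)) < 1/2" by (rule order_tendstoD) simp
  then have "\<forall>\<^sub>F n in sequentially. (\<Sum>k. g (k + Suc n)) < 1/2"
    by (subst eventually_sequentially_Suc)
  then have "\<forall>\<^sub>F n in sequentially. (\<Sum>k. g (k + Suc n)) < 1/2 \<and> real n powr \<alpha> / 2 \<le> a n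
      \<and> (\<forall>w\<in>W. cmod (wkb_radicand \<alpha> n w - 1) \<le> 1/2) \<and> (\<forall>w\<in>W. cmod (eta \<alpha> n w - 1) \<le> 1/2)
      \<and> (\<forall>w\<in>W. cmod (wkbD \<alpha> n w - 1) \<le> 1/2)
      \<and> (\<forall>w\<in>W. 0 \<le> Re w \<longrightarrow> cmod (eta \<alpha> n w) \<le> cmod (eta \<alpha> n (- w)))"
    using a_lower wkb_radicand_close eta_close[of "1/2"] wkbD_close[of "1/2"] eta_le_eta_minus
    by (simp add: eventually_conj_iff)
  then obtain N3 where N3: "\<And>n. n \<ge> N3 \<Longrightarrow> (\<Sum>k. g (k + Suc n)) < 1/2 \<and> real n powr \<alpha> / 2 \<le> a n
      \<and> (\<forall>w\<in>W. cmod (wkb_radicand \<alpha> n w - 1) \<le> 1/2) \<and> (\<forall>w\<in>W. cmod (eta \<alpha> n w - 1) \<le> 1/2)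
      \<and> (\<forall>w\<in>W. cmod (wkbD \<alpha> n w - 1) \<le> 1/2)
      \<and> (\<forall>w\<in>W. 0 \<le> Re w \<longrightarrow> cmod (eta \<alpha> n w) \<le> cmod (eta \<alpha> n (- w)))"
    unfolding eventually_sequentially by blast
  define N where "N = max (max N1 N2) (max N3 2)"
  have NN: "n \<ge> N1" "n \<ge> N2" "n \<ge> N3" "n \<ge> 2" if "n \<ge> N" for n
    using that by (simp_all add: N_def)
  have "wkb_tail \<alpha> wmin wmax p q a b N g"
  proof (unfold_locales)
    show "2 \<le> N" by (simp add: N_def)
    show "(\<Sum>k. g (k + Suc N)) \<le> 1/2" using N3[OF NN(3), of N] by simp
    show "summable g" "\<And>k. 0 \<le> g k" by (fact g)+
    fix n assume n: "n \<ge> N"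
    note N3' = N3[OF NN(3)[OF n]]
    show "real n powr \<alpha> / 2 \<le> a n" using N3' by simp
    fix w assume w: "w \<in> W"
    show "cmod (wkb_radicand \<alpha> n w - 1) \<le> 1/2" "cmod (eta \<alpha> n w - 1) \<le> 1/2" "cmod (wkbD \<alpha> n w - 1) \<le> 1/2"
      using N3' w by blast+
    show "cmod (residual n w) * real n powr (-\<alpha>/2) \<le> g n"
      using g1(3)[OF NN(1)[OF n] w] C(1) unfolding g_def by (simp add: add_increasing2)
    show "cmod (product_drift n w) \<le> g n"
      using C(3)[OF NN(2)[OF n] w] g1(2)[of n] unfolding g_def by (simp add: add_increasing)
    show "cmod (eta \<alpha> n w) \<le> cmod (eta \<alpha> n (- w))" if "0 \<le> Re w"
      using N3' w that by blast
  qed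
  then show ?thesis by blast
qed

context wkb_tail begin

lemma eta_bounds: "n \<ge> N \<Longrightarrow> w \<in> W \<Longrightarrow> 1/2 \<le> cmod (eta \<alpha> n w) \<and> cmod (eta \<alpha> n w) \<le> 2"
  using norm_triangle_ineq4[of "eta \<alpha> n w" "eta \<alpha> n w - 1"] norm_triangle_ineq[of "eta \<alpha> n w - 1" 1]
    eta_N[of n w] by simp

lemma eta_nz: "n \<ge> N \<Longrightarrow> w \<in> W \<Longrightarrow> eta \<alpha> n w \<noteq> 0"
  using eta_bounds[of n w] by auto

definition Q :: "nat \<Rightarrow> complex \<Rightarrow> complex" where
  "Q n w = (\<Prod>l = N..n. eta \<alpha> l w)"

lemma Q_Suc: "n \<ge> N \<Longrightarrow> Q (Suc n) w = Q n w * eta \<alpha> (Suc n) w"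
  by (simp add: Q_def)

lemma Q_nz: "w \<in> W \<Longrightarrow> Q n w \<noteq> 0"
  by (simp add: Q_def eta_nz)

definition F :: "nat \<Rightarrow> complex \<Rightarrow> complex" where
  "F n w = of_real (real n powr (\<alpha>/2)) * (Q n w * Q n (- w))"

lemma F_Suc:
  assumes "n \<ge> N" "w \<in> W"
  shows "F (Suc n) w = F n w * (1 + product_drift (Suc n) w)"
proof -
  have n: "n \<ge> 2" using assms N2 by simp
  have "real (Suc n) powr (\<alpha>/2) = real n powr (\<alpha>/2) * (1 - 1 / real (Suc n)) powr (-\<alpha>/2)"
  proof -
    have e: "1 - 1 / real (Suc n) = real n / real (Suc n)" by (simp add: field_simps)
    show ?thesis unfolding e using n by (simp add: powr_divide powr_minus divide_simps)
  qed
  then have s: "(of_real (real (Suc n) powr (\<alpha>/2)) :: complex)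
      = of_real (real n powr (\<alpha>/2)) * of_real ((1 - 1 / real (Suc n)) powr (-\<alpha>/2))"
    by (simp only: of_real_mult)
  have "F (Suc n) w = of_real (real (Suc n) powr (\<alpha>/2)) * (Q n w * Q n (- w)) * (eta \<alpha> (Suc n) w * eta \<alpha> (Suc n) (- w))"
    unfolding F_def Q_Suc[OF assms(1)] by (simp add: mult_ac)
  also have "eta \<alpha> (Suc n) w * eta \<alpha> (Suc n) (- w) = wkbD \<alpha> (Suc n) w"
    by (rule eta_mult_eta_minus) (use W_nz assms in auto)
  finally show ?thesis unfolding F_def product_drift_def s by (simp add: mult_ac)
qed

text \<open>
  The constants \<open>c1\<close> and \<open>c2\<close> bound \<open>F\<close> from below and above, \<open>c3\<close> bounds the Wronskian of the approximate solutions
  from below, \<open>c4\<close> bounds the kernel and \<open>c5\<close> the increments of \<open>v\<close>.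
\<close>

definition c0 where "c0 = real N powr (\<alpha>/2)"
definition c1 where "c1 = c0 / 4"
definition G where "G = (\<Sum>k. g k)"
definition c2 where "c2 = 2 * c0 * exp G"

lemma c0: "c0 > 0" using N2 by (simp add: c0_def)
lemma c1: "c1 > 0" using c0 by (simp add: c1_def)
lemma c2: "c2 > 0" using c0 by (simp add: c2_def)
lemma G: "G \<ge> 0" unfolding G_def using g by (intro suminf_nonneg)

lemma F_N: "w \<in> W \<Longrightarrow> c0 / 2 \<le> cmod (F N w)" "w \<in> W \<Longrightarrow> cmod (F N w) \<le> 2 * c0"
proof -
  assume w: "w \<in> W"
  have "F N w = of_real c0 * wkbD \<alpha> N w"
    unfolding F_def Q_def c0_def using eta_mult_eta_minus[OF W_nz[OF w], of N \<alpha>] N2 by simp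
  then have f: "cmod (F N w) = c0 * cmod (wkbD \<alpha> N w)" using c0 by (simp add: norm_mult)
  have d: "1/2 \<le> cmod (wkbD \<alpha> N w)" "cmod (wkbD \<alpha> N w) \<le> 2"
    using norm_triangle_ineq4[of "wkbD \<alpha> N w" "wkbD \<alpha> N w - 1"] norm_triangle_ineq[of "wkbD \<alpha> N w - 1" 1]
      D_N[of N w] w by simp_all
  show "c0 / 2 \<le> cmod (F N w)" using mult_left_mono[OF d(1), of c0] c0 f by simp
  show "cmod (F N w) \<le> 2 * c0" using mult_left_mono[OF d(2), of c0] c0 f by simp
qed

lemma F_bounds:
  assumes "n \<ge> N" "w \<in> W"
  shows "c1 \<le> cmod (F n w)" "cmod (F n w) \<le> c2"
proof -
  have gz: "cmod (product_drift (Suc n) w) \<le> g (Suc n)" if "n \<ge> N" for n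
    using product_drift_N[of "Suc n" w] that assms by simp
  have up: "cmod (F n w) \<le> cmod (F N w) * (\<Prod>k\<in>{N<..n}. 1 + g k)"
    using assms(1)
  proof (induction rule: dec_induct)
    case (step n)
    have i: "{N<..Suc n} = insert (Suc n) {N<..n}" using step by auto
    have "cmod (F (Suc n) w) = cmod (F n w) * cmod (1 + product_drift (Suc n) w)"
      using F_Suc[OF _ assms(2), of n] step by (simp add: norm_mult)
    also have "\<dots> \<le> (cmod (F N w) * (\<Prod>k\<in>{N<..n}. 1 + g k)) * (1 + g (Suc n))"
      using step gz[of n] g(2)
      by (intro mult_mono norm_triangle_le) (auto intro!: mult_nonneg_nonneg prod_nonneg add_nonneg_nonneg)
    finally show ?case unfolding i by (simp add: mult_ac)
  qed simp
  also have "\<dots> \<le> 2 * c0 * exp G"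
    unfolding G_def using F_N(2)[OF assms(2)] prod_one_plus_le_exp_suminf[OF g, of "{N<..n}"] c0
    by (intro mult_mono) (auto intro!: prod_nonneg add_nonneg_nonneg g)
  finally show "cmod (F n w) \<le> c2" by (simp add: c2_def)
  have s: "(\<Sum>k\<in>{N<..n}. g k) \<le> 1/2" for n
    using sum_tail_le[OF g, of N n] g_tail by linarith
  have "cmod (F N w) * (1 - (\<Sum>k\<in>{N<..n}. g k)) \<le> cmod (F n w)"
    using assms(1)
  proof (induction rule: dec_induct)
    case (step n)
    have i: "{N<..Suc n} = insert (Suc n) {N<..n}" using step by auto
    have "1 \<le> cmod (1 + product_drift (Suc n) w) + cmod (product_drift (Suc n) w)"
      using norm_triangle_ineq4[of "1 + product_drift (Suc n) w" "product_drift (Suc n) w"] by simp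
    then have ge: "1 - g (Suc n) \<le> cmod (1 + product_drift (Suc n) w)" using gz[of n] step by simp
    have gs: "g (Suc n) \<le> 1/2"
    proof -
      have "g (Suc n) + (\<Sum>k\<in>{N<..n}. g k) \<le> 1/2" using s[of "Suc n"] unfolding i by simp
      moreover have "0 \<le> (\<Sum>k\<in>{N<..n}. g k)" using g(2) by (intro sum_nonneg)
      ultimately show ?thesis by linarith
    qed
    have "(1 - (\<Sum>k\<in>{N<..Suc n}. g k)) \<le> (1 - (\<Sum>k\<in>{N<..n}. g k)) * (1 - g (Suc n))"
      unfolding i using g(2)[of "Suc n"] sum_nonneg[of "{N<..n}" g] g(2) by (simp add: algebra_simps)
    then have "cmod (F N w) * (1 - (\<Sum>k\<in>{N<..Suc n}. g k))
        \<le> cmod (F N w) * ((1 - (\<Sum>k\<in>{N<..n}. g k)) * (1 - g (Suc n)))"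
      by (rule mult_left_mono) simp
    also have "\<dots> \<le> cmod (F n w) * cmod (1 + product_drift (Suc n) w)"
      unfolding mult.assoc[symmetric] using step ge gs by (intro mult_mono) auto
    also have "\<dots> = cmod (F (Suc n) w)"
      using F_Suc[OF _ assms(2), of n] step by (simp add: norm_mult)
    finally show ?case .
  qed simp
  moreover have "cmod (F N w) * (1/2) \<le> cmod (F N w) * (1 - (\<Sum>k\<in>{N<..n}. g k))"
    using s[of n] by (intro mult_left_mono) auto
  ultimately show "c1 \<le> cmod (F n w)" using F_N(1)[OF assms(2)] by (simp add: c1_def)
qed

lemma F_step: "n \<ge> N \<Longrightarrow> w \<in> W \<Longrightarrow> cmod (F (Suc n) w - F n w) \<le> c2 * g (Suc n)"
proof -
  assume n: "n \<ge> N" and w: "w \<in> W"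
  have "F (Suc n) w - F n w = F n w * product_drift (Suc n) w"
    unfolding F_Suc[OF n w] by (simp add: algebra_simps)
  then show ?thesis
    using F_bounds(2)[OF n w] product_drift_N[of "Suc n" w] n w c2 by (simp add: norm_mult mult_mono)
qed

lemma mirror_product_eq: "n \<ge> N \<Longrightarrow> w \<in> W \<Longrightarrow> cmod (Q n w) * cmod (Q n (- w)) = cmod (F n w) * real n powr (-\<alpha>/2)"
proof -
  assume n: "n \<ge> N" and w: "w \<in> W"
  have "real n powr (\<alpha>/2) * real n powr (-\<alpha>/2) = 1" using n N2 by (simp add: powr_minus)
  then show ?thesis unfolding F_def by (simp add: norm_mult mult_ac)
qed

lemma mirror_product_bounds:
  assumes "n \<ge> N" "w \<in> W"
  shows "c1 * real n powr (-\<alpha>/2) \<le> cmod (Q n w) * cmod (Q n (- w))"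
    and "cmod (Q n w) * cmod (Q n (- w)) \<le> c2 * real n powr (-\<alpha>/2)"
  unfolding mirror_product_eq[OF assms] using F_bounds[OF assms] by (auto intro: mult_right_mono)

lemma Q_residual:
  assumes "n > N" "w \<in> W"
  shows "of_real (a (n - 1)) * Q (n - 1) w + (of_real (b n) - w\<^sup>2) * Q n w + of_real (a n) * Q (Suc n) w
    = residual n w * Q n w"
proof -
  have "Q n w = Q (n - 1) w * eta \<alpha> n w" using Q_Suc[of "n - 1" w] assms by simp
  moreover have "eta \<alpha> n w \<noteq> 0" using eta_nz assms by simp
  ultimately have "Q (n - 1) w = Q n w / eta \<alpha> n w" by simp
  then show ?thesis unfolding residual_def using Q_Suc[of n w] assms by (simp add: field_simps)
qed

text \<open>
  The Wronskian of the two approximate solutions.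
\<close>

definition Wr :: "nat \<Rightarrow> complex \<Rightarrow> complex" where
  "Wr n w = of_real (a n) * (Q n w * Q (Suc n) (- w) - Q (Suc n) w * Q n (- w))"

definition c3 where "c3 = c1 * wmin / 4"
lemma c3: "c3 > 0" using c1 wmin by (simp add: c3_def)

lemma Wr_lower:
  assumes "n \<ge> N" "w \<in> W"
  shows "c3 \<le> cmod (Wr n w)"
proof -
  have n2: "n \<ge> 2" using assms N2 by simp
  have "Wr n w = of_real (a n) * (Q n w * Q n (- w)) * (2 * wkbB \<alpha> (Suc n) w)"
    unfolding Wr_def Q_Suc[OF assms(1)] eta_minus_w eta_def by (simp add: algebra_simps)
  then have "cmod (Wr n w) = a n * (cmod (Q n w) * cmod (Q n (- w)))
      * (2 * (cmod w * real (Suc n) powr (-\<alpha>/2) * cmod (csqrt (wkb_radicand \<alpha> (Suc n) w))))"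
    using a_pos[of n] n2 by (simp add: norm_mult wkbB_def)
  moreover have "c3 \<le> a n * (cmod (Q n w) * cmod (Q n (- w)))
      * (2 * (cmod w * real (Suc n) powr (-\<alpha>/2) * cmod (csqrt (wkb_radicand \<alpha> (Suc n) w))))"
  proof -
    have s: "1/2 \<le> cmod (csqrt (wkb_radicand \<alpha> (Suc n) w))"
      by (rule order_trans[OF csqrt_near_1(1)[OF wkb_radicand_N] complex_Re_le_cmod]) (use assms in auto)
    have h: "real n powr (-\<alpha>/2) / 2 \<le> real (Suc n) powr (-\<alpha>/2)"
    proof -
      have "(2 * real n) powr (-\<alpha>/2) \<le> real (Suc n) powr (-\<alpha>/2)"
        using n2 \<alpha> by (intro powr_mono2') auto
      moreover have "(2 * real n) powr (-\<alpha>/2) = 2 powr (-\<alpha>/2) * real n powr (-\<alpha>/2)" by (rule powr_mult)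
      moreover have "(1/2::real) \<le> 2 powr (-\<alpha>/2)"
      proof -
        have "2 powr (-1) \<le> 2 powr (-\<alpha>/2)" using \<alpha> by (intro powr_mono) auto
        then show ?thesis by (simp add: powr_minus)
      qed
      then have "(1/2) * real n powr (-\<alpha>/2) \<le> 2 powr (-\<alpha>/2) * real n powr (-\<alpha>/2)" by (intro mult_right_mono) auto
      ultimately show ?thesis by linarith
    qed
    have mw: "wmin \<le> cmod w" using assms by (simp add: W_def)
    have pw: "real n powr \<alpha> * real n powr (-\<alpha>/2) * real n powr (-\<alpha>/2) = 1"
      using n2 by (simp only: powr_add[symmetric]) simp
    have "c3 = (real n powr \<alpha> / 2) * (c1 * real n powr (-\<alpha>/2)) * (2 * (wmin * (real n powr (-\<alpha>/2) / 2) * (1/2)))"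
    proof -
      have "(real n powr \<alpha> / 2) * (c1 * real n powr (-\<alpha>/2)) * (2 * (wmin * (real n powr (-\<alpha>/2) / 2) * (1/2)))
        = c1 * wmin / 4 * (real n powr \<alpha> * real n powr (-\<alpha>/2) * real n powr (-\<alpha>/2)) "
        by (simp add: field_simps)
      then show ?thesis unfolding pw c3_def using c1 wmin by simp
    qed
    also have "\<dots> \<le> a n * (cmod (Q n w) * cmod (Q n (- w)))
      * (2 * (cmod w * real (Suc n) powr (-\<alpha>/2) * cmod (csqrt (wkb_radicand \<alpha> (Suc n) w))))"
    proof (rule mult_mono)
      show "real n powr \<alpha> / 2 * (c1 * real n powr (-\<alpha>/2)) \<le> a n * (cmod (Q n w) * cmod (Q n (- w)))"
        by (rule mult_mono[OF a_ge[OF assms(1)] mirror_product_bounds(1)[OF assms]])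
          (use a_pos[of n] n2 c1 in auto)
      have "wmin * (real n powr (-\<alpha>/2) / 2) \<le> cmod w * real (Suc n) powr (-\<alpha>/2)"
        using mw h by (rule mult_mono) auto
      then have "wmin * (real n powr (-\<alpha>/2) / 2) * (1/2)
          \<le> cmod w * real (Suc n) powr (-\<alpha>/2) * cmod (csqrt (wkb_radicand \<alpha> (Suc n) w))"
        using s by (rule mult_mono) auto
      then show "2 * (wmin * (real n powr (-\<alpha>/2) / 2) * (1/2))
          \<le> 2 * (cmod w * real (Suc n) powr (-\<alpha>/2) * cmod (csqrt (wkb_radicand \<alpha> (Suc n) w)))"
        by (rule mult_left_mono) simp
      show "0 \<le> a n * (cmod (Q n w) * cmod (Q n (- w)))"
        using a_pos[of n] n2 by (intro mult_nonneg_nonneg) auto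
    qed (use wmin in simp)
    finally show ?thesis .
  qed
  ultimately show ?thesis by simp
qed

lemma Wr_nz: "n \<ge> N \<Longrightarrow> w \<in> W \<Longrightarrow> Wr n w \<noteq> 0"
  using Wr_lower[of n w] c3 by auto

text \<open>
  For two exact solutions the difference would vanish; here it is \<open>Q\<^sub>n(w) Q\<^sub>n(-w)\<close> times the difference of the two
  residuals.
\<close>

lemma Wr_step:
  assumes "n \<ge> N" "w \<in> W"
  shows "cmod (Wr (Suc n) w - Wr n w) \<le> 2 * c2 * g (Suc n)"
proof -
  let ?n = "Suc n"
  have w': "- w \<in> W" using W_minus assms by blast
  have 1: "of_real (a n) * Q n w + (of_real (b ?n) - w\<^sup>2) * Q ?n w + of_real (a ?n) * Q (Suc ?n) w = residual ?n w * Q ?n w"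
    using Q_residual[of ?n w] assms by simp
  have 2: "of_real (a n) * Q n (-w) + (of_real (b ?n) - w\<^sup>2) * Q ?n (-w) + of_real (a ?n) * Q (Suc ?n) (-w) = residual ?n (-w) * Q ?n (-w)"
    using Q_residual[of ?n "-w"] assms w' by simp
  have "Wr ?n w - Wr n w = Q ?n w * (of_real (a n) * Q n (-w) + (of_real (b ?n) - w\<^sup>2) * Q ?n (-w) + of_real (a ?n) * Q (Suc ?n) (-w))
     - Q ?n (-w) * (of_real (a n) * Q n w + (of_real (b ?n) - w\<^sup>2) * Q ?n w + of_real (a ?n) * Q (Suc ?n) w)"
    unfolding Wr_def by (simp add: algebra_simps)
  also have "\<dots> = (Q ?n w * Q ?n (-w)) * (residual ?n (-w) - residual ?n w)"
    unfolding 1 2 by (simp add: algebra_simps)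
  finally have "cmod (Wr ?n w - Wr n w) = (cmod (Q ?n w) * cmod (Q ?n (-w))) * cmod (residual ?n (-w) - residual ?n w)"
    by (simp add: norm_mult)
  also have "\<dots> \<le> (c2 * real ?n powr (-\<alpha>/2)) * (cmod (residual ?n (-w)) + cmod (residual ?n w))"
    by (rule mult_mono[OF mirror_product_bounds(2) norm_triangle_ineq4]) (use assms c2 in auto)
  also have "\<dots> = c2 * (cmod (residual ?n (-w)) * real ?n powr (-\<alpha>/2) + cmod (residual ?n w) * real ?n powr (-\<alpha>/2))"
    by (simp add: algebra_simps)
  also have "\<dots> \<le> c2 * (g ?n + g ?n)"
    using residual_N[of ?n w] residual_N[of ?n "-w"] assms w' c2 by (intro mult_left_mono add_mono) auto
  finally show ?thesis by simp
qed

definition T :: "nat \<Rightarrow> complex \<Rightarrow> complex" where "T n w = Q n (- w) / Q n w"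

lemma T_mono:
  assumes "N \<le> n" "n \<le> k" "w \<in> W" "0 \<le> Re w"
  shows "cmod (T n w) \<le> cmod (T k w)"
  using assms(2)
proof (induction rule: dec_induct)
  case (step k)
  have k: "k \<ge> N" using step assms by simp
  have "1 \<le> cmod (eta \<alpha> (Suc k) (-w)) / cmod (eta \<alpha> (Suc k) w)"
    using eta_le[of "Suc k" w] eta_nz[of "Suc k" w] k assms by (simp add: le_divide_eq)
  then have "cmod (T k w) * 1 \<le> cmod (T k w) * (cmod (eta \<alpha> (Suc k) (-w)) / cmod (eta \<alpha> (Suc k) w))"
    by (rule mult_left_mono) simp
  then show ?case using step unfolding T_def Q_Suc[OF k] by (simp add: norm_mult norm_divide)
qed simp

text \<open>
  Reduction of order: the quotient of two solutions has the Wronskian over \<open>a\<^sub>n Q\<^sub>n Q\<^sub>n\<^sub>+\<^sub>1\<close> as its increments.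
\<close>

lemma T_diff:
  assumes "n \<ge> N" "w \<in> W"
  shows "T (Suc n) w - T n w = Wr n w * (1 / (of_real (a n) * Q n w * Q (Suc n) w))"
proof -
  have "a n \<noteq> 0" using a_pos[of n] assms N2 by simp
  then show ?thesis using Q_nz[OF assms(2), of n] Q_nz[OF assms(2), of "Suc n"]
    unfolding T_def Wr_def by (simp add: field_simps)
qed

end

context wkb_tail begin

definition W0 where "W0 = {w \<in> W. 0 \<le> Re w}"
lemma W0: "w \<in> W0 \<Longrightarrow> w \<in> W" "w \<in> W0 \<Longrightarrow> 0 \<le> Re w" by (auto simp: W0_def)

text \<open>
  The kernel of variation of constants around \<open>Q\<close>.
\<close>

definition green_kernel :: "nat \<Rightarrow> nat \<Rightarrow> complex \<Rightarrow> complex" where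
  "green_kernel n k w = (\<Sum>j\<in>{n..<k}. (Q k w)\<^sup>2 * (1 / (of_real (a j) * Q j w * Q (Suc j) w)))"

definition c4 where "c4 = c2 * (2 / c3 + 2 * c2 * G / c3\<^sup>2)"

lemma c4: "c4 > 0" unfolding c4_def using c2 c3 G
  by (intro mult_pos_pos add_pos_nonneg divide_pos_pos divide_nonneg_nonneg mult_nonneg_nonneg) auto

lemma Abel_identity:
  fixes z t :: "nat \<Rightarrow> complex"
  assumes "n \<le> k"
  shows "(\<Sum>j\<in>{n..<k}. z j * (t (Suc j) - t j))
    = z k * t k - z n * t n - (\<Sum>j\<in>{n..<k}. t (Suc j) * (z (Suc j) - z j))"
  using assms
proof (induction rule: dec_induct)
  case (step k)
  then show ?case by (simp add: algebra_simps)
qed simp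

text \<open>
  On the cut the \<open>j\<close>-th term has the order \<open>k powr (-\<alpha>/2) * j powr (-\<alpha>/2)\<close>, so the triangle inequality loses a
  power of \<open>k\<close>.  But the terms are increments of \<open>T\<close> divided by the Wronskian.  Summation by parts leaves \<open>\<bar>T\<^sub>k\<bar>\<close>, the
  largest of the \<open>\<bar>T\<^sub>j\<bar>\<close>, times the variation of \<open>1 / Wr\<close>, and \<open>\<bar>Q\<^sub>k\<bar>\<^sup>2 \<bar>T\<^sub>k\<bar> = \<bar>Q\<^sub>k(w) Q\<^sub>k(-w)\<bar>\<close>.
\<close>

lemma green_kernel_bound:
  assumes "N \<le> n" "n \<le> k" "w \<in> W0"
  shows "cmod (green_kernel n k w) \<le> c4 * real k powr (-\<alpha>/2)"
proof -
  note w = W0[OF assms(3)]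
  define z where "z j = 1 / Wr j w" for j
  have zb: "cmod (z j) \<le> 1 / c3" if "j \<ge> N" for j
    unfolding z_def norm_divide using Wr_lower[OF that w(1)] c3 by (intro frac_le) auto
  have zd: "cmod (z (Suc j) - z j) \<le> 2 * c2 * g (Suc j) / c3\<^sup>2" if "j \<ge> N" for j
  proof -
    have j: "Suc j \<ge> N" using that by simp
    have "z (Suc j) - z j = (Wr j w - Wr (Suc j) w) / (Wr j w * Wr (Suc j) w)"
      unfolding z_def using Wr_nz[OF that w(1)] Wr_nz[OF j w(1)] by (simp add: field_simps)
    then have "cmod (z (Suc j) - z j) = cmod (Wr (Suc j) w - Wr j w) / (cmod (Wr j w) * cmod (Wr (Suc j) w))"
      by (simp add: norm_divide norm_mult norm_minus_commute)
    also have "\<dots> \<le> 2 * c2 * g (Suc j) / (c3 * c3)"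
      using Wr_step[OF that w(1)] Wr_lower[OF that w(1)] Wr_lower[OF j w(1)] c3 c2 g(2)
      by (intro frac_le mult_mono mult_pos_pos) auto
    finally show ?thesis by (simp add: power2_eq_square)
  qed
  have Tk: "cmod (T j w) \<le> cmod (T k w)" if "j \<in> {n..k}" for j
    using T_mono[of j k w] that assms w by auto
  have "(\<Sum>j\<in>{n..<k}. 1 / (of_real (a j) * Q j w * Q (Suc j) w)) = (\<Sum>j\<in>{n..<k}. z j * (T (Suc j) w - T j w))"
  proof (rule sum.cong)
    fix j assume "j \<in> {n..<k}"
    then have j: "j \<ge> N" using assms by simp
    show "1 / (of_real (a j) * Q j w * Q (Suc j) w) = z j * (T (Suc j) w - T j w)"
      unfolding T_diff[OF j w(1)] z_def using Wr_nz[OF j w(1)] by simp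
  qed simp
  also have "\<dots> = z k * T k w - z n * T n w - (\<Sum>j\<in>{n..<k}. T (Suc j) w * (z (Suc j) - z j))"
    by (rule Abel_identity[OF assms(2)])
  finally have eq: "(\<Sum>j\<in>{n..<k}. 1 / (of_real (a j) * Q j w * Q (Suc j) w))
      = z k * T k w - z n * T n w - (\<Sum>j\<in>{n..<k}. T (Suc j) w * (z (Suc j) - z j))" .
  have "cmod (z k * T k w - z n * T n w - (\<Sum>j\<in>{n..<k}. T (Suc j) w * (z (Suc j) - z j)))
      \<le> cmod (z k * T k w) + cmod (z n * T n w) + cmod (\<Sum>j\<in>{n..<k}. T (Suc j) w * (z (Suc j) - z j))"
    by (meson norm_triangle_ineq4 norm_triangle_le_diff order_trans add_mono order_refl)
  also have "\<dots> \<le> (1 / c3) * cmod (T k w) + (1 / c3) * cmod (T k w) + (\<Sum>j\<in>{n..<k}. cmod (T k w) * (2 * c2 * g (Suc j) / c3\<^sup>2))"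
  proof (intro add_mono sum_norm_le)
    show "cmod (z k * T k w) \<le> (1 / c3) * cmod (T k w)"
      unfolding norm_mult using zb[of k] assms by (intro mult_right_mono) auto
    show "cmod (z n * T n w) \<le> (1 / c3) * cmod (T k w)"
      unfolding norm_mult using zb[of n] Tk[of n] assms c3 by (intro mult_mono) auto
    fix j assume j: "j \<in> {n..<k}"
    show "cmod (T (Suc j) w * (z (Suc j) - z j)) \<le> cmod (T k w) * (2 * c2 * g (Suc j) / c3\<^sup>2)"
      unfolding norm_mult using zd[of j] Tk[of "Suc j"] assms j by (intro mult_mono) auto
  qed
  also have "(\<Sum>j\<in>{n..<k}. cmod (T k w) * (2 * c2 * g (Suc j) / c3\<^sup>2))
      = cmod (T k w) * (2 * c2 / c3\<^sup>2) * (\<Sum>j\<in>{n..<k}. g (Suc j))"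
    by (simp add: sum_distrib_left sum_divide_distrib mult_ac)
  also have "(\<Sum>j\<in>{n..<k}. g (Suc j)) \<le> G"
  proof -
    have "(\<Sum>j\<in>{n..<k}. g (Suc j)) = sum g {Suc n..<Suc k}" by (simp only: sum.shift_bounds_Suc_ivl)
    also have "\<dots> \<le> G" unfolding G_def using g by (intro sum_le_suminf) auto
    finally show ?thesis .
  qed
  then have "cmod (T k w) * (2 * c2 / c3\<^sup>2) * (\<Sum>j\<in>{n..<k}. g (Suc j)) \<le> cmod (T k w) * (2 * c2 / c3\<^sup>2) * G"
    using c2 by (intro mult_left_mono) auto
  finally have S: "cmod (\<Sum>j\<in>{n..<k}. 1 / (of_real (a j) * Q j w * Q (Suc j) w))
      \<le> cmod (T k w) * (2 / c3 + 2 * c2 * G / c3\<^sup>2)"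
    unfolding eq by (simp add: algebra_simps)
  have k: "k \<ge> N" using assms by simp
  have "cmod (green_kernel n k w) = (cmod (Q k w))\<^sup>2 * cmod (\<Sum>j\<in>{n..<k}. 1 / (of_real (a j) * Q j w * Q (Suc j) w))"
    unfolding green_kernel_def sum_distrib_left[symmetric] by (simp add: norm_mult norm_power)
  also have "\<dots> \<le> (cmod (Q k w))\<^sup>2 * (cmod (T k w) * (2 / c3 + 2 * c2 * G / c3\<^sup>2))"
    using S by (intro mult_left_mono) auto
  also have "\<dots> = (cmod (Q k w) * cmod (Q k (- w))) * (2 / c3 + 2 * c2 * G / c3\<^sup>2)"
    unfolding T_def using Q_nz[OF w(1), of k] by (simp add: norm_divide power2_eq_square)
  also have "\<dots> \<le> (c2 * real k powr (-\<alpha>/2)) * (2 / c3 + 2 * c2 * G / c3\<^sup>2)"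
    using mirror_product_bounds(2)[OF k w(1)] c2 c3 G
    by (intro mult_right_mono) (auto intro!: add_nonneg_nonneg divide_nonneg_nonneg)
  finally show ?thesis by (simp add: c4_def mult_ac)
qed

definition volterra_kernel where "volterra_kernel n k w = green_kernel n k w * residual k w"

lemma volterra_kernel_bound:
  assumes "N \<le> n" "n < k" "w \<in> W0"
  shows "cmod (volterra_kernel n k w) \<le> c4 * g k"
proof -
  have "cmod (volterra_kernel n k w) \<le> (c4 * real k powr (-\<alpha>/2)) * cmod (residual k w)"
    unfolding volterra_kernel_def norm_mult using green_kernel_bound[of n k w] assms by (intro mult_right_mono) auto
  also have "\<dots> = c4 * (cmod (residual k w) * real k powr (-\<alpha>/2))" by simp
  also have "\<dots> \<le> c4 * g k"
    using residual_N[of k w] W0[OF assms(3)] assms c4 by (intro mult_left_mono) auto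
  finally show ?thesis .
qed

lemma kernel_majorant_summable: "summable (\<lambda>k. c4 * g k)" "0 \<le> c4 * g k"
  using g c4 by (auto intro: summable_mult)

definition v_trunc where "v_trunc M n w = volterra volterra_kernel M n w"
definition exp_G where "exp_G = exp (\<Sum>k. c4 * g k)"
definition tail where "tail n = (\<Sum>k. g (k + Suc n))"

lemma exp_G: "exp_G > 0" by (simp add: exp_G_def)

lemma tail_tendsto: "tail \<longlonglongrightarrow> 0"
proof -
  have "(\<lambda>n. \<Sum>k. g (k + n)) \<longlonglongrightarrow> 0" using suminf_exist_split2[OF g(1)] .
  then show ?thesis unfolding tail_def[abs_def] by (rule LIMSEQ_Suc)
qed

lemma v_trunc_bound: "N \<le> n \<Longrightarrow> w \<in> W0 \<Longrightarrow> cmod (v_trunc M n w) \<le> exp_G"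
  unfolding v_trunc_def exp_G_def by (rule volterra_bound[where X = W0 and N = N]) (use volterra_kernel_bound kernel_majorant_summable in auto)

lemma v_trunc_minus_1: "N \<le> n \<Longrightarrow> w \<in> W0 \<Longrightarrow> cmod (v_trunc M n w - 1) \<le> exp_G * c4 * tail n"
proof -
  assume *: "N \<le> n" "w \<in> W0"
  have "cmod (v_trunc M n w - 1) \<le> exp_G * (\<Sum>k. c4 * g (k + Suc n))"
    unfolding v_trunc_def exp_G_def by (rule volterra_minus_1[where X = W0 and N = N]) (use volterra_kernel_bound kernel_majorant_summable * in auto)
  also have "(\<Sum>k. c4 * g (k + Suc n)) = c4 * tail n"
    unfolding tail_def using g(1) by (intro suminf_mult summable_ignore_initial_segment)
  finally show ?thesis by (simp add: mult.assoc)
qed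

lemma v_trunc_converges: "N \<le> n \<Longrightarrow> \<exists>l. uniform_limit W0 (\<lambda>M. v_trunc M n) l sequentially"
proof -
  assume n: "N \<le> n"
  have "summable (\<lambda>M. c4 * g (Suc M) * exp_G)"
    using kernel_majorant_summable(1) by (intro summable_mult2) (subst summable_Suc_iff)
  then obtain l where "uniform_limit W0 (\<lambda>M. v_trunc M n) l sequentially"
  proof (rule uniform_limit_telescope[where N = n])
    fix M w assume "M \<ge> n" "w \<in> W0"
    then show "cmod (v_trunc (Suc M) n w - v_trunc M n w) \<le> c4 * g (Suc M) * exp_G"
      unfolding v_trunc_def exp_G_def using n
      by (intro volterra_step[where X = W0 and N = N]) (use volterra_kernel_bound kernel_majorant_summable in auto)
  qed
  then show ?thesis by blast
qed

definition V :: "nat \<Rightarrow> complex \<Rightarrow> complex" where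
  "V n = (SOME l. uniform_limit W0 (\<lambda>M. v_trunc M n) l sequentially)"

lemma V_uniform: "N \<le> n \<Longrightarrow> uniform_limit W0 (\<lambda>M. v_trunc M n) (V n) sequentially"
  unfolding V_def using v_trunc_converges by (rule someI_ex)

lemma V_lim: "N \<le> n \<Longrightarrow> w \<in> W0 \<Longrightarrow> (\<lambda>M. v_trunc M n w) \<longlonglongrightarrow> V n w"
  using V_uniform tendsto_uniform_limitI by fast

lemma V_minus_1: "N \<le> n \<Longrightarrow> w \<in> W0 \<Longrightarrow> cmod (V n w - 1) \<le> exp_G * c4 * tail n"
  using v_trunc_minus_1 by (intro LIMSEQ_le_const2[OF tendsto_norm[OF tendsto_diff[OF V_lim tendsto_const]]]) auto

text \<open>
  In \<open>green_kernel n k - green_kernel (Suc n) k\<close> only the term \<open>j = n\<close> survives.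
\<close>

lemma v_trunc_diff:
  assumes "N \<le> n" "n < M" "w \<in> W0"
  shows "of_real (a n) * Q n w * Q (Suc n) w * (v_trunc M (Suc n) w - v_trunc M n w)
    = (\<Sum>k\<in>{n<..M}. (Q k w)\<^sup>2 * residual k w * v_trunc M k w)"
proof -
  note w = W0[OF assms(3)]
  let ?x = "of_real (a n) * Q n w * Q (Suc n) w"
  have x: "?x \<noteq> 0" using a_pos[of n] assms N2 Q_nz[OF w(1)] by auto
  have i: "{n<..M} = insert (Suc n) {Suc n<..M}" using assms by auto
  have K: "green_kernel n k w = green_kernel (Suc n) k w + (Q k w)\<^sup>2 * (1 / ?x)" if "k > n" for k
    unfolding green_kernel_def using that by (simp add: sum.atLeast_Suc_lessThan algebra_simps)
  have 0: "green_kernel (Suc n) (Suc n) w = 0" by (simp add: green_kernel_def)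
  have "v_trunc M (Suc n) w - v_trunc M n w = (\<Sum>k\<in>{n<..M}. volterra_kernel n k w * v_trunc M k w) - (\<Sum>k\<in>{Suc n<..M}. volterra_kernel (Suc n) k w * v_trunc M k w)"
    unfolding v_trunc_def by (subst volterra.simps, subst (2) volterra.simps) simp
  also have "(\<Sum>k\<in>{Suc n<..M}. volterra_kernel (Suc n) k w * v_trunc M k w) = (\<Sum>k\<in>{n<..M}. volterra_kernel (Suc n) k w * v_trunc M k w)"
    unfolding i by (simp add: volterra_kernel_def 0)
  also have "(\<Sum>k\<in>{n<..M}. volterra_kernel n k w * v_trunc M k w) - (\<Sum>k\<in>{n<..M}. volterra_kernel (Suc n) k w * v_trunc M k w)
      = (\<Sum>k\<in>{n<..M}. (1 / ?x) * ((Q k w)\<^sup>2 * residual k w * v_trunc M k w))"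
    unfolding sum_subtractf[symmetric] volterra_kernel_def by (rule sum.cong) (simp_all add: K algebra_simps)
  also have "\<dots> = (1 / ?x) * (\<Sum>k\<in>{n<..M}. (Q k w)\<^sup>2 * residual k w * v_trunc M k w)"
    by (rule sum_distrib_left[symmetric])
  finally show ?thesis using x by simp
qed

lemma Q_ratio:
  assumes "N \<le> n" "n \<le> k" "w \<in> W0"
  shows "(cmod (Q k w))\<^sup>2 \<le> (cmod (Q n w))\<^sup>2 * (c2 / c1 * real k powr (-\<alpha>/2) * real n powr (\<alpha>/2))"
proof -
  note w = W0[OF assms(3)]
  have pos: "cmod (Q n w) > 0" "cmod (Q k w) > 0" "cmod (Q n (-w)) > 0" "cmod (Q k (-w)) > 0"
    using Q_nz w(1) W_minus by auto
  have "cmod (Q n (-w)) / cmod (Q n w) \<le> cmod (Q k (-w)) / cmod (Q k w)"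
    using T_mono[OF assms(1,2) w] by (simp add: T_def norm_divide)
  then have "cmod (Q n (-w)) * cmod (Q k w) \<le> cmod (Q k (-w)) * cmod (Q n w)"
    using pos by (simp add: divide_simps mult.commute)
  then have "(cmod (Q n (-w)) * cmod (Q k w)) * (cmod (Q n w) * cmod (Q k w))
      \<le> (cmod (Q k (-w)) * cmod (Q n w)) * (cmod (Q n w) * cmod (Q k w))"
    using pos by (intro mult_right_mono) auto
  then have 1: "(cmod (Q k w))\<^sup>2 * (cmod (Q n w) * cmod (Q n (-w)))
      \<le> (cmod (Q n w))\<^sup>2 * (cmod (Q k w) * cmod (Q k (-w)))"
    by (simp add: power2_eq_square mult_ac)
  have "(cmod (Q k w))\<^sup>2 * (c1 * real n powr (-\<alpha>/2)) \<le> (cmod (Q k w))\<^sup>2 * (cmod (Q n w) * cmod (Q n (-w)))"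
    using mirror_product_bounds(1)[OF assms(1) w(1)] by (intro mult_left_mono) auto
  also note 1
  also have "(cmod (Q n w))\<^sup>2 * (cmod (Q k w) * cmod (Q k (-w))) \<le> (cmod (Q n w))\<^sup>2 * (c2 * real k powr (-\<alpha>/2))"
    using mirror_product_bounds(2)[of k w] assms w by (intro mult_left_mono) auto
  finally have 2: "(cmod (Q k w))\<^sup>2 * (c1 * real n powr (-\<alpha>/2)) \<le> (cmod (Q n w))\<^sup>2 * (c2 * real k powr (-\<alpha>/2))" .
  have np: "real n powr (-\<alpha>/2) * real n powr (\<alpha>/2) = 1" using assms N2 by (simp add: powr_minus)
  have "(cmod (Q k w))\<^sup>2 = (cmod (Q k w))\<^sup>2 * (c1 * real n powr (-\<alpha>/2)) * (real n powr (\<alpha>/2) / c1)"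
    using c1 np by (simp add: field_simps)
  also have "\<dots> \<le> (cmod (Q n w))\<^sup>2 * (c2 * real k powr (-\<alpha>/2)) * (real n powr (\<alpha>/2) / c1)"
    using 2 c1 by (intro mult_right_mono) auto
  finally show ?thesis by (simp add: mult_ac)
qed

definition c5 where "c5 = 4 * (c2 / c1) * exp_G"

text \<open>
  The factor \<open>n powr (-\<alpha>/2)\<close> matters for the Wronskian at infinity, where \<open>a\<^sub>n \<bar>Q\<^sub>n\<bar>\<^sup>2\<close> grows like \<open>n powr (\<alpha>/2)\<close>.
\<close>

lemma v_trunc_diff_bound:
  assumes "N \<le> n" "n < M" "w \<in> W0"
  shows "cmod (v_trunc M (Suc n) w - v_trunc M n w) \<le> c5 * real n powr (-\<alpha>/2) * tail n"
proof -
  note w = W0[OF assms(3)]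
  let ?q = "cmod (Q n w)" and ?d = "cmod (v_trunc M (Suc n) w - v_trunc M n w)"
  have q: "?q > 0" using Q_nz[OF w(1)] by auto
  have apos: "a n > 0" using a_pos[of n] assms N2 by simp
  have n0: "real n > 0" using assms N2 by simp
  have "a n * ?q\<^sup>2 * cmod (eta \<alpha> (Suc n) w) * ?d
      = cmod (of_real (a n) * Q n w * Q (Suc n) w * (v_trunc M (Suc n) w - v_trunc M n w))"
    using apos unfolding Q_Suc[OF assms(1)] by (simp add: norm_mult power2_eq_square)
  also have "\<dots> \<le> (\<Sum>k\<in>{n<..M}. (?q\<^sup>2 * (c2 / c1) * real n powr (\<alpha>/2) * exp_G) * g k)"
    unfolding v_trunc_diff[OF assms]
  proof (rule sum_norm_le)
    fix k assume k: "k \<in> {n<..M}"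
    have "cmod ((Q k w)\<^sup>2 * residual k w * v_trunc M k w) = (cmod (Q k w))\<^sup>2 * cmod (residual k w) * cmod (v_trunc M k w)"
      by (simp add: norm_mult norm_power)
    also have "\<dots> \<le> (?q\<^sup>2 * (c2 / c1 * real k powr (-\<alpha>/2) * real n powr (\<alpha>/2))) * cmod (residual k w) * exp_G"
      using Q_ratio[of n k w] v_trunc_bound[of k w M] assms k c1 c2 by (intro mult_mono) auto
    also have "\<dots> = (?q\<^sup>2 * (c2 / c1) * real n powr (\<alpha>/2) * exp_G) * (cmod (residual k w) * real k powr (-\<alpha>/2))"
      by simp
    also have "\<dots> \<le> (?q\<^sup>2 * (c2 / c1) * real n powr (\<alpha>/2) * exp_G) * g k"
      using residual_N[of k w] k assms w c1 c2 exp_G by (intro mult_left_mono) auto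
    finally show "cmod ((Q k w)\<^sup>2 * residual k w * v_trunc M k w) \<le> (?q\<^sup>2 * (c2 / c1) * real n powr (\<alpha>/2) * exp_G) * g k" .
  qed
  also have "\<dots> = (?q\<^sup>2 * (c2 / c1) * real n powr (\<alpha>/2) * exp_G) * (\<Sum>k\<in>{n<..M}. g k)"
    by (rule sum_distrib_left[symmetric])
  also have "\<dots> \<le> (?q\<^sup>2 * (c2 / c1) * real n powr (\<alpha>/2) * exp_G) * tail n"
    unfolding tail_def using sum_tail_le[OF g] c1 c2 exp_G by (intro mult_left_mono) auto
  finally have "?q\<^sup>2 * (a n * cmod (eta \<alpha> (Suc n) w) * ?d) \<le> ?q\<^sup>2 * ((c2 / c1) * real n powr (\<alpha>/2) * exp_G * tail n)"
    by (simp only: mult_ac)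
  from iffD1[OF mult_le_cancel_left_pos[OF zero_less_power[OF q]] this]
  have 1: "a n * cmod (eta \<alpha> (Suc n) w) * ?d \<le> (c2 / c1) * real n powr (\<alpha>/2) * exp_G * tail n" .
  have "(real n powr \<alpha> / 2) * (1/2) * ?d \<le> a n * cmod (eta \<alpha> (Suc n) w) * ?d"
    using a_ge[OF assms(1)] eta_bounds[of "Suc n" w] assms w apos by (intro mult_mono) auto
  with 1 have 2: "real n powr \<alpha> * ?d \<le> 4 * ((c2 / c1) * real n powr (\<alpha>/2) * exp_G * tail n)" by simp
  have "?d = real n powr (-\<alpha>) * (real n powr \<alpha> * ?d)" using n0 by (simp add: powr_minus)
  also have "\<dots> \<le> real n powr (-\<alpha>) * (4 * ((c2 / c1) * real n powr (\<alpha>/2) * exp_G * tail n))"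
    using 2 by (intro mult_left_mono) auto
  also have "\<dots> = c5 * (real n powr (-\<alpha>) * real n powr (\<alpha>/2)) * tail n" by (simp add: c5_def)
  also have "real n powr (-\<alpha>) * real n powr (\<alpha>/2) = real n powr (-\<alpha>/2)"
    by (simp only: powr_add[symmetric]) simp
  finally show ?thesis .
qed

lemma V_diff_bound:
  assumes "N \<le> n" "w \<in> W0"
  shows "cmod (V (Suc n) w - V n w) \<le> c5 * real n powr (-\<alpha>/2) * tail n"
proof (rule LIMSEQ_le_const2[OF tendsto_norm[OF tendsto_diff[OF V_lim V_lim]]])
  show "\<exists>M0. \<forall>M\<ge>M0. cmod (v_trunc M (Suc n) w - v_trunc M n w) \<le> c5 * real n powr (-\<alpha>/2) * tail n"
    using v_trunc_diff_bound[OF assms(1) _ assms(2)] by (intro exI[of _ "Suc n"]) auto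
qed (use assms in auto)

text \<open>
  By \<open>v_trunc_diff\<close> the increment of \<open>a\<^sub>n Q\<^sub>n Q\<^sub>n\<^sub>+\<^sub>1 (v\<^sub>n\<^sub>+\<^sub>1 - v\<^sub>n)\<close> in \<open>n\<close> is
  \<open>- Q\<^sub>n\<^sup>2 r\<^sub>n v\<^sub>n\<close>, which cancels the residual of \<open>Q\<close>.
\<close>

lemma v_trunc_recurrence:
  assumes "N < n" "n < M" "w \<in> W0"
  shows "of_real (a (n - 1)) * (Q (n - 1) w * v_trunc M (n - 1) w) + of_real (b n) * (Q n w * v_trunc M n w)
    + of_real (a n) * (Q (Suc n) w * v_trunc M (Suc n) w) = w\<^sup>2 * (Q n w * v_trunc M n w)"
proof -
  note w = W0[OF assms(3)]
  have Sn: "Suc (n - 1) = n" using assms by simp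
  have i: "{n - 1<..M} = insert n {n<..M}" using assms by auto
  have 1: "of_real (a n) * Q n w * Q (Suc n) w * (v_trunc M (Suc n) w - v_trunc M n w)
      - of_real (a (n - 1)) * Q (n - 1) w * Q n w * (v_trunc M n w - v_trunc M (n - 1) w)
    = - ((Q n w)\<^sup>2 * residual n w * v_trunc M n w)"
    using v_trunc_diff[of n M w] v_trunc_diff[of "n - 1" M w] assms unfolding Sn i by simp
  have "Q n w * (of_real (a (n - 1)) * (Q (n - 1) w * v_trunc M (n - 1) w) + (of_real (b n) - w\<^sup>2) * (Q n w * v_trunc M n w)
      + of_real (a n) * (Q (Suc n) w * v_trunc M (Suc n) w))
    = (of_real (a n) * Q n w * Q (Suc n) w * (v_trunc M (Suc n) w - v_trunc M n w)
      - of_real (a (n - 1)) * Q (n - 1) w * Q n w * (v_trunc M n w - v_trunc M (n - 1) w))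
      + Q n w * v_trunc M n w * (of_real (a (n - 1)) * Q (n - 1) w + (of_real (b n) - w\<^sup>2) * Q n w + of_real (a n) * Q (Suc n) w)"
    by (simp add: algebra_simps)
  also have "\<dots> = 0"
    unfolding 1 Q_residual[OF assms(1) w(1)] by (simp add: power2_eq_square)
  finally have "of_real (a (n - 1)) * (Q (n - 1) w * v_trunc M (n - 1) w) + (of_real (b n) - w\<^sup>2) * (Q n w * v_trunc M n w)
      + of_real (a n) * (Q (Suc n) w * v_trunc M (Suc n) w) = 0"
    using Q_nz[OF w(1), of n] by simp
  then show ?thesis by (simp add: algebra_simps)
qed

lemma V_recurrence:
  assumes "N < n" "w \<in> W0"
  shows "of_real (a (n - 1)) * (Q (n - 1) w * V (n - 1) w) + of_real (b n) * (Q n w * V n w)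
    + of_real (a n) * (Q (Suc n) w * V (Suc n) w) = w\<^sup>2 * (Q n w * V n w)"
proof (rule LIMSEQ_unique)
  let ?f = "\<lambda>M. of_real (a (n - 1)) * (Q (n - 1) w * v_trunc M (n - 1) w) + of_real (b n) * (Q n w * v_trunc M n w)
    + of_real (a n) * (Q (Suc n) w * v_trunc M (Suc n) w)"
  show "?f \<longlonglongrightarrow> of_real (a (n - 1)) * (Q (n - 1) w * V (n - 1) w) + of_real (b n) * (Q n w * V n w)
    + of_real (a n) * (Q (Suc n) w * V (Suc n) w)"
    using assms by (intro tendsto_intros V_lim) auto
  have "(\<lambda>M. w\<^sup>2 * (Q n w * v_trunc M n w)) \<longlonglongrightarrow> w\<^sup>2 * (Q n w * V n w)"
    using assms by (intro tendsto_intros V_lim) auto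
  then show "?f \<longlonglongrightarrow> w\<^sup>2 * (Q n w * V n w)"
  proof (rule Lim_transform_eventually)
    show "\<forall>\<^sub>F M in sequentially. w\<^sup>2 * (Q n w * v_trunc M n w) = ?f M"
      using eventually_gt_at_top[of n] by eventually_elim (use v_trunc_recurrence[OF assms(1) _ assms(2)] in auto)
  qed
qed

end

section \<open>Behaviour on the cut and decay away from it\<close>

lemma csqrt_cnj_near_1:
  assumes "cmod (x - 1) \<le> 1/2"
  shows "csqrt (cnj x) = cnj (csqrt x)"
proof -
  have "\<bar>Re (x - 1)\<bar> \<le> 1/2" by (rule order_trans[OF abs_Re_le_cmod assms])
  then have r: "Re x > 0" unfolding minus_complex.sel one_complex.sel by linarith
  then have "x \<notin> \<real>\<^sub>\<le>\<^sub>0" by (auto simp: complex_nonpos_Reals_iff)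
  then show ?thesis by (rule cnj_csqrt[symmetric])
qed

lemma norm_triangle3_diff: "cmod (x + y - z) \<le> cmod x + cmod y + cmod z"
  using norm_triangle_ineq4[of "x + y" z] norm_triangle_ineq[of x y] by linarith

context wkb_tail begin

lemma eta_cnj:
  assumes "n \<ge> N" "w \<in> W"
  shows "eta \<alpha> n (cnj w) = cnj (eta \<alpha> n w)"
proof -
  have r: "wkb_radicand \<alpha> n (cnj w) = cnj (wkb_radicand \<alpha> n w)" by (simp add: wkb_radicand_def)
  show ?thesis
    unfolding eta_def wkbA_def wkbB_def r csqrt_cnj_near_1[OF wkb_radicand_N[OF assms]] by simp
qed

text \<open>
  The values of \<open>\<surd>\<lambda>\<close> on both sides of the negative half-line.
\<close>

definition cut where "cut = {w \<in> W. Re w = 0}"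

lemma cut: "w \<in> cut \<Longrightarrow> w \<in> W" "w \<in> cut \<Longrightarrow> w \<in> W0" "w \<in> cut \<Longrightarrow> cnj w = - w"
  "w \<in> cut \<Longrightarrow> w = \<i> * of_real (Im w)"
  by (auto simp: cut_def W0_def complex_eq_iff)

lemma Q_cut: "w \<in> cut \<Longrightarrow> Q n (- w) = cnj (Q n w)"
proof -
  assume w: "w \<in> cut"
  have "eta \<alpha> l (- w) = cnj (eta \<alpha> l w)" if "l \<in> {N..n}" for l
    using eta_cnj[of l w] cut(1,3)[OF w] that by simp
  then have "(\<Prod>l = N..n. eta \<alpha> l (- w)) = (\<Prod>l = N..n. cnj (eta \<alpha> l w))" by (rule prod.cong[OF refl])
  then show ?thesis unfolding Q_def cnj_prod .
qed

lemma F_cut: "w \<in> cut \<Longrightarrow> F n w = of_real (real n powr (\<alpha>/2) * (cmod (Q n w))\<^sup>2)"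
  unfolding F_def by (simp add: Q_cut complex_norm_square[symmetric])

lemma norm_F_cut: "w \<in> cut \<Longrightarrow> cmod (F n w) = real n powr (\<alpha>/2) * (cmod (Q n w))\<^sup>2"
  unfolding F_cut norm_of_real by simp

lemma F_converges: "\<exists>l. uniform_limit W F l sequentially"
proof -
  have "summable (\<lambda>n. c2 * g (Suc n))"
    using g(1) by (intro summable_mult) (subst summable_Suc_iff)
  from uniform_limit_telescope[OF this, of N W F] F_step
  obtain l where "uniform_limit W F l sequentially" by blast
  then show ?thesis by blast
qed

definition F_limit where "F_limit = (SOME l. uniform_limit W F l sequentially)"

lemma F_limit: "uniform_limit W F F_limit sequentially"
  unfolding F_limit_def using F_converges by (rule someI_ex)

lemma F_limit_pointwise: "w \<in> W \<Longrightarrow> (\<lambda>n. F n w) \<longlonglongrightarrow> F_limit w"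
  using F_limit tendsto_uniform_limitI by fast

lemma F_limit_lower: "w \<in> W \<Longrightarrow> c1 \<le> cmod (F_limit w)"
  using F_bounds(1) by (intro LIMSEQ_le_const[OF tendsto_norm[OF F_limit_pointwise]]) auto

lemma a_ratio: "(\<lambda>n. a n * real n powr (-\<alpha>)) \<longlonglongrightarrow> 1"
proof -
  have "(\<lambda>n. \<bar>p n / real n powr (\<alpha> / 2)\<bar>) \<longlonglongrightarrow> 0" using p_l1 by (rule summable_LIMSEQ_zero)
  then have 1: "(\<lambda>n. p n / real n powr (\<alpha> / 2)) \<longlonglongrightarrow> 0" by (rule tendsto_rabs_zero_cancel)
  have 2: "(\<lambda>n. real n powr (-\<alpha>/2)) \<longlonglongrightarrow> 0"
    using \<alpha> by (intro tendsto_neg_powr filterlim_real_sequentially) auto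
  have 3: "(\<lambda>n. 1 + (p n / real n powr (\<alpha> / 2)) * real n powr (-\<alpha>/2)) \<longlonglongrightarrow> 1 + 0 * 0"
    by (intro tendsto_intros 1 2)
  show ?thesis
  proof (rule Lim_transform_eventually)
    show "(\<lambda>n. 1 + (p n / real n powr (\<alpha> / 2)) * real n powr (-\<alpha>/2)) \<longlonglongrightarrow> 1" using 3 by simp
    show "\<forall>\<^sub>F n in sequentially. 1 + (p n / real n powr (\<alpha> / 2)) * real n powr (-\<alpha>/2) = a n * real n powr (-\<alpha>)"
      using eventually_ge_at_top[of 1]
    proof eventually_elim
      case (elim n)
      have x: "real n powr (-\<alpha>/2) = 1 / real n powr (\<alpha>/2)" by (simp add: powr_minus_divide)
      have y: "real n powr (-\<alpha>) = 1 / (real n powr (\<alpha>/2) * real n powr (\<alpha>/2))"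
        by (simp add: powr_minus_divide flip: powr_add)
      have z: "real n powr \<alpha> = real n powr (\<alpha>/2) * real n powr (\<alpha>/2)" by (simp flip: powr_add)
      show ?case unfolding a_def[OF elim] x y z using elim by (simp add: field_simps)
    qed
  qed
qed

lemma V_tendsto_1: "w \<in> W0 \<Longrightarrow> (\<lambda>n. V n w) \<longlonglongrightarrow> 1"
proof -
  assume w: "w \<in> W0"
  have "(\<lambda>n. exp_G * c4 * tail n) \<longlonglongrightarrow> 0" using tail_tendsto by (rule tendsto_mult_right_zero)
  moreover have "\<forall>\<^sub>F n in sequentially. norm (V n w - 1) \<le> exp_G * c4 * tail n"
    using eventually_ge_at_top[of N] by eventually_elim (use V_minus_1 w in auto)
  ultimately have "(\<lambda>n. V n w - 1) \<longlonglongrightarrow> 0" by (rule Lim_null_comparison[rotated])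
  then show ?thesis by (rule LIM_zero_cancel)
qed

lemma csqrt_radicand_tendsto: "w \<in> W \<Longrightarrow> (\<lambda>n. csqrt (wkb_radicand \<alpha> n w)) \<longlonglongrightarrow> 1"
proof -
  assume w: "w \<in> W"
  obtain C N' where C: "\<And>n w. n \<ge> N' \<Longrightarrow> w \<in> W \<Longrightarrow> cmod (wkb_radicand \<alpha> n w - 1) \<le> C * real n powr (-\<beta>)"
    using upowE[OF upow_radicand] by metis
  have "(\<lambda>n. C * real n powr (-\<beta>)) \<longlonglongrightarrow> 0"
    using \<beta> by (intro tendsto_mult_right_zero tendsto_neg_powr filterlim_real_sequentially) auto
  moreover have "\<forall>\<^sub>F n in sequentially. norm (csqrt (wkb_radicand \<alpha> n w) - 1) \<le> C * real n powr (-\<beta>)"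
    using eventually_ge_at_top[of "max N N'"]
  proof eventually_elim
    case (elim n)
    then show ?case using csqrt_minus_1_bound[OF wkb_radicand_N[of n w]] C[of n w] w by simp
  qed
  ultimately have "(\<lambda>n. csqrt (wkb_radicand \<alpha> n w) - 1) \<longlonglongrightarrow> 0" by (rule Lim_null_comparison[rotated])
  then show ?thesis by (rule LIM_zero_cancel)
qed

text \<open>
  Insert \<open>u\<^sub>n = Q\<^sub>n V\<^sub>n\<close> and \<open>V\<^sub>n\<^sub>+\<^sub>1 = V\<^sub>n + d\<^sub>n\<close>.  On the cut \<open>a\<^sub>n \<bar>Q\<^sub>n\<bar>\<^sup>2\<close> is \<open>n powr (\<alpha>/2) * \<bar>F n w\<bar>\<close> up to a factor that
  tends to one, the imaginary part of \<open>eta (Suc n) w\<close> is \<open>- Im w * n powr (-\<alpha>/2)\<close> to leading order, and the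
  contribution of \<open>d\<^sub>n = o(n powr (-\<alpha>/2))\<close> disappears in the limit.
\<close>

lemma wronskian_limit:
  assumes w: "w \<in> cut"
  shows "(\<lambda>n. a n * Im (cnj (Q n w * V n w) * (Q (Suc n) w * V (Suc n) w)))
    \<longlonglongrightarrow> - (Im w * cmod (F_limit w))"
proof -
  note wW = cut(1)[OF w] and w0 = cut(2)[OF w]
  define h where "h n = real n powr (\<alpha>/2)" for n
  define \<theta> where "\<theta> n = h n * real (Suc n) powr (-\<alpha>/2)" for n
  have \<theta>: "\<theta> \<longlonglongrightarrow> 1"
  proof -
    have "(\<lambda>n. 1 + 1 / real n) \<longlonglongrightarrow> 1" by real_asymp
    from tendsto_powr[OF this tendsto_const[of "-\<alpha>/2"]] have "(\<lambda>n. (1 + 1 / real n) powr (-\<alpha>/2)) \<longlonglongrightarrow> 1" by simp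
    then show ?thesis
    proof (rule Lim_transform_eventually)
      show "\<forall>\<^sub>F n in sequentially. (1 + 1 / real n) powr (-\<alpha>/2) = \<theta> n"
        using eventually_ge_at_top[of 1]
      proof eventually_elim
        case (elim n)
        have "real (Suc n) = real n * (1 + 1 / real n)" using elim by (simp add: field_simps)
        then have "real (Suc n) powr (-\<alpha>/2) = real n powr (-\<alpha>/2) * (1 + 1 / real n) powr (-\<alpha>/2)"
          by (simp only: powr_mult)
        moreover have "h n * real n powr (-\<alpha>/2) = 1" using elim by (simp add: h_def powr_minus)
        ultimately show ?case unfolding \<theta>_def by (simp add: mult.assoc[symmetric])
      qed
    qed
  qed
  have Im\<eta>: "Im (eta \<alpha> (Suc n) w) = - (Im w * real (Suc n) powr (-\<alpha>/2) * Re (csqrt (wkb_radicand \<alpha> (Suc n) w)))" for n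
  proof -
    have "Re w = 0" using w by (simp add: cut_def)
    then have "Im (wkbA \<alpha> (Suc n) w) = 0"
      unfolding wkbA_def by (simp add: power2_eq_square)
    moreover have "Im (wkbB \<alpha> (Suc n) w) = Im w * real (Suc n) powr (-\<alpha>/2) * Re (csqrt (wkb_radicand \<alpha> (Suc n) w))"
      unfolding wkbB_def using \<open>Re w = 0\<close> by (simp del: csqrt.sel)
    ultimately show ?thesis by (simp add: eta_def del: csqrt.sel)
  qed
  define d where "d n = V (Suc n) w - V n w" for n
  define e where "e n = of_real (h n) * d n" for n
  have e0: "e \<longlonglongrightarrow> 0"
  proof (rule Lim_null_comparison)
    show "(\<lambda>n. c5 * tail n) \<longlonglongrightarrow> 0" using tail_tendsto by (rule tendsto_mult_right_zero)
    show "\<forall>\<^sub>F n in sequentially. norm (e n) \<le> c5 * tail n"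
      using eventually_ge_at_top[of N]
    proof eventually_elim
      case (elim n)
      have "h n * real n powr (-\<alpha>/2) = 1" using elim N2 by (simp add: h_def powr_minus)
      have "norm (e n) = h n * cmod (d n)" by (simp add: e_def norm_mult h_def)
      also have "\<dots> \<le> h n * (c5 * real n powr (-\<alpha>/2) * tail n)"
        unfolding d_def using V_diff_bound[OF elim w0] by (intro mult_left_mono) (auto simp: h_def)
      also have "\<dots> = (h n * real n powr (-\<alpha>/2)) * (c5 * tail n)" by simp
      finally show ?case unfolding \<open>h n * real n powr (-\<alpha>/2) = 1\<close> by simp
    qed
  qed
  have \<eta>1: "(\<lambda>n. eta \<alpha> (Suc n) w) \<longlonglongrightarrow> 1"
  proof (rule LIMSEQ_Suc, rule LIM_zero_cancel)
    obtain C N' where C: "\<And>n w. n \<ge> N' \<Longrightarrow> w \<in> W \<Longrightarrow> cmod (eta \<alpha> n w - 1) \<le> C * real n powr (-\<alpha>/2)"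
      using upowE[OF upow_eta_1] by metis
    show "(\<lambda>n. eta \<alpha> n w - 1) \<longlonglongrightarrow> 0"
    proof (rule Lim_null_comparison)
      show "(\<lambda>n. C * real n powr (-\<alpha>/2)) \<longlonglongrightarrow> 0"
        using \<alpha> by (intro tendsto_mult_right_zero tendsto_neg_powr filterlim_real_sequentially) auto
      show "\<forall>\<^sub>F n in sequentially. norm (eta \<alpha> n w - 1) \<le> C * real n powr (-\<alpha>/2)"
        using eventually_ge_at_top[of N'] by eventually_elim (use C wW in auto)
    qed
  qed
  let ?S = "\<lambda>n. Re (csqrt (wkb_radicand \<alpha> (Suc n) w))"
  have S1: "?S \<longlonglongrightarrow> 1"
    using tendsto_Re[OF LIMSEQ_Suc[OF csqrt_radicand_tendsto[OF wW]]] by (simp del: csqrt.sel)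
  let ?L = "\<lambda>n. (a n * real n powr (-\<alpha>)) * cmod (F n w)
      * ((cmod (V n w))\<^sup>2 * (- (Im w * \<theta> n * ?S n)) + Im (eta \<alpha> (Suc n) w * cnj (V n w) * e n))"
  have "?L \<longlonglongrightarrow> 1 * cmod (F_limit w) * ((cmod 1)\<^sup>2 * (- (Im w * 1 * 1)) + Im (1 * cnj 1 * 0))"
    by (intro tendsto_mult tendsto_add tendsto_minus tendsto_Im tendsto_norm tendsto_power tendsto_cnj
        a_ratio F_limit_pointwise wW V_tendsto_1 w0 \<theta> S1 \<eta>1 e0 tendsto_const)
  then have "?L \<longlonglongrightarrow> - (Im w * cmod (F_limit w))" by (simp add: mult.commute del: csqrt.sel)
  then show ?thesis
  proof (rule Lim_transform_eventually)
    show "\<forall>\<^sub>F n in sequentially. ?L n = a n * Im (cnj (Q n w * V n w) * (Q (Suc n) w * V (Suc n) w))"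
      using eventually_ge_at_top[of N]
    proof eventually_elim
      case (elim n)
      have n0: "real n > 0" using elim N2 by simp
      have hh: "real n powr (-\<alpha>) * h n * h n = 1"
        unfolding h_def using n0 by (simp add: mult.assoc powr_minus flip: powr_add)
      have "cnj (Q n w * V n w) * (Q (Suc n) w * V (Suc n) w)
          = (Q n w * cnj (Q n w)) * (eta \<alpha> (Suc n) w * cnj (V n w) * (V n w + d n))"
        unfolding Q_Suc[OF elim] d_def by (simp add: mult_ac)
      also have "\<dots> = of_real ((cmod (Q n w))\<^sup>2) * (of_real ((cmod (V n w))\<^sup>2) * eta \<alpha> (Suc n) w
            + eta \<alpha> (Suc n) w * cnj (V n w) * d n)"
        unfolding complex_norm_square by (simp add: algebra_simps)
      finally have 1: "Im (cnj (Q n w * V n w) * (Q (Suc n) w * V (Suc n) w))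
          = (cmod (Q n w))\<^sup>2 * ((cmod (V n w))\<^sup>2 * Im (eta \<alpha> (Suc n) w) + Im (eta \<alpha> (Suc n) w * cnj (V n w) * d n))"
        by (simp del: of_real_power)
      have 2: "Im (eta \<alpha> (Suc n) w * cnj (V n w) * e n) = h n * Im (eta \<alpha> (Suc n) w * cnj (V n w) * d n)"
        unfolding e_def by (simp add: algebra_simps)
      have 3: "- (Im w * \<theta> n * ?S n) = h n * Im (eta \<alpha> (Suc n) w)"
        unfolding Im\<eta> \<theta>_def by (simp add: mult_ac del: csqrt.sel)
      have "?L n = (a n * real n powr (-\<alpha>)) * (h n * (cmod (Q n w))\<^sup>2)
         * ((cmod (V n w))\<^sup>2 * (h n * Im (eta \<alpha> (Suc n) w)) + h n * Im (eta \<alpha> (Suc n) w * cnj (V n w) * d n))"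
        unfolding 2 3 norm_F_cut[OF w] h_def[symmetric] ..
      also have "\<dots> = (real n powr (-\<alpha>) * h n * h n) * (a n * ((cmod (Q n w))\<^sup>2 *
          ((cmod (V n w))\<^sup>2 * Im (eta \<alpha> (Suc n) w) + Im (eta \<alpha> (Suc n) w * cnj (V n w) * d n))))"
        by (simp add: algebra_simps)
      finally show ?case unfolding hh 1 by simp
    qed
  qed
qed

text \<open>
  For \<open>Re w > 0\<close> the modulus of \<open>eta n w\<close> is at most \<open>1 - n powr (-\<alpha>/2) * Re w / 2\<close> for large \<open>n\<close>, and \<open>n powr (-\<alpha>/2)\<close>
  exceeds every multiple of \<open>1/n\<close>.
\<close>

lemma eta_decay:
  assumes w: "w \<in> W" and Rw: "Re w > 0"
  shows "\<forall>\<^sub>F n in sequentially. cmod (eta \<alpha> n w) \<le> 1 - 3 / real n"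
proof -
  define h where "h n = real n powr (-\<alpha>/2)" for n
  obtain C1 N1 where C1: "C1 \<ge> 0" "\<And>n w. n \<ge> N1 \<Longrightarrow> w \<in> W \<Longrightarrow> cmod (wkbA \<alpha> n w - 1) \<le> C1 * real n powr (-\<alpha>)"
    using upowE[OF upow_wkbA] by metis
  have 1: "(\<lambda>n. csqrt (wkb_radicand \<alpha> n w)) \<longlonglongrightarrow> 1" by (rule csqrt_radicand_tendsto[OF w])
  have h0: "h \<longlonglongrightarrow> 0" unfolding h_def
    using \<alpha> by (intro tendsto_neg_powr filterlim_real_sequentially) auto
  let ?r = "\<lambda>n. C1 * h n + cmod w * cmod (csqrt (wkb_radicand \<alpha> n w) - 1) + h n * (cmod w)\<^sup>2 / 2"
  have "?r \<longlonglongrightarrow> C1 * 0 + cmod w * cmod (1 - 1) + 0 * (cmod w)\<^sup>2 / 2"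
    by (intro tendsto_intros h0 1) auto
  then have "?r \<longlonglongrightarrow> 0" by simp
  then have ev1: "\<forall>\<^sub>F n in sequentially. ?r n < Re w / 2" using Rw by (intro order_tendstoD) auto
  have "(\<lambda>n. real n powr (\<alpha>/2 - 1)) \<longlonglongrightarrow> 0"
    using \<alpha> by (intro tendsto_neg_powr filterlim_real_sequentially) auto
  then have ev2: "\<forall>\<^sub>F n in sequentially. real n powr (\<alpha>/2 - 1) < Re w / 6" using Rw by (intro order_tendstoD) auto
  have "(\<lambda>n. h n * (2 * Re w)) \<longlonglongrightarrow> 0" using h0 by (rule tendsto_mult_left_zero)
  then have ev3: "\<forall>\<^sub>F n in sequentially. h n * (2 * Re w) < 1" by (rule order_tendstoD) simp
  show ?thesis
    using ev1 ev2 ev3 eventually_ge_at_top[of "max N1 1"]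
  proof eventually_elim
    case (elim n)
    have n0: "real n > 0" using elim by simp
    have h: "h n > 0" using n0 by (simp add: h_def)
    have h2: "real n powr (-\<alpha>) = h n * h n" by (simp add: h_def flip: powr_add)
    have "(cmod (1 - w * of_real (h n)))\<^sup>2 = 1 - 2 * (h n * Re w) + (h n)\<^sup>2 * (cmod w)\<^sup>2"
      unfolding cmod_power2 by (simp add: power2_eq_square algebra_simps)
    also have "\<dots> \<le> (1 - h n * Re w + (h n)\<^sup>2 * (cmod w)\<^sup>2 / 2)\<^sup>2"
    proof -
      have e: "(1 - h n * Re w + (h n)\<^sup>2 * (cmod w)\<^sup>2 / 2)\<^sup>2 = 1 - 2 * (h n * Re w) + (h n)\<^sup>2 * (cmod w)\<^sup>2
          + (- (h n * Re w) + (h n)\<^sup>2 * (cmod w)\<^sup>2 / 2)\<^sup>2"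
        by (simp add: power2_eq_square algebra_simps)
      show ?thesis unfolding e using zero_le_power2[of "- (h n * Re w) + (h n)\<^sup>2 * (cmod w)\<^sup>2 / 2"] by linarith
    qed
    finally have "cmod (1 - w * of_real (h n)) \<le> 1 - h n * Re w + (h n)\<^sup>2 * (cmod w)\<^sup>2 / 2"
    proof (rule power2_le_imp_le)
      have "0 \<le> (h n)\<^sup>2 * (cmod w)\<^sup>2 / 2" by simp
      then show "0 \<le> 1 - h n * Re w + (h n)\<^sup>2 * (cmod w)\<^sup>2 / 2" using elim(3) h Rw by simp
    qed
    moreover have "eta \<alpha> n w = (1 - w * of_real (h n)) + (wkbA \<alpha> n w - 1) - w * of_real (h n) * (csqrt (wkb_radicand \<alpha> n w) - 1)"
      unfolding eta_def wkbB_def h_def by (simp add: algebra_simps)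
    then have "cmod (eta \<alpha> n w) \<le> cmod (1 - w * of_real (h n)) + cmod (wkbA \<alpha> n w - 1)
        + cmod (w * of_real (h n) * (csqrt (wkb_radicand \<alpha> n w) - 1))"
      by (simp only: norm_triangle3_diff)
    moreover have "cmod (wkbA \<alpha> n w - 1) \<le> C1 * (h n * h n)" using C1(2)[of n w] elim w h2 by simp
    moreover have "cmod (w * of_real (h n) * (csqrt (wkb_radicand \<alpha> n w) - 1)) = h n * (cmod w * cmod (csqrt (wkb_radicand \<alpha> n w) - 1))"
      using h by (simp add: norm_mult)
    ultimately have "cmod (eta \<alpha> n w) \<le> 1 - h n * Re w + h n * ?r n"
      by (simp add: algebra_simps power2_eq_square)
    also have "\<dots> \<le> 1 - h n * Re w + h n * (Re w / 2)"
      using elim(1) h by (intro add_left_mono mult_left_mono) auto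
    also have "\<dots> = 1 - h n * (Re w / 2)" by (simp add: algebra_simps)
    also have "\<dots> \<le> 1 - 3 / real n"
    proof -
      have "3 / real n = h n * (3 * real n powr (\<alpha>/2 - 1))"
      proof -
        have "h n * real n powr (\<alpha>/2 - 1) = real n powr (-1)"
          unfolding h_def by (simp only: powr_add[symmetric]) simp
        then show ?thesis using n0 by (simp add: powr_minus_divide)
      qed
      also have "\<dots> \<le> h n * (Re w / 2)" using elim(2) h by (intro mult_left_mono) auto
      finally show ?thesis by simp
    qed
    finally show ?case .
  qed
qed

text \<open>
  Because \<open>(1 - 3/n) * n\<^sup>3 \<le> (n - 1)\<^sup>3\<close>, the sequence \<open>n\<^sup>3 * \<bar>Q\<^sub>n\<bar>\<close> is eventually nonincreasing.
\<close>

lemma Q_decay: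
  assumes w: "w \<in> W" and Rw: "Re w > 0"
  shows "\<exists>C\<ge>0. \<forall>\<^sub>F n in sequentially. cmod (Q n w) \<le> C / real n ^ 3"
proof -
  obtain L where L: "\<And>n. n \<ge> L \<Longrightarrow> cmod (eta \<alpha> n w) \<le> 1 - 3 / real n"
    using eta_decay[OF assms] unfolding eventually_sequentially by blast
  define L' where "L' = max L N"
  have "cmod (Q n w) * real n ^ 3 \<le> cmod (Q L' w) * real L' ^ 3" if "n \<ge> L'" for n
    using that
  proof (induction rule: dec_induct)
    case (step n)
    have n: "n \<ge> L" "n \<ge> N" using step by (auto simp: L'_def)
    have x: "(1 - 3 / real (Suc n)) * real (Suc n) ^ 3 \<le> real n ^ 3"
      by (simp add: field_simps power3_eq_cube)
    have "cmod (Q (Suc n) w) * real (Suc n) ^ 3 = cmod (Q n w) * (cmod (eta \<alpha> (Suc n) w) * real (Suc n) ^ 3)"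
      unfolding Q_Suc[OF n(2)] by (simp add: norm_mult)
    also have "\<dots> \<le> cmod (Q n w) * ((1 - 3 / real (Suc n)) * real (Suc n) ^ 3)"
      using L[of "Suc n"] n by (intro mult_left_mono mult_right_mono) auto
    also have "\<dots> \<le> cmod (Q n w) * real n ^ 3" using x by (intro mult_left_mono) auto
    finally show ?case using step by simp
  qed simp
  then have "\<forall>\<^sub>F n in sequentially. cmod (Q n w) \<le> (cmod (Q L' w) * real L' ^ 3) / real n ^ 3"
    using N2 unfolding eventually_sequentially
    by (intro exI[of _ L']) (auto simp: L'_def pos_le_divide_eq)
  then show ?thesis by (intro exI[of _ "cmod (Q L' w) * real L' ^ 3"]) auto
qed

end

section \<open>The closed slit annulus\<close>

lemma closed_slit_annulus_subset:
  assumes "s \<in> closed_slit_annulus r R"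
  shows "fst s = (snd s)\<^sup>2" "r \<le> cmod (fst s)" "cmod (fst s) \<le> R" "0 \<le> Re (snd s)"
proof -
  let ?S = "{s :: complex \<times> complex. fst s = (snd s)\<^sup>2 \<and> r \<le> cmod (fst s) \<and> cmod (fst s) \<le> R \<and> 0 \<le> Re (snd s)}"
  have "closed ?S"
    by (intro closed_Collect_conj closed_Collect_eq closed_Collect_le continuous_intros)
  moreover have "lift ` slit_annulus r R \<subseteq> ?S"
    using Re_csqrt by (auto simp: lift_def slit_annulus_def simp del: csqrt.sel)
  ultimately have "closed_slit_annulus r R \<subseteq> ?S"
    unfolding closed_slit_annulus_def by (intro closure_minimal)
  then show "fst s = (snd s)\<^sup>2" "r \<le> cmod (fst s)" "cmod (fst s) \<le> R" "0 \<le> Re (snd s)"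
    using assms by auto
qed

lemma lift_in_closed: "z \<in> slit_annulus r R \<Longrightarrow> lift z \<in> closed_slit_annulus r R"
  unfolding closed_slit_annulus_def by (meson closure_subset image_subset_iff)

lemma open_slit_annulus: "open (slit_annulus r R)"
  unfolding slit_annulus_def
  by (intro open_Diff closed_nonpos_Reals_complex open_Collect_conj open_Collect_less continuous_intros)

text \<open>
  The exponential image of a rectangle; in particular the slit annulus is connected.
\<close>

lemma slit_annulus_exp:
  "0 < r \<Longrightarrow> slit_annulus r R = exp ` {z. ln r < Re z \<and> Re z < ln R \<and> - pi < Im z \<and> Im z < pi}" if "r < R" for r R
proof -
  assume r: "0 < r"
  have R: "0 < R" using r that by simp
  show ?thesis
  proof (intro set_eqI iffI)
    fix z assume z: "z \<in> slit_annulus r R"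
    then have z0: "z \<noteq> 0" and b: "r < cmod z" "cmod z < R" and nr: "z \<notin> \<real>\<^sub>\<le>\<^sub>0"
      by (auto simp: slit_annulus_def)
    have "- pi < Im (Ln z)" "Im (Ln z) \<le> pi" using z0 mpi_less_Im_Ln Im_Ln_le_pi by auto
    moreover have "Im (Ln z) \<noteq> pi" using nr z0 Im_Ln_eq_pi[of z] by (auto simp: complex_nonpos_Reals_iff)
    ultimately have "Ln z \<in> {z. ln r < Re z \<and> Re z < ln R \<and> - pi < Im z \<and> Im z < pi}"
      using z0 b r R by (simp add: Re_Ln)
    then have "exp (Ln z) \<in> exp ` {z. ln r < Re z \<and> Re z < ln R \<and> - pi < Im z \<and> Im z < pi}"
      by (rule imageI)
    then show "z \<in> exp ` {z. ln r < Re z \<and> Re z < ln R \<and> - pi < Im z \<and> Im z < pi}"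
      unfolding exp_Ln[OF z0] .
  next
    fix z assume "z \<in> exp ` {z. ln r < Re z \<and> Re z < ln R \<and> - pi < Im z \<and> Im z < pi}"
    then obtain y where y: "z = exp y" "ln r < Re y" "Re y < ln R" "- pi < Im y" "Im y < pi" by auto
    have "Ln z = y" unfolding y(1) using y by (intro Ln_exp) auto
    moreover have z0: "z \<noteq> 0" by (simp add: y(1))
    ultimately have "\<not> (Re z < 0 \<and> Im z = 0)" using Im_Ln_eq_pi[OF z0] y(5) by auto
    then have "z \<notin> \<real>\<^sub>\<le>\<^sub>0" using z0 by (auto simp: complex_nonpos_Reals_iff complex_eq_iff)
    moreover have "exp (ln r) < exp (Re y)" "exp (Re y) < exp (ln R)" using y by simp_all
    then have "r < cmod z" "cmod z < R" using r R by (simp_all add: y(1))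
    ultimately show "z \<in> slit_annulus r R" by (simp add: slit_annulus_def)
  qed
qed

lemma connected_closed_slit_annulus:
  assumes "0 < r" "r < R"
  shows "connected (closed_slit_annulus r R)"
proof -
  have "{z. ln r < Re z \<and> Re z < ln R \<and> - pi < Im z \<and> Im z < pi}
      = {z. ln r < Re z} \<inter> ({z. Re z < ln R} \<inter> ({z. - pi < Im z} \<inter> {z. Im z < pi}))" by auto
  then have "convex {z. ln r < Re z \<and> Re z < ln R \<and> - pi < Im z \<and> Im z < pi}"
    by (simp only:) (intro convex_Int convex_halfspace_Re_gt convex_halfspace_Re_lt
        convex_halfspace_Im_gt convex_halfspace_Im_lt)
  then have "connected (slit_annulus r R)"
    unfolding slit_annulus_exp[OF assms(2,1)]
    by (intro connected_continuous_image convex_connected continuous_intros)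
  then have "connected (lift ` slit_annulus r R)"
    unfolding lift_def
    by (intro connected_continuous_image continuous_on_Pair continuous_on_id
        continuous_on_subset[OF continuous_on_csqrt]) (auto simp: slit_annulus_def)
  then show ?thesis
    unfolding closed_slit_annulus_def by (rule connected_imp_connected_closure)
qed

text \<open>
  The half-angle formula for the root.  It is continuous on the whole plane, which makes it convenient for limits
  from above onto the cut.
\<close>

definition upper_root :: "complex \<Rightarrow> complex" where
  "upper_root z = Complex (sqrt ((cmod z + Re z) / 2)) (sqrt ((cmod z - Re z) / 2))"

lemma continuous_upper_root: "continuous_on UNIV upper_root"
  unfolding upper_root_def[abs_def] Complex_eq by (intro continuous_intros) auto

lemma upper_root_csqrt: "Im z > 0 \<Longrightarrow> csqrt z = upper_root z"
  by (simp add: upper_root_def complex_eq_iff)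

lemma upper_root_real: "x < 0 \<Longrightarrow> upper x = (of_real x, upper_root (of_real x))"
  by (simp add: upper_root_def upper_def complex_eq_iff)

lemma lift_tendsto_upper:
  assumes "x < 0"
  shows "(lift \<longlongrightarrow> upper x) (at (of_real x) within {z. Im z > 0})"
proof -
  have "((\<lambda>z. (z, upper_root z)) \<longlongrightarrow> (of_real x, upper_root (of_real x))) (at (of_real x))"
    using continuous_upper_root by (intro tendsto_intros) (auto simp: continuous_on_eq_continuous_at isCont_def)
  then have "((\<lambda>z. (z, upper_root z)) \<longlongrightarrow> upper x) (at (of_real x) within {z. Im z > 0})"
    unfolding upper_root_real[OF assms] by (rule tendsto_within_subset) auto
  then show ?thesis
  proof (rule Lim_transform_eventually)
    show "\<forall>\<^sub>F z in at (of_real x) within {z. Im z > 0}. (z, upper_root z) = lift z"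
      unfolding eventually_at by (rule exI[of _ 1]) (auto simp: lift_def upper_root_csqrt)
  qed
qed

lemma upper_in_closed:
  assumes "0 < r" "r < R" "x \<in> {-R..-r}"
  shows "upper x \<in> closed_slit_annulus r R"
proof -
  have inner: "upper x \<in> closed_slit_annulus r R" if x: "x \<in> {-R<..<-r}" for x
  proof -
    have "(\<lambda>n. Complex x (1 / real (Suc n))) \<longlonglongrightarrow> Complex x 0"
      unfolding Complex_eq by (intro tendsto_intros) real_asymp
    then have lim: "(\<lambda>n. Complex x (1 / real (Suc n))) \<longlonglongrightarrow> of_real x" by (simp add: complex_of_real_def)
    have lt: "x < 0" using x assms by simp
    have "filterlim (\<lambda>n. Complex x (1 / real (Suc n))) (at (of_real x) within {z. Im z > 0}) sequentially"
      using lim by (auto simp: filterlim_at complex_eq_iff)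
    from filterlim_compose[OF lift_tendsto_upper[OF lt] this]
    have l: "(\<lambda>n. lift (Complex x (1 / real (Suc n)))) \<longlonglongrightarrow> upper x" .
    have "(\<lambda>n. cmod (Complex x (1 / real (Suc n)))) \<longlonglongrightarrow> cmod (of_real x)"
      using lim by (rule tendsto_norm)
    then have c: "(\<lambda>n. cmod (Complex x (1 / real (Suc n)))) \<longlonglongrightarrow> - x" using lt by simp
    have "\<forall>\<^sub>F n in sequentially. r < cmod (Complex x (1 / real (Suc n)))"
      "\<forall>\<^sub>F n in sequentially. cmod (Complex x (1 / real (Suc n))) < R"
      by (rule order_tendstoD[OF c]; use x in simp)+
    then have ev: "\<forall>\<^sub>F n in sequentially. lift (Complex x (1 / real (Suc n))) \<in> closed_slit_annulus r R"
      by eventually_elim (auto intro!: lift_in_closed simp: slit_annulus_def complex_nonpos_Reals_iff)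
    show ?thesis
      by (rule Lim_in_closed_set[OF _ ev _ l]) (simp_all add: closed_slit_annulus_def)
  qed
  have "upper ` closure {-R<..<-r} \<subseteq> closed_slit_annulus r R"
  proof (rule image_closure_subset)
    show "continuous_on (closure {-R<..<-r}) upper"
      unfolding upper_def[abs_def] by (intro continuous_intros)
    show "closed (closed_slit_annulus r R)" by (simp add: closed_slit_annulus_def)
    show "upper ` {-R<..<-r} \<subseteq> closed_slit_annulus r R" using inner by auto
  qed
  moreover have "closure {-R<..<-r} = {-R..-r}" using assms by (intro closure_greaterThanLessThan) simp
  ultimately show ?thesis using assms by auto
qed

lemma regular_const: "regular_on_surface r R (\<lambda>s. c)"
  by (simp add: regular_on_surface_def)

lemma regular_fst: "regular_on_surface r R fst"
  by (auto simp: regular_on_surface_def lift_def intro: continuous_intros holomorphic_intros)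

lemma regular_snd: "regular_on_surface r R snd"
  unfolding regular_on_surface_def lift_def
  by (auto intro!: continuous_intros holomorphic_intros simp: slit_annulus_def)

lemma regular_add:
  "regular_on_surface r R f \<Longrightarrow> regular_on_surface r R g \<Longrightarrow> regular_on_surface r R (\<lambda>s. f s + g s)"
  by (auto simp: regular_on_surface_def intro: continuous_intros holomorphic_intros)

lemma regular_diff:
  "regular_on_surface r R f \<Longrightarrow> regular_on_surface r R g \<Longrightarrow> regular_on_surface r R (\<lambda>s. f s - g s)"
  by (auto simp: regular_on_surface_def intro: continuous_intros holomorphic_intros)

lemma regular_mult:
  "regular_on_surface r R f \<Longrightarrow> regular_on_surface r R g \<Longrightarrow> regular_on_surface r R (\<lambda>s. f s * g s)"
  by (auto simp: regular_on_surface_def intro: continuous_intros holomorphic_intros)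

lemma regular_power:
  "regular_on_surface r R f \<Longrightarrow> regular_on_surface r R (\<lambda>s. f s ^ k)"
  by (auto simp: regular_on_surface_def intro: continuous_intros holomorphic_intros)

lemma regular_divide:
  assumes "regular_on_surface r R f" "regular_on_surface r R g"
    "\<And>s. s \<in> closed_slit_annulus r R \<Longrightarrow> g s \<noteq> 0"
  shows "regular_on_surface r R (\<lambda>s. f s / g s)"
  unfolding regular_on_surface_def
proof
  show "(\<lambda>z. f (lift z) / g (lift z)) holomorphic_on slit_annulus r R"
    using assms(1,2) assms(3)[OF lift_in_closed]
    by (intro holomorphic_on_divide) (auto simp: regular_on_surface_def)
  show "continuous_on (closed_slit_annulus r R) (\<lambda>s. f s / g s)"
    using assms by (intro continuous_on_divide) (auto simp: regular_on_surface_def)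
qed

lemma regular_sum:
  "(\<And>i. i \<in> I \<Longrightarrow> regular_on_surface r R (f i)) \<Longrightarrow> regular_on_surface r R (\<lambda>s. \<Sum>i\<in>I. f i s)"
  by (auto simp: regular_on_surface_def intro: continuous_intros holomorphic_intros)

lemma regular_prod:
  "(\<And>i. i \<in> I \<Longrightarrow> regular_on_surface r R (f i)) \<Longrightarrow> regular_on_surface r R (\<lambda>s. \<Prod>i\<in>I. f i s)"
  by (auto simp: regular_on_surface_def intro: continuous_intros holomorphic_intros)

lemma regular_cong:
  assumes "regular_on_surface r R f" "\<And>s. s \<in> closed_slit_annulus r R \<Longrightarrow> g s = f s"
  shows "regular_on_surface r R g"
proof -
  have "(\<lambda>z. f (lift z)) holomorphic_on slit_annulus r R \<longleftrightarrow> (\<lambda>z. g (lift z)) holomorphic_on slit_annulus r R"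
    using assms(2) lift_in_closed by (intro holomorphic_cong) auto
  moreover have "continuous_on (closed_slit_annulus r R) f \<longleftrightarrow> continuous_on (closed_slit_annulus r R) g"
    using assms(2) by (intro continuous_on_cong) auto
  ultimately show ?thesis using assms(1) by (simp add: regular_on_surface_def)
qed

lemma near_1_not_nonpos: "cmod (x - 1) \<le> 1/2 \<Longrightarrow> x \<notin> \<real>\<^sub>\<le>\<^sub>0"
proof -
  assume "cmod (x - 1) \<le> 1/2"
  then have "\<bar>Re (x - 1)\<bar> \<le> 1/2" by (rule order_trans[OF abs_Re_le_cmod])
  then have "Re x > 0" unfolding minus_complex.sel one_complex.sel by linarith
  then show ?thesis by (auto simp: complex_nonpos_Reals_iff)
qed

lemma regular_csqrt:
  assumes "regular_on_surface r R f" "\<And>s. s \<in> closed_slit_annulus r R \<Longrightarrow> cmod (f s - 1) \<le> 1/2"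
  shows "regular_on_surface r R (\<lambda>s. csqrt (f s))"
proof -
  have "f s \<notin> \<real>\<^sub>\<le>\<^sub>0" if "s \<in> closed_slit_annulus r R" for s
    using assms(2)[OF that] by (rule near_1_not_nonpos)
  note np = this
  show ?thesis
    unfolding regular_on_surface_def
  proof
    show "(\<lambda>z. csqrt (f (lift z))) holomorphic_on slit_annulus r R"
      using assms(1) np[OF lift_in_closed]
      by (intro holomorphic_on_csqrt') (auto simp: regular_on_surface_def)
    show "continuous_on (closed_slit_annulus r R) (\<lambda>s. csqrt (f s))"
    proof (rule continuous_on_compose2[OF continuous_on_csqrt])
      show "continuous_on (closed_slit_annulus r R) f" using assms(1) by (simp add: regular_on_surface_def)
      show "f ` closed_slit_annulus r R \<subseteq> - \<real>\<^sub>\<le>\<^sub>0" using np by blast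
    qed
  qed
qed

lemma regular_uniform_limit:
  assumes f: "\<And>M. regular_on_surface r R (f M)"
    and u: "uniform_limit (closed_slit_annulus r R) f l sequentially"
  shows "regular_on_surface r R l"
proof -
  have "continuous_on (closed_slit_annulus r R) l"
    using f by (intro uniform_limit_theorem[OF _ u]) (auto simp: regular_on_surface_def)
  moreover have "(\<lambda>z. l (lift z)) holomorphic_on slit_annulus r R"
  proof (rule holomorphic_uniform_sequence[OF open_slit_annulus, where f = "\<lambda>M z. f M (lift z)"])
    show "(\<lambda>z. f M (lift z)) holomorphic_on slit_annulus r R" for M
      using f by (simp add: regular_on_surface_def)
    fix x assume "x \<in> slit_annulus r R"
    then obtain d where d: "d > 0" "cball x d \<subseteq> slit_annulus r R"
      using open_slit_annulus open_contains_cball by blast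
    have "uniform_limit (cball x d) (\<lambda>M z. f M (lift z)) (\<lambda>z. l (lift z)) sequentially"
      using u unfolding uniform_limit_iff
    proof (intro allI impI)
      fix e :: real assume "\<forall>e>0. \<forall>\<^sub>F n in sequentially. \<forall>s\<in>closed_slit_annulus r R. dist (f n s) (l s) < e" "e > 0"
      then have "\<forall>\<^sub>F n in sequentially. \<forall>s\<in>closed_slit_annulus r R. dist (f n s) (l s) < e" by simp
      then show "\<forall>\<^sub>F n in sequentially. \<forall>z\<in>cball x d. dist (f n (lift z)) (l (lift z)) < e"
        by eventually_elim (use d lift_in_closed in blast)
    qed
    then show "\<exists>d>0. cball x d \<subseteq> slit_annulus r R \<and>
        uniform_limit (cball x d) (\<lambda>M z. f M (lift z)) (\<lambda>z. l (lift z)) sequentially"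
      using d by blast
  qed
  ultimately show ?thesis by (simp add: regular_on_surface_def)
qed

text \<open>
  The quotient of two branches of \<open>\<surd>f\<close> is continuous with values \<open>\<plusminus>1\<close>, hence constant on the connected closure.
  Positivity at one point of the positive half-line determines the constant.
\<close>

lemma sqrt_branch_eq_csqrt:
  assumes rR: "0 < r" "r < R" and f: "regular_on_surface r R f"
    and near: "\<And>s. s \<in> closed_slit_annulus r R \<Longrightarrow> cmod (f s - 1) \<le> 1/2"
    and pos: "\<And>x. x \<in> {r..R} \<Longrightarrow> f (lift (of_real x)) \<in> \<real> \<and> 0 < Re (f (lift (of_real x)))"
    and s: "s \<in> closed_slit_annulus r R"
  shows "sqrt_branch r R f s = csqrt (f s)"
proof -
  let ?K = "closed_slit_annulus r R"
  have "is_sqrt_branch r R f (\<lambda>s. csqrt (f s))"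
    unfolding is_sqrt_branch_def
  proof (intro conjI ballI)
    show "regular_on_surface r R (\<lambda>s. csqrt (f s))" using f near by (rule regular_csqrt)
    fix x assume x: "x \<in> {r..R}"
    obtain y where y: "f (lift (of_real x)) = of_real y" "y > 0"
      using pos[OF x] by (metis Re_complex_of_real Reals_cases)
    then have "csqrt (f (lift (of_real x))) = of_real (sqrt y)" by simp
    then show "csqrt (f (lift (of_real x))) \<in> \<real>" "0 < Re (csqrt (f (lift (of_real x))))"
      using y(2) by (simp_all del: csqrt.sel)
  qed simp
  then have g: "is_sqrt_branch r R f (sqrt_branch r R f)"
    unfolding sqrt_branch_def by (rule someI[of "is_sqrt_branch r R f"])
  define g where "g = sqrt_branch r R f"
  have g2: "(g s)\<^sup>2 = f s" if "s \<in> ?K" for s using g that by (auto simp: is_sqrt_branch_def g_def)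
  have f0: "f s \<noteq> 0" if "s \<in> ?K" for s using near[OF that] by auto
  define h where "h s = g s / csqrt (f s)" for s
  have hK: "h s = 1 \<or> h s = -1" if "s \<in> ?K" for s
  proof -
    have "(h s)\<^sup>2 = 1" unfolding h_def power_divide g2[OF that] using f0[OF that] by simp
    then show ?thesis by (simp add: power2_eq_1_iff)
  qed
  have hc: "continuous_on ?K h"
    using g regular_csqrt[OF f near] f0 unfolding h_def g_def is_sqrt_branch_def regular_on_surface_def
    by (auto intro!: continuous_on_divide)
  have "\<exists>c. \<forall>s\<in>?K. h s = c"
  proof -
    have "finite (h ` ?K)" by (rule finite_subset[of _ "{1, -1}"]) (use hK in auto)
    then have "h constant_on ?K"
      using continuous_finite_range_constant[OF connected_closed_slit_annulus[OF rR] hc] by simp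
    then show ?thesis by (simp add: constant_on_def)
  qed
  then obtain c where c: "\<And>s. s \<in> ?K \<Longrightarrow> h s = c" by blast
  define x0 where "x0 = (r + R) / 2"
  have "r < x0" "x0 < R" "0 < x0" using rR by (simp_all add: x0_def)
  then have x0: "x0 \<in> {r..R}" "lift (of_real x0) \<in> ?K"
    by (auto simp: slit_annulus_def complex_nonpos_Reals_iff intro!: lift_in_closed)
  have "h (lift (of_real x0)) \<noteq> -1"
  proof
    assume "h (lift (of_real x0)) = -1"
    then have "g (lift (of_real x0)) = - csqrt (f (lift (of_real x0)))"
      using f0[OF x0(2)] by (simp add: h_def divide_eq_eq)
    moreover have "0 < Re (g (lift (of_real x0)))" using g x0(1) by (auto simp: is_sqrt_branch_def g_def)
    moreover have "0 \<le> Re (csqrt (f (lift (of_real x0))))" by (rule Re_csqrt)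
    ultimately show False by (simp del: csqrt.sel)
  qed
  then have "c = 1" using hK[OF x0(2)] c[OF x0(2)] by auto
  then have "h s = 1" using c[OF s] by simp
  then show ?thesis using f0[OF s] by (simp add: h_def g_def divide_eq_eq)
qed

section \<open>Solutions of the recurrence\<close>

text \<open>
  Truncation of \<open>f\<close> at \<open>k\<close> replaces \<open>v\<close> by its own truncation and two boundary terms, \<open>a k * f (Suc k)\<close> at \<open>k\<close> and
  \<open>a k * f k\<close> at \<open>Suc k\<close>.
\<close>

lemma decaying_in_jacobi_operator:
  fixes f :: "nat \<Rightarrow> complex"
  assumes f: "f \<in> ell2" and a0: "(\<lambda>n. of_real (a n) * f n) \<longlonglongrightarrow> 0" "(\<lambda>n. of_real (a n) * f (Suc n)) \<longlonglongrightarrow> 0"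
    and v: "v \<in> ell2"
    and 1: "of_real (b 1) * f 1 + of_real (a 1) * f 2 = v 1"
    and 2: "\<And>n. n \<ge> 2 \<Longrightarrow> of_real (a (n - 1)) * f (n - 1) + of_real (b n) * f n + of_real (a n) * f (n + 1) = v n"
  shows "(f, v) \<in> jacobi_operator a b"
proof -
  have f0: "f 0 = 0" and v0: "v 0 = 0" using f v by (auto simp: ell2_def)
  define \<phi> where "\<phi> k n = (if n \<le> k then f n else 0)" for k n
  have fin: "finitely_supported (\<phi> k)" for k
    unfolding finitely_supported_def \<phi>_def using f0 by (auto intro: finite_subset[of _ "{..k}"])
  have tail: "(\<lambda>k. \<Sum>n. (cmod (u (n + Suc k)))\<^sup>2) \<longlonglongrightarrow> 0" if "u \<in> ell2" for u
    using suminf_exist_split2[OF ell2_summable[OF that]] by (rule LIMSEQ_Suc)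
  have trunc: "(\<Sum>n. (cmod ((if n \<le> k then u n else 0) - u n))\<^sup>2) = (\<Sum>n. (cmod (u (n + Suc k)))\<^sup>2)"
    if "u \<in> ell2" for u k
  proof -
    have "summable (\<lambda>n. (cmod ((if n \<le> k then u n else 0) - u n))\<^sup>2)"
      by (rule summable_comparison_test'[OF ell2_summable[OF that], of 0]) auto
    from suminf_split_initial_segment[OF this, of "Suc k"] show ?thesis by (simp add: sum.neutral)
  qed
  have d: "(\<lambda>n. u n - (w n::complex)) \<in> ell2" if "u \<in> ell2" "w \<in> ell2" for u w by (rule ell2_diff[OF that])
  have \<phi>2: "\<phi> k \<in> ell2" for k by (rule finitely_supported_ell2[OF fin])
  have t1: "ell2_tendsto \<phi> f"
    unfolding ell2_tendsto_iff_sq[OF \<phi>2 f] ell2_norm_sq[OF d[OF \<phi>2 f]]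
    using tail[OF f] trunc[OF f] by (simp add: \<phi>_def)
  let ?J = "\<lambda>k. jacobi_apply a b (\<phi> k)"
  have J2: "?J k \<in> ell2" for k by (intro finitely_supported_ell2 finitely_supported_jacobi_apply fin)
  have Jeq: "?J k n = (if n \<le> k then v n else 0) - (if n = k then of_real (a k) * f (Suc k) else 0)
      + (if n = Suc k then of_real (a k) * f k else 0)" if "k \<ge> 1" for k n
  proof -
    consider "n = 0" | "n = 1" | "n \<ge> 2" by linarith
    then show ?thesis
    proof cases
      case 1
      then show ?thesis using v0 that by simp
    next
      case n: 2
      have "jacobi_apply a b (\<phi> k) 1 = of_real (b 1) * f 1 + of_real (a 1) * \<phi> k 2"
        using jacobi_apply_Suc[OF fin, of 1 a b k] that f0 by (simp add: \<phi>_def numeral_2_eq_2)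
      then show ?thesis using n that 1 by (auto simp: \<phi>_def numeral_2_eq_2 algebra_simps)
    next
      case n: 3
      then obtain j where j: "n = Suc (Suc j)" by (metis add_2_eq_Suc le_Suc_ex)
      show ?thesis
        using jacobi_apply_Suc[OF fin, of n a b k] 2[OF n] n that unfolding j
        by (auto simp: \<phi>_def algebra_simps not_le less_Suc_eq_le le_Suc_eq)
    qed
  qed
  have t2: "ell2_tendsto ?J v"
  proof -
    have lim: "(\<lambda>k. 2 * (\<Sum>n. (cmod (v (n + Suc k)))\<^sup>2)
        + 2 * (2 * (cmod (of_real (a k) * f (Suc k)))\<^sup>2 + 2 * (cmod (of_real (a k) * f k))\<^sup>2)) \<longlonglongrightarrow> 2 * 0 + 2 * (2 * 0\<^sup>2 + 2 * 0\<^sup>2)"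
      by (intro tendsto_intros tail[OF v] tendsto_norm_zero a0)
    have sg: "(\<lambda>n. if n = k then c else 0) \<in> ell2" "(ell2_norm (\<lambda>n. if n = k then c else 0))\<^sup>2 = (cmod c)\<^sup>2"
      if "k \<ge> 1" for k and c :: complex
    proof -
      have "(\<lambda>n. (cmod (if n = k then c else 0))\<^sup>2) sums (\<Sum>n\<in>{k}. (cmod (if n = k then c else 0))\<^sup>2)"
        by (rule sums_finite) auto
      then have s: "(\<lambda>n. (cmod (if n = k then c else 0))\<^sup>2) sums (cmod c)\<^sup>2" by simp
      then show m: "(\<lambda>n. if n = k then c else 0) \<in> ell2" using that by (auto simp: ell2_def sums_iff)
      show "(ell2_norm (\<lambda>n. if n = k then c else 0))\<^sup>2 = (cmod c)\<^sup>2"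
        unfolding ell2_norm_sq[OF m] using s by (rule sums_unique[symmetric])
    qed
    have b: "(ell2_norm (\<lambda>n. ?J k n - v n))\<^sup>2 \<le> 2 * (\<Sum>n. (cmod (v (n + Suc k)))\<^sup>2)
        + 2 * (2 * (cmod (of_real (a k) * f (Suc k)))\<^sup>2 + 2 * (cmod (of_real (a k) * f k))\<^sup>2)" if k: "k \<ge> 1" for k
    proof -
      let ?x = "\<lambda>n. if n = k then - (of_real (a k) * f (Suc k)) else 0"
      let ?y = "\<lambda>n. if n = Suc k then of_real (a k) * f k else 0"
      let ?t = "\<lambda>n. (if n \<le> k then v n else 0) - v n"
      have e: "(\<lambda>n. ?J k n - v n) = (\<lambda>n. ?t n + (?x n + ?y n))"
        by (auto simp: Jeq[OF k])
      have "(\<lambda>n. if n \<le> k then v n else 0) \<in> ell2"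
        by (rule finitely_supported_ell2) (use v0 in \<open>auto simp: finitely_supported_def intro: finite_subset[of _ "{..k}"]\<close>)
      then have t: "?t \<in> ell2" using v by (rule d)
      have xy: "(\<lambda>n. ?x n + ?y n) \<in> ell2" by (intro ell2_add(1) sg(1)) (use k in auto)
      have tn: "(ell2_norm ?t)\<^sup>2 = (\<Sum>n. (cmod (v (n + Suc k)))\<^sup>2)"
        unfolding ell2_norm_sq[OF t] by (rule trunc[OF v])
      have "(ell2_norm (\<lambda>n. ?x n + ?y n))\<^sup>2 \<le> 2 * (ell2_norm ?x)\<^sup>2 + 2 * (ell2_norm ?y)\<^sup>2"
        by (rule ell2_add(2)[OF sg(1) sg(1)]) (use k in auto)
      also have "(ell2_norm ?x)\<^sup>2 = (cmod (of_real (a k) * f (Suc k)))\<^sup>2"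
        using sg(2)[OF k, of "- (of_real (a k) * f (Suc k))"] by simp
      also have "(ell2_norm ?y)\<^sup>2 = (cmod (of_real (a k) * f k))\<^sup>2"
        using sg(2)[of "Suc k" "of_real (a k) * f k"] by simp
      finally have xyb: "(ell2_norm (\<lambda>n. ?x n + ?y n))\<^sup>2
          \<le> 2 * (cmod (of_real (a k) * f (Suc k)))\<^sup>2 + 2 * (cmod (of_real (a k) * f k))\<^sup>2" .
      have "(ell2_norm (\<lambda>n. ?J k n - v n))\<^sup>2 \<le> 2 * (ell2_norm ?t)\<^sup>2 + 2 * (ell2_norm (\<lambda>n. ?x n + ?y n))\<^sup>2"
        unfolding e by (rule ell2_add(2)[OF t xy])
      also have "\<dots> \<le> 2 * (\<Sum>n. (cmod (v (n + Suc k)))\<^sup>2)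
        + 2 * (2 * (cmod (of_real (a k) * f (Suc k)))\<^sup>2 + 2 * (cmod (of_real (a k) * f k))\<^sup>2)"
        unfolding tn by (intro add_left_mono mult_left_mono xyb) simp
      finally show ?thesis .
    qed
    show ?thesis
      unfolding ell2_tendsto_iff_sq[OF J2 v]
    proof (rule real_tendsto_sandwich[OF _ _ tendsto_const])
      show "\<forall>\<^sub>F k in sequentially. (ell2_norm (\<lambda>n. ?J k n - v n))\<^sup>2 \<le> 2 * (\<Sum>n. (cmod (v (n + Suc k)))\<^sup>2)
        + 2 * (2 * (cmod (of_real (a k) * f (Suc k)))\<^sup>2 + 2 * (cmod (of_real (a k) * f k))\<^sup>2)"
        using eventually_ge_at_top[of 1] by eventually_elim (rule b)
      show "(\<lambda>k. 2 * (\<Sum>n. (cmod (v (n + Suc k)))\<^sup>2)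
        + 2 * (2 * (cmod (of_real (a k) * f (Suc k)))\<^sup>2 + 2 * (cmod (of_real (a k) * f k))\<^sup>2)) \<longlonglongrightarrow> 0"
        using lim by simp
    qed auto
  qed
  show ?thesis
    unfolding jacobi_operator_def using f v fin t1 t2 by auto
qed

lemma wronskian_const:
  assumes u: "jacobi_solution a b z u" and v: "jacobi_solution a b z v" and "n \<ge> 1"
  shows "wronskian a u v n = wronskian a u v 1"
  using assms(3)
proof (induction rule: dec_induct)
  case (step n)
  have "of_real (a n) * u n + of_real (b (Suc n)) * u (Suc n) + of_real (a (Suc n)) * u (Suc (Suc n)) = z * u (Suc n)"
    "of_real (a n) * v n + of_real (b (Suc n)) * v (Suc n) + of_real (a (Suc n)) * v (Suc (Suc n)) = z * v (Suc n)"
    using u v step unfolding jacobi_solution_def by (auto dest!: spec[of _ "Suc n"])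
  then have e: "of_real (a (Suc n)) * u (Suc (Suc n)) = z * u (Suc n) - of_real (a n) * u n - of_real (b (Suc n)) * u (Suc n)"
    "of_real (a (Suc n)) * v (Suc (Suc n)) = z * v (Suc n) - of_real (a n) * v n - of_real (b (Suc n)) * v (Suc n)"
    by (simp_all add: algebra_simps eq_diff_eq)
  have "wronskian a u v (Suc n) = u (Suc n) * (of_real (a (Suc n)) * v (Suc (Suc n)))
      - (of_real (a (Suc n)) * u (Suc (Suc n))) * v (Suc n)"
    by (simp add: wronskian_def algebra_simps)
  also have "\<dots> = wronskian a u v n"
    unfolding e by (simp add: wronskian_def algebra_simps)
  finally show ?case using step by simp
qed simp

lemma jacobi_solution_eqI:
  assumes u: "jacobi_solution a b z u" and v: "jacobi_solution a b z v"
    and a: "\<And>n. n \<ge> 1 \<Longrightarrow> a n \<noteq> 0" and 12: "u 1 = v 1" "u 2 = v 2" and "n \<ge> 1"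
  shows "u n = v n"
proof -
  have "u n = v n \<and> u (Suc n) = v (Suc n)" using assms(6)
  proof (induction rule: dec_induct)
    case base
    then show ?case using 12 by (simp add: numeral_2_eq_2)
  next
    case (step n)
    have "of_real (a n) * u n + of_real (b (Suc n)) * u (Suc n) + of_real (a (Suc n)) * u (Suc (Suc n)) = z * u (Suc n)"
      "of_real (a n) * v n + of_real (b (Suc n)) * v (Suc n) + of_real (a (Suc n)) * v (Suc (Suc n)) = z * v (Suc n)"
      using u v step unfolding jacobi_solution_def by (auto dest!: spec[of _ "Suc n"])
    then have "of_real (a (Suc n)) * u (Suc (Suc n)) = of_real (a (Suc n)) * v (Suc (Suc n))"
      using step by (metis add_left_imp_eq)
    then show ?case using step a[of "Suc n"] by simp
  qed
  then show ?thesis by simp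
qed

lemma orth_poly_solution:
  assumes "\<And>n. n \<ge> 1 \<Longrightarrow> a n \<noteq> 0"
  shows "jacobi_solution a b z (\<lambda>n. orth_poly a b n z)"
  unfolding jacobi_solution_def
proof (intro allI impI)
  fix n :: nat assume "2 \<le> n"
  then obtain j where n: "n = Suc (Suc j)" by (metis add_2_eq_Suc le_Suc_ex)
  have "a (j + 2) \<noteq> 0" using assms by simp
  then show "of_real (a (n - 1)) * orth_poly a b (n - 1) z + of_real (b n) * orth_poly a b n z
      + of_real (a n) * orth_poly a b (n + 1) z = z * orth_poly a b n z"
    unfolding n by (simp add: field_simps)
qed

text \<open>
  Both sides solve the recurrence, and the Wronskian at \<open>n = 1\<close> makes them agree for \<open>n = 1, 2\<close>.
\<close>

lemma orth_poly_representation: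
  fixes u :: "nat \<Rightarrow> complex" and x K :: real
  assumes u: "jacobi_solution a b (of_real x) u" and a: "\<And>n. n \<ge> 1 \<Longrightarrow> a n > 0"
    and W: "wronskian a (\<lambda>n. cnj (u n)) u 1 = - 2 * \<i> * of_real K" and K: "K \<noteq> 0" and n: "n \<ge> 1"
  defines "u0 \<equiv> (of_real x - of_real (b 1)) * u 1 - of_real (a 1) * u 2"
  defines "\<Psi> \<equiv> u0 / (2 * \<i> * of_real K)"
  shows "orth_poly a b n (of_real x) = \<Psi> * cnj (u n) + cnj \<Psi> * u n"
proof -
  have u': "jacobi_solution a b (of_real x) (\<lambda>n. cnj (u n))"
    unfolding jacobi_solution_def
  proof (intro allI impI)
    fix n :: nat assume "2 \<le> n"
    then have "of_real (a (n - 1)) * u (n - 1) + of_real (b n) * u n + of_real (a n) * u (n + 1) = of_real x * u n"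
      using u by (simp add: jacobi_solution_def)
    from arg_cong[OF this, of cnj]
    show "of_real (a (n - 1)) * cnj (u (n - 1)) + of_real (b n) * cnj (u n) + of_real (a n) * cnj (u (n + 1)) = of_real x * cnj (u n)"
      by simp
  qed
  let ?v = "\<lambda>n. \<Psi> * cnj (u n) + cnj \<Psi> * u n"
  have v: "jacobi_solution a b (of_real x) ?v"
    unfolding jacobi_solution_def
  proof (intro allI impI)
    fix n :: nat assume n: "2 \<le> n"
    have e1: "of_real (a (n - 1)) * u (n - 1) + of_real (b n) * u n + of_real (a n) * u (n + 1) = of_real x * u n"
      using u n by (simp add: jacobi_solution_def)
    have e2: "of_real (a (n - 1)) * cnj (u (n - 1)) + of_real (b n) * cnj (u n) + of_real (a n) * cnj (u (n + 1)) = of_real x * cnj (u n)"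
      using u' n by (simp add: jacobi_solution_def)
    have "of_real (a (n - 1)) * ?v (n - 1) + of_real (b n) * ?v n + of_real (a n) * ?v (n + 1)
      = \<Psi> * (of_real (a (n - 1)) * cnj (u (n - 1)) + of_real (b n) * cnj (u n) + of_real (a n) * cnj (u (n + 1)))
      + cnj \<Psi> * (of_real (a (n - 1)) * u (n - 1) + of_real (b n) * u n + of_real (a n) * u (n + 1))"
      by (simp add: algebra_simps)
    also have "\<dots> = of_real x * ?v n" unfolding e1 e2 by (simp add: algebra_simps)
    finally show "of_real (a (n - 1)) * ?v (n - 1) + of_real (b n) * ?v n + of_real (a n) * ?v (n + 1) = of_real x * ?v n" .
  qed
  let ?K = "2 * \<i> * of_real K :: complex"
  have K0: "?K \<noteq> 0" using K by simp
  have a1: "a 1 > 0" using a by simp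
  have W1: "of_real (a 1) * (cnj (u 1) * u 2 - cnj (u 2) * u 1) = - ?K"
    using W by (simp add: wronskian_def numeral_2_eq_2)
  have c\<Psi>: "cnj \<Psi> = - (cnj u0 / ?K)" by (simp add: \<Psi>_def)
  have v1: "?v 1 = 1"
  proof -
    have "u0 * cnj (u 1) - cnj u0 * u 1 = - (of_real (a 1) * (cnj (u 1) * u 2 - cnj (u 2) * u 1))"
      by (simp add: u0_def algebra_simps)
    then have "u0 * cnj (u 1) - cnj u0 * u 1 = ?K" unfolding W1 by simp
    moreover have "?v 1 = (u0 * cnj (u 1) - cnj u0 * u 1) / ?K"
      unfolding c\<Psi> by (simp add: \<Psi>_def diff_divide_distrib)
    ultimately show ?thesis using K0 by simp
  qed
  have v2: "?v 2 = (of_real x - of_real (b 1)) / of_real (a 1)"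
  proof -
    have "u0 * cnj (u 2) - cnj u0 * u 2 = (of_real x - of_real (b 1)) * (u 1 * cnj (u 2) - cnj (u 1) * u 2)"
      by (simp add: u0_def algebra_simps)
    then have "of_real (a 1) * (u0 * cnj (u 2) - cnj u0 * u 2)
        = of_real (a 1) * ((of_real x - of_real (b 1)) * (u 1 * cnj (u 2) - cnj (u 1) * u 2))"
      by (simp only:)
    also have "\<dots> = (of_real x - of_real (b 1)) * (- (of_real (a 1) * (cnj (u 1) * u 2 - cnj (u 2) * u 1)))"
      by (simp add: algebra_simps)
    finally have "of_real (a 1) * (u0 * cnj (u 2) - cnj u0 * u 2) = (of_real x - of_real (b 1)) * ?K"
      unfolding W1 by simp
    then have "(u0 * cnj (u 2) - cnj u0 * u 2) / ?K = (of_real x - of_real (b 1)) / of_real (a 1)"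
      using K0 a1 by (simp add: field_simps)
    moreover have "?v 2 = (u0 * cnj (u 2) - cnj u0 * u 2) / ?K"
      unfolding c\<Psi> by (simp add: \<Psi>_def diff_divide_distrib)
    ultimately show ?thesis by simp
  qed
  show ?thesis
  proof (rule jacobi_solution_eqI[OF orth_poly_solution v _ _ _ n])
    show "orth_poly a b 1 (of_real x) = ?v 1" unfolding v1 by simp
    show "orth_poly a b 2 (of_real x) = ?v 2" unfolding v2 by (simp add: numeral_2_eq_2)
  qed (use a in \<open>simp_all add: less_imp_neq[symmetric]\<close>)
qed

section \<open>The solution on the closed slit annulus\<close>

lemma backward_extension:
  fixes U :: "nat \<Rightarrow> 's \<Rightarrow> complex"
  shows "\<exists>u. (\<forall>n\<ge>N. u n = U n) \<and> (\<forall>n<N. u n = (\<lambda>s. step n (u (Suc n) s) (u (Suc (Suc n)) s) s))"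
proof (induction N arbitrary: U)
  case 0
  then show ?case by auto
next
  case (Suc N)
  obtain u where u: "\<forall>n\<ge>N. u n = (U(N := (\<lambda>s. step N (U (Suc N) s) (U (Suc (Suc N)) s) s))) n"
    "\<forall>n<N. u n = (\<lambda>s. step n (u (Suc n) s) (u (Suc (Suc n)) s) s)"
    using Suc.IH[of "U(N := (\<lambda>s. step N (U (Suc N) s) (U (Suc (Suc N)) s) s))"] by blast
  have 1: "u n = U n" if "n \<ge> Suc N" for n using u(1) that by simp
  have 2: "u N = (\<lambda>s. step N (u (Suc N) s) (u (Suc (Suc N)) s) s)"
    using u(1) 1[of "Suc N"] 1[of "Suc (Suc N)"] by simp
  show ?case
    using 1 2 u(2) by (intro exI[of _ u]) (auto simp: less_Suc_eq)
qed

locale slit_jacobi = wkb_tail \<alpha> "sqrt r" "sqrt R" p q a b N g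
  for \<alpha> r R :: real and p q a b :: "nat \<Rightarrow> real" and N :: nat and g :: "nat \<Rightarrow> real" +
  assumes rR: "0 < r" "r < R"
begin

abbreviation K where "K \<equiv> closed_slit_annulus r R"

lemma snd_W0: "s \<in> K \<Longrightarrow> snd s \<in> W0"
proof -
  assume s: "s \<in> K"
  have "cmod (fst s) = (cmod (snd s))\<^sup>2"
    using closed_slit_annulus_subset(1)[OF s] by (simp add: norm_power)
  then have "sqrt (cmod (fst s)) = cmod (snd s)" by simp
  then have "sqrt r \<le> cmod (snd s)" "cmod (snd s) \<le> sqrt R"
    using closed_slit_annulus_subset(2,3)[OF s] by (metis real_sqrt_le_iff)+
  then show ?thesis using closed_slit_annulus_subset(4)[OF s] by (simp add: W0_def W_def)
qed

lemma radicand_eq: "s \<in> K \<Longrightarrow> radicand \<alpha> n s = wkb_radicand \<alpha> n (snd s)"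
proof -
  assume s: "s \<in> K"
  have e: "real n powr (1 - \<alpha>) = 1 / real n powr (\<alpha> - 1)" "real n powr (-\<alpha>) = 1 / real n powr \<alpha>"
    by (simp_all flip: powr_minus_divide)
  show ?thesis unfolding radicand_def wkb_radicand_def e closed_slit_annulus_subset(1)[OF s] by simp
qed

lemma regular_radicand: "regular_on_surface r R (radicand \<alpha> n)"
proof -
  have "fst s \<noteq> 0" if "s \<in> K" for s using closed_slit_annulus_subset(2)[OF that] rR by auto
  then have "regular_on_surface r R (\<lambda>s. 1 + fst s * (1 / of_real (4 * real n powr \<alpha>))
      + (of_real \<alpha> * (1 / of_real (real n powr (1 - \<alpha>)))) / fst s)"
    by (intro regular_add regular_const regular_mult regular_divide regular_fst)
  then show ?thesis by (rule regular_cong) (simp add: radicand_def)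
qed

lemma radicand_near: "n \<ge> N \<Longrightarrow> s \<in> K \<Longrightarrow> cmod (radicand \<alpha> n s - 1) \<le> 1/2"
  unfolding radicand_eq using wkb_radicand_N snd_W0 W0 by blast

lemma sqrt_branch_radicand:
  assumes "n \<ge> N" "s \<in> K"
  shows "sqrt_branch r R (radicand \<alpha> n) s = csqrt (wkb_radicand \<alpha> n (snd s))"
proof -
  have "sqrt_branch r R (radicand \<alpha> n) s = csqrt (radicand \<alpha> n s)"
  proof (rule sqrt_branch_eq_csqrt[OF rR regular_radicand radicand_near[OF assms(1)] _ assms(2)])
    fix x assume x: "x \<in> {r..R}"
    have "radicand \<alpha> n (lift (of_real x)) = of_real (1 + x / (4 * real n powr \<alpha>) + \<alpha> / (x * real n powr (1 - \<alpha>)))"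
      by (simp add: radicand_def lift_def)
    moreover have "0 < 1 + x / (4 * real n powr \<alpha>) + \<alpha> / (x * real n powr (1 - \<alpha>))"
      using x rR \<alpha> by (intro add_pos_nonneg divide_nonneg_nonneg mult_nonneg_nonneg) auto
    ultimately show "radicand \<alpha> n (lift (of_real x)) \<in> \<real> \<and> 0 < Re (radicand \<alpha> n (lift (of_real x)))"
      by simp
  qed
  then show ?thesis by (simp only: radicand_eq[OF assms(2)])
qed

lemma eta_minus_eq:
  assumes "n \<ge> N" "s \<in> K"
  shows "eta_minus r R \<alpha> n s = eta \<alpha> n (snd s)"
proof -
  have "real n powr (-\<alpha>/2) = 1 / real n powr (\<alpha>/2)" "real n powr (-\<alpha>) = 1 / real n powr \<alpha>"
    by (simp_all flip: powr_minus_divide)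
  then show ?thesis
    unfolding eta_minus_def eta_def wkbA_def wkbB_def sqrt_branch_radicand[OF assms]
      closed_slit_annulus_subset(1)[OF assms(2)] by (simp del: csqrt.sel)
qed

lemma regular_eta: "n \<ge> N \<Longrightarrow> regular_on_surface r R (\<lambda>s. eta \<alpha> n (snd s))"
proof -
  assume n: "n \<ge> N"
  have "regular_on_surface r R (\<lambda>s. csqrt (radicand \<alpha> n s))"
    by (rule regular_csqrt[OF regular_radicand radicand_near[OF n]])
  then have "regular_on_surface r R (\<lambda>s. csqrt (wkb_radicand \<alpha> n (snd s)))"
    by (rule regular_cong) (simp add: radicand_eq del: csqrt.sel)
  then have "regular_on_surface r R (\<lambda>s. (1 + (snd s)\<^sup>2 * (of_real (real n powr (-\<alpha>)) / 2) + of_real (\<alpha> / (4 * real n)))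
     - snd s * of_real (real n powr (-\<alpha>/2)) * csqrt (wkb_radicand \<alpha> n (snd s)))"
    by (intro regular_diff regular_add regular_mult regular_const regular_power regular_snd)
  then show ?thesis by (rule regular_cong) (simp add: eta_def wkbA_def wkbB_def)
qed

lemma regular_Q: "regular_on_surface r R (\<lambda>s. Q n (snd s))"
  unfolding Q_def by (intro regular_prod regular_eta) auto

lemma regular_residual: "n \<ge> N \<Longrightarrow> regular_on_surface r R (\<lambda>s. residual n (snd s))"
  unfolding residual_def
  using eta_nz[OF _ W0(1)[OF snd_W0]]
  by (intro regular_diff regular_add regular_mult regular_const regular_power regular_snd regular_divide regular_eta) auto

lemma regular_green_kernel: "n \<ge> N \<Longrightarrow> regular_on_surface r R (\<lambda>s. green_kernel n k (snd s))"
proof -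
  assume n: "n \<ge> N"
  have "of_real (a j) * Q j (snd s) * Q (Suc j) (snd s) \<noteq> 0" if "s \<in> K" "j \<ge> N" for s j
    using Q_nz[OF W0(1)[OF snd_W0[OF that(1)]]] a_pos[of j] that(2) N2 by auto
  then show ?thesis
    unfolding green_kernel_def using n
    by (intro regular_sum regular_mult regular_power regular_divide regular_const regular_Q) auto
qed

lemma regular_v_trunc: "n \<ge> N \<Longrightarrow> regular_on_surface r R (\<lambda>s. v_trunc M n (snd s))"
proof (induction "M - n" arbitrary: n rule: less_induct)
  case less
  have "regular_on_surface r R (\<lambda>s. 1 - (\<Sum>k\<in>{n<..M}. green_kernel n k (snd s) * residual k (snd s) * v_trunc M k (snd s)))"
    using less by (intro regular_diff regular_const regular_sum regular_mult regular_green_kernel regular_residual less.hyps) auto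
  moreover have "v_trunc M n w = 1 - (\<Sum>k\<in>{n<..M}. green_kernel n k w * residual k w * v_trunc M k w)" for w
    unfolding v_trunc_def by (subst volterra.simps) (simp add: volterra_kernel_def)
  ultimately show ?case by simp
qed

lemma regular_V: "n \<ge> N \<Longrightarrow> regular_on_surface r R (\<lambda>s. V n (snd s))"
proof -
  assume n: "n \<ge> N"
  have u: "uniform_limit K (\<lambda>M s. v_trunc M n (snd s)) (\<lambda>s. V n (snd s)) sequentially"
    unfolding uniform_limit_iff
  proof (intro allI impI)
    fix e :: real assume "e > 0"
    then have "\<forall>\<^sub>F M in sequentially. \<forall>w\<in>W0. dist (v_trunc M n w) (V n w) < e"
      using uniform_limitD[OF V_uniform[OF n]] by simp
    then show "\<forall>\<^sub>F M in sequentially. \<forall>s\<in>K. dist (v_trunc M n (snd s)) (V n (snd s)) < e"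
      by eventually_elim (use snd_W0 in blast)
  qed
  show ?thesis by (rule regular_uniform_limit[OF regular_v_trunc[OF n] u])
qed

text \<open>
  \<open>Q\<^sub>n V\<^sub>n\<close> for \<open>n \<ge> N\<close>, continued to smaller indices by solving the recurrence for its lowest term.
\<close>

definition sol :: "nat \<Rightarrow> complex \<times> complex \<Rightarrow> complex" where
  "sol = (SOME u. (\<forall>n\<ge>N. u n = (\<lambda>s. Q n (snd s) * V n (snd s))) \<and>
     (\<forall>n<N. u n = (\<lambda>s. ((fst s - of_real (b (Suc n))) * u (Suc n) s - of_real (a (Suc n)) * u (Suc (Suc n)) s)
        / of_real (a n))))"

lemma sol: "n \<ge> N \<Longrightarrow> sol n s = Q n (snd s) * V n (snd s)"
  "n < N \<Longrightarrow> sol n s = ((fst s - of_real (b (Suc n))) * sol (Suc n) s - of_real (a (Suc n)) * sol (Suc (Suc n)) s)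
        / of_real (a n)"
proof -
  have "\<exists>u. (\<forall>n\<ge>N. u n = (\<lambda>s. Q n (snd s) * V n (snd s))) \<and>
     (\<forall>n<N. u n = (\<lambda>s. ((fst s - of_real (b (Suc n))) * u (Suc n) s - of_real (a (Suc n)) * u (Suc (Suc n)) s)
        / of_real (a n)))"
    by (rule backward_extension[where step = "\<lambda>n x y s. ((fst s - of_real (b (Suc n))) * x - of_real (a (Suc n)) * y)
        / of_real (a n)"])
  from someI_ex[OF this, folded sol_def]
  have e: "\<forall>n\<ge>N. sol n = (\<lambda>s. Q n (snd s) * V n (snd s))"
     "\<forall>n<N. sol n = (\<lambda>s. ((fst s - of_real (b (Suc n))) * sol (Suc n) s - of_real (a (Suc n)) * sol (Suc (Suc n)) s)
        / of_real (a n))"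
    by (rule conjunct1, rule conjunct2)
  then show "n \<ge> N \<Longrightarrow> sol n s = Q n (snd s) * V n (snd s)"
    "n < N \<Longrightarrow> sol n s = ((fst s - of_real (b (Suc n))) * sol (Suc n) s - of_real (a (Suc n)) * sol (Suc (Suc n)) s)
        / of_real (a n)"
    using fun_cong[OF e(1)[rule_format], of n s] fun_cong[OF e(2)[rule_format], of n s] by simp_all
qed

lemma sol_solution: "s \<in> K \<Longrightarrow> jacobi_solution a b (fst s) (\<lambda>n. sol n s)"
  unfolding jacobi_solution_def
proof (intro allI impI)
  fix n :: nat assume s: "s \<in> K" and n: "2 \<le> n"
  show "of_real (a (n - 1)) * sol (n - 1) s + of_real (b n) * sol n s + of_real (a n) * sol (n + 1) s = fst s * sol n s"
  proof (cases "n - 1 \<ge> N")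
    case True
    then have nN: "n > N" using n by simp
    then show ?thesis
      using V_recurrence[OF nN snd_W0[OF s]] True sol(1)[of "n - 1" s] sol(1)[of n s] sol(1)[of "Suc n" s]
      by (simp add: closed_slit_annulus_subset(1)[OF s])
  next
    case False
    then have "n - 1 < N" "1 \<le> n - 1" "Suc (n - 1) = n" using n by simp_all
    then have "of_real (a (n - 1)) * sol (n - 1) s
        = (fst s - of_real (b n)) * sol n s - of_real (a n) * sol (Suc n) s"
      using sol(2)[of "n - 1" s] a_pos[of "n - 1"] by simp
    then show ?thesis by (simp add: algebra_simps)
  qed
qed

lemma regular_sol: "n \<ge> 1 \<Longrightarrow> regular_on_surface r R (sol n)"
proof (induction "N - n" arbitrary: n rule: less_induct)
  case less
  have big: "regular_on_surface r R (sol n)" if "n \<ge> N" for n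
    using regular_mult[OF regular_Q[of n] regular_V[OF that]] by (rule regular_cong) (simp add: sol(1)[OF that])
  show ?case
  proof (cases "n \<ge> N")
    case False
    have 1: "regular_on_surface r R (sol (Suc n))" "regular_on_surface r R (sol (Suc (Suc n)))"
      using False by (cases "Suc n \<ge> N"; cases "Suc (Suc n) \<ge> N"; auto intro: big less.hyps)+
    have "regular_on_surface r R (\<lambda>s. ((fst s - of_real (b (Suc n))) * sol (Suc n) s - of_real (a (Suc n)) * sol (Suc (Suc n)) s)
        / of_real (a n))"
      using a_pos[OF less.prems] by (intro regular_divide regular_diff regular_mult regular_const regular_fst 1) auto
    then show ?thesis by (rule regular_cong) (use False sol(2)[of n] in auto)
  qed (rule big)
qed

lemma sol_asymptotics:
  "\<exists>\<epsilon>. uniform_limit K \<epsilon> (\<lambda>_. 0) sequentially \<and>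
    (\<forall>n\<ge>N. \<forall>s\<in>K. sol n s = (\<Prod>l = N..n. eta_minus r R \<alpha> l s) * (1 + \<epsilon> n s))"
proof (intro exI conjI allI impI ballI)
  show "uniform_limit K (\<lambda>n s. V n (snd s) - 1) (\<lambda>_. 0) sequentially"
    unfolding uniform_limit_iff
  proof (intro allI impI)
    fix e :: real assume e: "e > 0"
    have "(\<lambda>n. exp_G * c4 * tail n) \<longlonglongrightarrow> 0" using tail_tendsto by (rule tendsto_mult_right_zero)
    then have "\<forall>\<^sub>F n in sequentially. exp_G * c4 * tail n < e" using e by (rule order_tendstoD)
    then show "\<forall>\<^sub>F n in sequentially. \<forall>s\<in>K. dist (V n (snd s) - 1) 0 < e"
      using eventually_ge_at_top[of N]
    proof eventually_elim
      case (elim n)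
      show ?case
      proof
        fix s assume "s \<in> K"
        from V_minus_1[OF elim(2) snd_W0[OF this]] elim(1) show "dist (V n (snd s) - 1) 0 < e" by simp
      qed
    qed
  qed
  fix n s assume n: "n \<ge> N" and s: "s \<in> K"
  have "(\<Prod>l = N..n. eta_minus r R \<alpha> l s) = Q n (snd s)"
    unfolding Q_def by (rule prod.cong) (use eta_minus_eq s in auto)
  then show "sol n s = (\<Prod>l = N..n. eta_minus r R \<alpha> l s) * (1 + (V n (snd s) - 1))"
    by (simp add: sol(1)[OF n])
qed

lemma upper_K: "x \<in> {-R..-r} \<Longrightarrow> upper x \<in> K"
  using upper_in_closed[OF rR] .

lemma upper_cut: "x \<in> {-R..-r} \<Longrightarrow> snd (upper x) \<in> cut"
  using W0(1)[OF snd_W0[OF upper_K]] by (auto simp: cut_def upper_def)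

definition H where "H x = sqrt (cmod (F_limit (snd (upper x))))"

lemma H_pos: "x \<in> {-R..-r} \<Longrightarrow> H x > 0"
  using F_limit_lower[OF cut(1)[OF upper_cut]] c1 unfolding H_def by fastforce

lemma H_sq: "(H x)\<^sup>2 = cmod (F_limit (snd (upper x)))"
  by (simp add: H_def)

lemma H_limit:
  assumes x: "x \<in> {-R..-r}"
  shows "(\<lambda>n. real n powr (\<alpha> / 4) * (\<Prod>l = N..n. cmod (eta_minus r R \<alpha> l (upper x)))) \<longlonglongrightarrow> H x"
proof -
  let ?w = "snd (upper x)"
  have "(\<lambda>n. sqrt (cmod (F n ?w))) \<longlonglongrightarrow> H x"
    unfolding H_def by (intro tendsto_real_sqrt tendsto_norm F_limit_pointwise cut(1) upper_cut x)
  moreover have "sqrt (cmod (F n ?w)) = real n powr (\<alpha> / 4) * (\<Prod>l = N..n. cmod (eta_minus r R \<alpha> l (upper x)))" for n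
  proof -
    have "(\<Prod>l = N..n. cmod (eta_minus r R \<alpha> l (upper x))) = cmod (Q n ?w)"
      unfolding Q_def prod_norm[symmetric] by (rule prod.cong) (use eta_minus_eq upper_K[OF x] in auto)
    moreover have "real n powr (\<alpha>/2) = (real n powr (\<alpha>/4))\<^sup>2"
      by (simp add: power2_eq_square flip: powr_add)
    ultimately show ?thesis
      unfolding norm_F_cut[OF upper_cut[OF x]] by (simp add: real_sqrt_mult)
  qed
  ultimately show ?thesis by simp
qed

lemma continuous_upper: "continuous_on S upper"
  unfolding upper_def[abs_def] by (intro continuous_intros)

lemma H_continuous: "continuous_on {-R..-r} H"
proof -
  have "continuous_on {-R..-r} (\<lambda>x. cmod (F_limit (snd (upper x))))"
  proof (rule uniform_limit_theorem[where f = "\<lambda>n x. cmod (F n (snd (upper x)))"])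
    show "\<forall>\<^sub>F n in sequentially. continuous_on {-R..-r} (\<lambda>x. cmod (F n (snd (upper x))))"
    proof (rule always_eventually, rule allI)
      fix n
      have "continuous_on {-R..-r} (\<lambda>x. Q n (snd (upper x)))"
        using regular_Q[of n] upper_K
        by (intro continuous_on_compose2[of K "\<lambda>s. Q n (snd s)" _ upper] continuous_upper)
          (auto simp: regular_on_surface_def)
      then have "continuous_on {-R..-r} (\<lambda>x. real n powr (\<alpha>/2) * (cmod (Q n (snd (upper x))))\<^sup>2)"
        by (intro continuous_intros)
      then show "continuous_on {-R..-r} (\<lambda>x. cmod (F n (snd (upper x))))"
        by (rule continuous_on_cong[THEN iffD2, rotated 2]) (use norm_F_cut upper_cut in auto)
    qed
    have "uniform_limit {-R..-r} (\<lambda>n x. F n (snd (upper x))) (\<lambda>x. F_limit (snd (upper x))) sequentially"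
      unfolding uniform_limit_iff
    proof (intro allI impI)
      fix e :: real assume "e > 0"
      then have "\<forall>\<^sub>F n in sequentially. \<forall>w\<in>W. dist (F n w) (F_limit w) < e"
        using uniform_limitD[OF F_limit] by simp
      then show "\<forall>\<^sub>F n in sequentially. \<forall>x\<in>{-R..-r}. dist (F n (snd (upper x))) (F_limit (snd (upper x))) < e"
        by eventually_elim (use cut(1)[OF upper_cut] in blast)
    qed
    then show "uniform_limit {-R..-r} (\<lambda>n x. cmod (F n (snd (upper x)))) (\<lambda>x. cmod (F_limit (snd (upper x)))) sequentially"
      by (rule uniform_limit_norm)
  qed simp
  then show ?thesis unfolding H_def by (intro continuous_on_real_sqrt)
qed

lemma sol_cnj_solution: "x \<in> {-R..-r} \<Longrightarrow> jacobi_solution a b (of_real x) (\<lambda>n. cnj (sol n (upper x)))"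
  unfolding jacobi_solution_def
proof (intro allI impI)
  fix n :: nat assume x: "x \<in> {-R..-r}" and n: "2 \<le> n"
  have "of_real (a (n - 1)) * sol (n - 1) (upper x) + of_real (b n) * sol n (upper x) + of_real (a n) * sol (n + 1) (upper x)
      = of_real x * sol n (upper x)"
    using sol_solution[OF upper_K[OF x]] n by (simp add: jacobi_solution_def upper_def)
  from arg_cong[OF this, of cnj]
  show "of_real (a (n - 1)) * cnj (sol (n - 1) (upper x)) + of_real (b n) * cnj (sol n (upper x))
      + of_real (a n) * cnj (sol (n + 1) (upper x)) = of_real x * cnj (sol n (upper x))" by simp
qed

text \<open>
  The Wronskian is constant, so it equals its limit at infinity.
\<close>

lemma sol_wronskian:
  assumes x: "x \<in> {-R..-r}" and n: "n \<ge> 1"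
  shows "wronskian a (\<lambda>n. cnj (sol n (upper x))) (\<lambda>n. sol n (upper x)) n = - 2 * \<i> * of_real (sqrt (- x) * (H x)\<^sup>2)"
proof -
  let ?u = "\<lambda>n. sol n (upper x)" and ?w = "snd (upper x)"
  let ?Wr = "\<lambda>n. wronskian a (\<lambda>n. cnj (?u n)) ?u n"
  have s: "jacobi_solution a b (of_real x) ?u"
    using sol_solution[OF upper_K[OF x]] by (simp add: upper_def)
  have const: "?Wr n = ?Wr 1" if "n \<ge> 1" for n
    by (rule wronskian_const[OF sol_cnj_solution[OF x] s that])
  have im: "?Wr n = 2 * \<i> * of_real (a n * Im (cnj (?u n) * ?u (Suc n)))" for n
    unfolding wronskian_def by (simp add: complex_eq_iff)
  have "(\<lambda>n. a n * Im (cnj (Q n ?w * V n ?w) * (Q (Suc n) ?w * V (Suc n) ?w))) \<longlonglongrightarrow> - (Im ?w * cmod (F_limit ?w))"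
    by (rule wronskian_limit[OF upper_cut[OF x]])
  then have "(\<lambda>n. a n * Im (cnj (?u n) * ?u (Suc n))) \<longlonglongrightarrow> - (Im ?w * cmod (F_limit ?w))"
  proof (rule Lim_transform_eventually)
    show "\<forall>\<^sub>F n in sequentially. a n * Im (cnj (Q n ?w * V n ?w) * (Q (Suc n) ?w * V (Suc n) ?w))
        = a n * Im (cnj (?u n) * ?u (Suc n))"
      using eventually_ge_at_top[of N] by eventually_elim (simp add: sol(1))
  qed
  then have "?Wr \<longlonglongrightarrow> 2 * \<i> * of_real (- (Im ?w * cmod (F_limit ?w)))"
    unfolding im by (intro tendsto_intros)
  moreover have "\<forall>\<^sub>F n in sequentially. ?Wr 1 = ?Wr n"
    using eventually_ge_at_top[of "1::nat"] by eventually_elim (rule const[symmetric])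
  then have "?Wr \<longlonglongrightarrow> ?Wr 1" by (rule Lim_transform_eventually[OF tendsto_const])
  ultimately have "?Wr 1 = 2 * \<i> * of_real (- (Im ?w * cmod (F_limit ?w)))" by (rule LIMSEQ_unique[rotated])
  also have "\<dots> = - 2 * \<i> * of_real (sqrt (- x) * (H x)\<^sup>2)"
    unfolding H_sq by (simp add: upper_def)
  finally show ?thesis using const[OF n] by simp
qed

end

section \<open>The spectral density\<close>

context slit_jacobi begin

definition sol0 :: "complex \<times> complex \<Rightarrow> complex" where
  "sol0 s = (fst s - of_real (b 1)) * sol 1 s - of_real (a 1) * sol 2 s"

lemma regular_sol0: "regular_on_surface r R sol0"
  unfolding sol0_def[abs_def]
  by (intro regular_diff regular_mult regular_const regular_fst regular_sol) auto

lemma sol_decay: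
  assumes s: "s \<in> K" and Rw: "Re (snd s) > 0"
  shows "\<exists>C\<ge>0. \<forall>\<^sub>F n in sequentially. cmod (sol n s) \<le> C / real n ^ 3"
proof -
  let ?w = "snd s"
  obtain C where C: "C \<ge> 0" "\<forall>\<^sub>F n in sequentially. cmod (Q n ?w) \<le> C / real n ^ 3"
    using Q_decay[OF W0(1)[OF snd_W0[OF s]] Rw] by blast
  have "(\<lambda>n. cmod (V n ?w)) \<longlonglongrightarrow> cmod 1"
    by (intro tendsto_norm V_tendsto_1 snd_W0 s)
  then have "\<forall>\<^sub>F n in sequentially. cmod (V n ?w) < 2" by (rule order_tendstoD) simp
  then have "\<forall>\<^sub>F n in sequentially. cmod (sol n s) \<le> (2 * C) / real n ^ 3"
    using C(2) eventually_ge_at_top[of N]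
  proof eventually_elim
    case (elim n)
    have "cmod (sol n s) = cmod (Q n ?w) * cmod (V n ?w)" by (simp add: sol(1)[OF elim(3)] norm_mult)
    also have "\<dots> \<le> (C / real n ^ 3) * 2" using elim C(1) by (intro mult_mono) auto
    finally show ?case by (simp add: mult.commute)
  qed
  then show ?thesis using C(1) by (intro exI[of _ "2 * C"]) auto
qed

lemma a_le_linear: "\<forall>\<^sub>F n in sequentially. a n \<le> 2 * real n"
proof -
  have "\<forall>\<^sub>F n in sequentially. a n * real n powr (-\<alpha>) < 2"
    using a_ratio by (rule order_tendstoD) simp
  then show ?thesis using eventually_ge_at_top[of 1]
  proof eventually_elim
    case (elim n)
    have "a n = (a n * real n powr (-\<alpha>)) * real n powr \<alpha>" using elim(2) by (simp add: powr_minus)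
    also have "\<dots> \<le> 2 * real n powr \<alpha>" using elim by (intro mult_right_mono) auto
    also have "real n powr \<alpha> \<le> real n powr 1" using elim(2) \<alpha> by (intro powr_mono) auto
    finally show ?case using elim(2) by simp
  qed
qed

text \<open>
  The index 0 is not part of the half-line, and \<open>sol0\<close> is the boundary value there: in the first row of the
  matrix the recurrence holds up to a multiple of \<open>sol0\<close>.
\<close>

lemma sol_in_operator:
  assumes s: "s \<in> K" and Rw: "Re (snd s) > 0"
  defines "y \<equiv> \<lambda>n. if n = 0 then 0 else sol n s"
  shows "(\<lambda>n. d * y n, \<lambda>n. fst s * (d * y n) + (- d * sol0 s) * e1 n) \<in> jacobi_operator a b"
proof -
  obtain C where C: "C \<ge> 0" "\<forall>\<^sub>F n in sequentially. cmod (sol n s) \<le> C / real n ^ 3"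
    using sol_decay[OF s Rw] by blast
  have yC: "\<forall>\<^sub>F n in sequentially. cmod (y n) \<le> C / real n ^ 3"
    using C(2) eventually_ge_at_top[of 1] by eventually_elim (simp add: y_def)
  have y: "y \<in> ell2"
  proof -
    have "summable (\<lambda>n. C\<^sup>2 * (1 / real n ^ 6))"
      using inverse_power_summable[of 6, where 'a = real] by (intro summable_mult) (simp add: inverse_eq_divide)
    moreover have "\<forall>\<^sub>F n in sequentially. norm ((cmod (y n))\<^sup>2) \<le> C\<^sup>2 * (1 / real n ^ 6)"
      using yC
    proof eventually_elim
      case (elim n)
      then have "(cmod (y n))\<^sup>2 \<le> (C / real n ^ 3)\<^sup>2" by (intro power_mono) auto
      then show ?case by (simp add: power_divide flip: power_mult)
    qed
    ultimately have "summable (\<lambda>n. (cmod (y n))\<^sup>2)" by (rule summable_comparison_test_ev[rotated])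
    then show ?thesis by (simp add: ell2_def y_def)
  qed
  have l1: "(\<lambda>n. of_real (a n) * y n) \<longlonglongrightarrow> 0"
  proof (rule Lim_null_comparison)
    show "(\<lambda>n. 2 * C / (real n)\<^sup>2) \<longlonglongrightarrow> 0" by real_asymp
    show "\<forall>\<^sub>F n in sequentially. norm (of_real (a n) * y n) \<le> 2 * C / (real n)\<^sup>2"
      using yC a_le_linear eventually_ge_at_top[of 1]
    proof eventually_elim
      case (elim n)
      have "norm (of_real (a n) * y n) \<le> (2 * real n) * (C / real n ^ 3)"
        unfolding norm_mult norm_of_real using elim a_pos[OF elim(3)] by (intro mult_mono) auto
      also have "\<dots> = 2 * C / (real n)\<^sup>2" using elim(3) by (simp add: power2_eq_square power3_eq_cube field_simps)
      finally show ?case .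
    qed
  qed
  have l2: "(\<lambda>n. of_real (a n) * y (Suc n)) \<longlonglongrightarrow> 0"
  proof (rule Lim_null_comparison)
    show "(\<lambda>n. 2 * C / (real n)\<^sup>2) \<longlonglongrightarrow> 0" by real_asymp
    have "\<forall>\<^sub>F n in sequentially. cmod (y (Suc n)) \<le> C / real (Suc n) ^ 3"
      using yC by (subst eventually_sequentially_Suc)
    then show "\<forall>\<^sub>F n in sequentially. norm (of_real (a n) * y (Suc n)) \<le> 2 * C / (real n)\<^sup>2"
      using a_le_linear eventually_ge_at_top[of 1]
    proof eventually_elim
      case (elim n)
      have "C / real (Suc n) ^ 3 \<le> C / real n ^ 3"
        using C(1) elim(3) by (intro divide_left_mono power_mono) auto
      then have "norm (of_real (a n) * y (Suc n)) \<le> (2 * real n) * (C / real n ^ 3)"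
        unfolding norm_mult norm_of_real using elim a_pos[OF elim(3)] by (intro mult_mono) auto
      also have "\<dots> = 2 * C / (real n)\<^sup>2" using elim(3) by (simp add: power2_eq_square power3_eq_cube field_simps)
      finally show ?case .
    qed
  qed
  show ?thesis
  proof (rule decaying_in_jacobi_operator)
    show dy: "(\<lambda>n. d * y n) \<in> ell2" using y by (rule ell2_scale)
    show "(\<lambda>n. fst s * (d * y n) + (- d * sol0 s) * e1 n) \<in> ell2"
      by (intro ell2_add(1) ell2_scale(1) y ell2_e1)
    show "(\<lambda>n. of_real (a n) * (d * y n)) \<longlonglongrightarrow> 0"
      using tendsto_mult_right_zero[OF l1, of d] by (simp add: mult_ac)
    show "(\<lambda>n. of_real (a n) * (d * y (Suc n))) \<longlonglongrightarrow> 0"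
      using tendsto_mult_right_zero[OF l2, of d] by (simp add: mult_ac)
    show "of_real (b 1) * (d * y 1) + of_real (a 1) * (d * y 2) = fst s * (d * y 1) + - d * sol0 s * e1 1"
      by (simp add: y_def sol0_def e1_def algebra_simps)
    fix n :: nat assume n: "n \<ge> 2"
    have e: "of_real (a (n - 1)) * sol (n - 1) s + of_real (b n) * sol n s + of_real (a n) * sol (n + 1) s = fst s * sol n s"
      using sol_solution[OF s] n by (simp add: jacobi_solution_def)
    have "of_real (a (n - 1)) * (d * y (n - 1)) + of_real (b n) * (d * y n) + of_real (a n) * (d * y (n + 1))
        = d * (of_real (a (n - 1)) * sol (n - 1) s + of_real (b n) * sol n s + of_real (a n) * sol (n + 1) s)"
      using n by (simp add: y_def algebra_simps)
    then show "of_real (a (n - 1)) * (d * y (n - 1)) + of_real (b n) * (d * y n) + of_real (a n) * (d * y (n + 1))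
        = fst s * (d * y n) + - d * sol0 s * e1 n"
      unfolding e using n by (simp add: y_def e1_def)
  qed
qed

lemma lift_props:
  assumes "z \<in> slit_annulus r R"
  shows "lift z \<in> K" "fst (lift z) = z" "0 < Re (snd (lift z))"
proof -
  show "lift z \<in> K" using assms by (rule lift_in_closed)
  show "fst (lift z) = z" by (simp add: lift_def)
  have "z \<notin> \<real>\<^sub>\<le>\<^sub>0" using assms by (simp add: slit_annulus_def)
  have "Re (csqrt z) \<noteq> 0"
  proof
    assume 0: "Re (csqrt z) = 0"
    define y where "y = Im (csqrt z)"
    have "csqrt z = Complex 0 y" using 0 by (simp add: y_def complex_eq_iff del: csqrt.sel)
    from power2_csqrt[of z, unfolded this] have "z = - of_real (y\<^sup>2)"
      by (auto simp: complex_eq_iff power2_eq_square)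
    then show False using \<open>z \<notin> \<real>\<^sub>\<le>\<^sub>0\<close> by (simp add: complex_nonpos_Reals_iff)
  qed
  then show "0 < Re (snd (lift z))" using Re_csqrt[of z] by (simp add: lift_def del: csqrt.sel)
qed

text \<open>
  If \<open>sol0\<close> vanished, the solution would be an eigenvector for the nonreal number \<open>z\<close>.  Otherwise \<open>- sol / sol0\<close> is
  the resolvent applied to \<open>e1\<close>.
\<close>

lemma resolvent_entry:
  assumes sp: "spectral_measure_of E (jacobi_operator a b)" and z: "z \<in> slit_annulus r R" "Im z > 0"
  shows "integral\<^sup>L (scalar_measure E e1) (\<lambda>x. Im (1 / (of_real x - z))) = Im (- sol 1 (lift z) / sol0 (lift z))"
proof -
  interpret pvm E using sp by unfold_locales (simp add: spectral_measure_of_def)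
  let ?s = "lift z"
  let ?y = "\<lambda>n. if n = 0 then 0 else sol n ?s"
  note lp = lift_props[OF z(1)]
  have c: "sol0 ?s \<noteq> 0"
  proof
    assume c: "sol0 ?s = 0"
    have "(?y, \<lambda>n. z * ?y n) \<in> jacobi_operator a b"
      using sol_in_operator[OF lp(1,3), of 1] unfolding c lp(2) by simp
    note y = this
    have "?y = (\<lambda>n. 0)" by (rule nonreal_not_eigenvalue[OF sp y]) (use z(2) in simp)
    then have 0: "sol n ?s = 0" if "n \<ge> 1" for n using that by (auto dest: fun_cong[of _ _ n])
    have V0: "V n (snd ?s) = 0" if "n \<ge> N" for n
      using 0[of n] sol(1)[OF that, of ?s] Q_nz[OF W0(1)[OF snd_W0[OF lp(1)]], of n] that N2 by simp
    have "\<forall>\<^sub>F n in sequentially. 0 = V n (snd ?s)"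
      using eventually_ge_at_top[of N] by eventually_elim (rule V0[symmetric])
    then have "(\<lambda>n. V n (snd ?s)) \<longlonglongrightarrow> 0" by (rule Lim_transform_eventually[OF tendsto_const])
    from LIMSEQ_unique[OF this V_tendsto_1[OF snd_W0[OF lp(1)]]] show False by simp
  qed
  define d where "d = - 1 / sol0 ?s"
  have "(\<lambda>n. d * ?y n, \<lambda>n. z * (d * ?y n) + e1 n) \<in> jacobi_operator a b"
    using sol_in_operator[OF lp(1,3), of d] c unfolding lp(2) by (simp add: d_def)
  from resolvent_Stieltjes[OF sp this z(2)] show ?thesis by (simp add: d_def)
qed

lemma sol_Im_product:
  assumes x: "x \<in> {-R..-r}"
  shows "Im (sol0 (upper x) * cnj (sol 1 (upper x))) = sqrt (- x) * (H x)\<^sup>2"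
proof -
  let ?u = "\<lambda>n. sol n (upper x)"
  have "of_real (a 1) * (cnj (?u 1) * ?u 2 - cnj (?u 2) * ?u 1) = - 2 * \<i> * of_real (sqrt (- x) * (H x)\<^sup>2)"
    using sol_wronskian[OF x, of 1] by (simp add: wronskian_def numeral_2_eq_2)
  moreover have "sol0 (upper x) * cnj (?u 1) - cnj (sol0 (upper x)) * ?u 1
      = - (of_real (a 1) * (cnj (?u 1) * ?u 2 - cnj (?u 2) * ?u 1))"
    by (simp add: sol0_def upper_def algebra_simps)
  ultimately have "sol0 (upper x) * cnj (?u 1) - cnj (sol0 (upper x)) * ?u 1
      = 2 * \<i> * of_real (sqrt (- x) * (H x)\<^sup>2)" by simp
  from arg_cong[OF this, of Im] show ?thesis by (simp del: of_real_mult)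
qed

lemma wronskian_constant_pos: "x \<in> {-R..-r} \<Longrightarrow> sqrt (- x) * (H x)\<^sup>2 > 0"
  using H_pos[of x] rR by auto

lemma sol0_upper_nz: "x \<in> {-R..-r} \<Longrightarrow> sol0 (upper x) \<noteq> 0"
  using sol_Im_product[of x] wronskian_constant_pos[of x] by auto

text \<open>
  The first entry of the resolvent is continuous up to the upper side of the cut, so Stieltjes inversion applies; the
  boundary value of its imaginary part is known from the Wronskian.
\<close>

lemma density_at:
  assumes sp: "spectral_measure_of E (jacobi_operator a b)" and x: "x \<in> {-R<..<-r}"
  shows "(cdf (scalar_measure E e1) has_real_derivative
      sqrt (- x) * (H x)\<^sup>2 / (pi * (cmod (sol0 (upper x)))\<^sup>2)) (at x)"
proof -
  interpret pvm E using sp by unfold_locales (simp add: spectral_measure_of_def)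
  interpret finite_borel_measure "scalar_measure E e1" by (rule finite_borel_measure_scalar[OF ell2_e1])
  have x': "x \<in> {-R..-r}" "x < 0" using x rR by auto
  define L where "L = Im (- sol 1 (upper x) / sol0 (upper x))"
  have L: "L = sqrt (- x) * (H x)\<^sup>2 / (cmod (sol0 (upper x)))\<^sup>2"
  proof -
    have "L = Im (sol0 (upper x) * cnj (sol 1 (upper x))) / (cmod (sol0 (upper x)))\<^sup>2"
      unfolding L_def by (simp add: Im_divide cmod_power2 algebra_simps diff_divide_distrib)
    then show ?thesis by (simp only: sol_Im_product[OF x'(1)])
  qed
  have UK: "upper x \<in> K" by (rule upper_K[OF x'(1)])
  have "((\<lambda>s. Im (- sol 1 s / sol0 s)) \<longlongrightarrow> L) (at (upper x) within K)"
    unfolding L_def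
    using regular_sol[of 1] regular_sol0 UK sol0_upper_nz[OF x'(1)]
    by (intro tendsto_Im tendsto_divide tendsto_minus) (auto simp: regular_on_surface_def continuous_on_def)
  moreover have "filterlim lift (at (upper x) within K) (at (of_real x) within {z. Im z > 0})"
    unfolding filterlim_at
  proof
    show "(lift \<longlongrightarrow> upper x) (at (of_real x) within {z. Im z > 0})" by (rule lift_tendsto_upper[OF x'(2)])
    have nb: "\<forall>\<^sub>F z in nhds (of_real x). z \<in> {z. r < cmod z \<and> cmod z < R}"
      by (rule eventually_nhds_in_open) (use x x'(2) in \<open>auto intro!: open_Collect_conj open_Collect_less continuous_intros\<close>)
    then show "\<forall>\<^sub>F z in at (of_real x) within {z. Im z > 0}. lift z \<in> K \<and> lift z \<noteq> upper x"
      unfolding eventually_at_filter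
      by eventually_elim (auto intro!: lift_in_closed simp: slit_annulus_def complex_nonpos_Reals_iff, auto simp: lift_def upper_def)
  qed
  ultimately have lim: "((\<lambda>z. Im (- sol 1 (lift z) / sol0 (lift z))) \<longlongrightarrow> L) (at (of_real x) within {z. Im z > 0})"
    by (rule filterlim_compose)
  have "(cdf (scalar_measure E e1) has_real_derivative L / pi) (at x)"
  proof (rule Stieltjes_inversion_deriv)
    fix e :: real assume e: "e > 0"
    from tendstoD[OF lim e] obtain d where d0: "d > 0" and d1: "\<forall>z\<in>{z. Im z > 0}. z \<noteq> of_real x \<and> dist z (of_real x) < d \<longrightarrow>
        dist (Im (- sol 1 (lift z) / sol0 (lift z))) L < e"
      unfolding eventually_at by blast
    have d: "d > 0" "\<bar>Im (- sol 1 (lift z) / sol0 (lift z)) - L\<bar> < e"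
      if "Im z > 0" "dist z (of_real x) < d" for z
    proof -
      have "z \<noteq> of_real x" using that(1) by auto
      then show "\<bar>Im (- sol 1 (lift z) / sol0 (lift z)) - L\<bar> < e"
        using d1 that unfolding dist_real_def by blast
    qed (fact d0)
    \<comment> \<open>The choice of \<open>d'\<close> keeps \<open>x' + \<i> y\<close> inside the annulus and within distance \<open>d\<close> of \<open>x\<close>.\<close>
    define d' where "d' = min (d / 2) (min ((R + x) / 2) ((- r - x) / 2))"
    have d': "d' > 0" using d0 x by (simp add: d'_def)
    show "\<exists>d>0. \<forall>x' y. \<bar>x' - x\<bar> < d \<and> 0 < y \<and> y < d \<longrightarrow>
        \<bar>(LINT t|scalar_measure E e1. y / ((t - x')\<^sup>2 + y\<^sup>2)) - L\<bar> < e"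
    proof (intro exI[of _ d'] conjI allI impI d')
      fix x' y assume xy: "\<bar>x' - x\<bar> < d' \<and> 0 < y \<and> y < d'"
      define z where "z = Complex x' y"
      have "cmod (z - of_real x) \<le> \<bar>x' - x\<bar> + \<bar>y\<bar>"
        using cmod_le[of "z - of_real x"] by (simp add: z_def)
      then have near: "cmod (z - of_real x) < 2 * d'" using xy by simp
      have "cmod z \<le> cmod (z - of_real x) + - x" "- x \<le> cmod (z - of_real x) + cmod z"
        using norm_triangle_ineq[of "z - of_real x" "of_real x"] norm_triangle_ineq4[of "z" "z - of_real x"] x'(2) by simp_all
      moreover have "d' \<le> (R + x) / 2" "d' \<le> (- r - x) / 2" "d' \<le> d / 2"
        unfolding d'_def min_def by (simp_all split: if_split)
      then have "2 * d' \<le> R + x" "2 * d' \<le> - r - x" "2 * d' \<le> d" by simp_all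
      ultimately have "z \<in> slit_annulus r R" "dist z (of_real x) < d"
        using near xy by (auto simp: slit_annulus_def complex_nonpos_Reals_iff z_def dist_norm)
      moreover have "(\<lambda>t. Im (1 / (of_real t - z))) = (\<lambda>t. y / ((t - x')\<^sup>2 + y\<^sup>2))"
        by (simp add: Im_inverse_eq cmod_power2 z_def)
      ultimately show "\<bar>(LINT t|scalar_measure E e1. y / ((t - x')\<^sup>2 + y\<^sup>2)) - L\<bar> < e"
        using resolvent_entry[OF sp, of z] d(2)[of z] xy by (simp add: z_def)
    qed
  qed
  then show ?thesis by (simp add: L mult.commute)
qed

end

theorem theorem4p1:
  fixes \<alpha> r R :: real
    and p q a b :: "nat \<Rightarrow> real"
  assumes alpha: "0 < \<alpha>" "\<alpha> < 1"
    and a_def: "\<And>n. n \<ge> 1 \<Longrightarrow> a n = real n powr \<alpha> + p n"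
    and b_def: "\<And>n. n \<ge> 1 \<Longrightarrow> b n = - 2 * real n powr \<alpha> + q n"
    and a_pos: "\<And>n. n \<ge> 1 \<Longrightarrow> a n > 0"
    and p_l1: "summable (\<lambda>n. \<bar>p n / real n powr (\<alpha> / 2)\<bar>)"
    and q_l1: "summable (\<lambda>n. \<bar>q n / real n powr (\<alpha> / 2)\<bar>)"
    and rR: "0 < r" "r < R"
  shows "\<exists>N0\<ge>1.
    (\<forall>n\<ge>N0. \<forall>s\<in>closed_slit_annulus r R. radicand \<alpha> n s \<noteq> 0) \<and>
    (\<forall>n\<ge>N0. \<forall>s\<in>closed_slit_annulus r R. eta_minus r R \<alpha> n s \<noteq> 0) \<and>
    (\<exists>(u :: nat \<Rightarrow> complex \<times> complex \<Rightarrow> complex) (H :: real \<Rightarrow> real)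
      (u0 :: real \<Rightarrow> complex) (\<Psi> :: real \<Rightarrow> complex).
      \<comment> \<open>(1)\<close>
      (\<forall>s\<in>closed_slit_annulus r R. jacobi_solution a b (fst s) (\<lambda>n. u n s)) \<and>
      (\<exists>\<epsilon>. uniform_limit (closed_slit_annulus r R) \<epsilon> (\<lambda>_. 0) sequentially \<and>
           (\<forall>n\<ge>N0. \<forall>s\<in>closed_slit_annulus r R.
              u n s = (\<Prod>l = N0..n. eta_minus r R \<alpha> l s) * (1 + \<epsilon> n s))) \<and>
      (\<forall>n\<ge>1. regular_on_surface r R (u n)) \<and>
      \<comment> \<open>(2)\<close>
      (\<forall>x\<in>{-R..-r}.
         (\<lambda>n. real n powr (\<alpha> / 4) * (\<Prod>l = N0..n. cmod (eta_minus r R \<alpha> l (upper x))))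
           \<longlonglongrightarrow> H x \<and>
         H x \<noteq> 0) \<and>
      continuous_on {-R..-r} H \<and>
      \<comment> \<open>(3)\<close>
      (\<forall>x\<in>{-R..-r}.
         jacobi_solution a b (of_real x) (\<lambda>n. cnj (u n (upper x))) \<and>
         (\<forall>n\<ge>1. wronskian a (\<lambda>n. cnj (u n (upper x))) (\<lambda>n. u n (upper x)) n
                   = - 2 * \<i> * of_real (sqrt (- x) * (H x)\<^sup>2)) \<and>
         - 2 * \<i> * of_real (sqrt (- x) * (H x)\<^sup>2) \<noteq> 0) \<and>
      \<comment> \<open>(4)\<close>
      (\<forall>x\<in>{-R..-r}.
         u0 x = (of_real x - of_real (b 1)) * u 1 (upper x) - of_real (a 1) * u 2 (upper x) \<and>
         \<Psi> x = u0 x / (2 * \<i> * of_real (sqrt (- x) * (H x)\<^sup>2)) \<and>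
         (\<forall>n\<ge>1. orth_poly a b n (of_real x)
                   = \<Psi> x * cnj (u n (upper x)) + cnj (\<Psi> x) * u n (upper x))) \<and>
      \<comment> \<open>(5)\<close>
      (\<forall>E. spectral_measure_of E (jacobi_operator a b) \<longrightarrow>
         (AE x in lborel. x \<in> {-R..-r} \<longrightarrow>
            (cdf (scalar_measure E e1) has_real_derivative
               1 / (4 * pi * sqrt (- x) * (cmod (\<Psi> x))\<^sup>2 * (H x)\<^sup>2)) (at x) \<and>
            1 / (4 * pi * sqrt (- x) * (cmod (\<Psi> x))\<^sup>2 * (H x)\<^sup>2)
              = sqrt (- x) * (H x)\<^sup>2 / (pi * (cmod (u0 x))\<^sup>2))))"
proof -
  interpret perturbed_wkb \<alpha> "sqrt r" "sqrt R" p q a b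
    by unfold_locales (use assms in auto)
  obtain N g where "wkb_tail \<alpha> (sqrt r) (sqrt R) p q a b N g" using exists_threshold by blast
  then interpret wkb_tail \<alpha> "sqrt r" "sqrt R" p q a b N g .
  interpret slit_jacobi \<alpha> r R p q a b N g by unfold_locales (fact rR)+
  define u0 where "u0 x = sol0 (upper x)" for x
  define \<Psi> where "\<Psi> x = u0 x / (2 * \<i> * of_real (sqrt (- x) * (H x)\<^sup>2))" for x
  have formula: "1 / (4 * pi * sqrt (- x) * (cmod (\<Psi> x))\<^sup>2 * (H x)\<^sup>2)
      = sqrt (- x) * (H x)\<^sup>2 / (pi * (cmod (u0 x))\<^sup>2)" if x: "x \<in> {-R..-r}" for x
  proof -
    have h: "H x > 0" and t: "sqrt (- x) > 0" using H_pos[OF x] x rR by auto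
    have c: "cmod (\<Psi> x) = cmod (u0 x) / (2 * (sqrt (- x) * (H x)\<^sup>2))"
      unfolding \<Psi>_def using h t by (simp add: norm_divide norm_mult norm_power)
    have z: "cmod (u0 x) \<noteq> 0" using sol0_upper_nz[OF x] by (simp add: u0_def)
    have alg: "1 / (4 * pi * \<tau> * (U / (2 * (\<tau> * \<eta>\<^sup>2)))\<^sup>2 * \<eta>\<^sup>2) = \<tau> * \<eta>\<^sup>2 / (pi * U\<^sup>2)"
      if "\<tau> > 0" "\<eta> > 0" "U \<noteq> 0" for \<tau> \<eta> U :: real
      using that by (simp add: field_simps power2_eq_square)
    show ?thesis unfolding c by (rule alg[OF t h z])
  qed
  have ev: "AE x in lborel. x \<in> {-R..-r} \<longrightarrow>
            (cdf (scalar_measure E e1) has_real_derivative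
               1 / (4 * pi * sqrt (- x) * (cmod (\<Psi> x))\<^sup>2 * (H x)\<^sup>2)) (at x) \<and>
            1 / (4 * pi * sqrt (- x) * (cmod (\<Psi> x))\<^sup>2 * (H x)\<^sup>2)
              = sqrt (- x) * (H x)\<^sup>2 / (pi * (cmod (u0 x))\<^sup>2)"
    if sp: "spectral_measure_of E (jacobi_operator a b)" for E
    using AE_lborel_singleton[of "-R"] AE_lborel_singleton[of "-r"]
  proof eventually_elim
    case (elim x)
    show ?case
    proof (intro impI conjI)
      assume x: "x \<in> {-R..-r}"
      then have "x \<in> {-R<..<-r}" using elim by auto
      from density_at[OF sp this]
      show "(cdf (scalar_measure E e1) has_real_derivative
               1 / (4 * pi * sqrt (- x) * (cmod (\<Psi> x))\<^sup>2 * (H x)\<^sup>2)) (at x)"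
        unfolding formula[OF x] u0_def .
    qed (rule formula)
  qed
  have P: "orth_poly a b n (of_real x) = \<Psi> x * cnj (sol n (upper x)) + cnj (\<Psi> x) * sol n (upper x)"
    if x: "x \<in> {-R..-r}" and n: "n \<ge> 1" for x n
  proof -
    have s: "jacobi_solution a b (of_real x) (\<lambda>n. sol n (upper x))"
      using sol_solution[OF upper_K[OF x]] by (simp add: upper_def)
    have "sqrt (- x) * (H x)\<^sup>2 \<noteq> 0" using wronskian_constant_pos[OF x] by linarith
    from orth_poly_representation[OF s a_pos sol_wronskian[OF x, of 1] this n]
    show ?thesis by (simp add: \<Psi>_def u0_def sol0_def upper_def)
  qed
  show ?thesis
  \<comment> \<open>The witnesses are inserted by hand because the error sequence \<open>\<epsilon>\<close> has the same type as \<open>sol\<close>.\<close>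
  proof (rule exI[of _ N],
      ((intro conjI; (rule exI[of _ sol], rule exI[of _ H], rule exI[of _ u0], rule exI[of _ \<Psi>])?);
        (intro conjI allI ballI impI)?))
    show "1 \<le> N" using N2 by simp
    show "radicand \<alpha> n s \<noteq> 0" if "n \<ge> N" "s \<in> K" for n s using radicand_near[OF that] by auto
    show "eta_minus r R \<alpha> n s \<noteq> 0" if "n \<ge> N" "s \<in> K" for n s
      unfolding eta_minus_eq[OF that] using eta_nz that W0(1)[OF snd_W0] by blast
    show "jacobi_solution a b (fst s) (\<lambda>n. sol n s)" if "s \<in> K" for s using that by (rule sol_solution)
    show "\<exists>\<epsilon>. uniform_limit K \<epsilon> (\<lambda>_. 0) sequentially \<and>
           (\<forall>n\<ge>N. \<forall>s\<in>K. sol n s = (\<Prod>l = N..n. eta_minus r R \<alpha> l s) * (1 + \<epsilon> n s))"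
      by (rule sol_asymptotics)
    show "regular_on_surface r R (sol n)" if "n \<ge> 1" for n using that by (rule regular_sol)
    show "continuous_on {-R..-r} H" by (rule H_continuous)
    show "AE x in lborel. x \<in> {-R..-r} \<longrightarrow>
            (cdf (scalar_measure E e1) has_real_derivative
               1 / (4 * pi * sqrt (- x) * (cmod (\<Psi> x))\<^sup>2 * (H x)\<^sup>2)) (at x) \<and>
            1 / (4 * pi * sqrt (- x) * (cmod (\<Psi> x))\<^sup>2 * (H x)\<^sup>2)
              = sqrt (- x) * (H x)\<^sup>2 / (pi * (cmod (u0 x))\<^sup>2)"
      if "spectral_measure_of E (jacobi_operator a b)" for E using that by (rule ev)
    fix x assume x: "x \<in> {-R..-r}"
    show "(\<lambda>n. real n powr (\<alpha> / 4) * (\<Prod>l = N..n. cmod (eta_minus r R \<alpha> l (upper x)))) \<longlonglongrightarrow> H x"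
      using x by (rule H_limit)
    show "H x \<noteq> 0" using H_pos[OF x] by simp
    show "jacobi_solution a b (of_real x) (\<lambda>n. cnj (sol n (upper x)))" using x by (rule sol_cnj_solution)
    show "wronskian a (\<lambda>n. cnj (sol n (upper x))) (\<lambda>n. sol n (upper x)) n
                   = - 2 * \<i> * of_real (sqrt (- x) * (H x)\<^sup>2)" if "n \<ge> 1" for n
      using x that by (rule sol_wronskian)
    have nz: "- 2 * \<i> * of_real c \<noteq> 0" if "c > 0" for c :: real using that by simp
    show "- 2 * \<i> * of_real (sqrt (- x) * (H x)\<^sup>2) \<noteq> 0" by (rule nz[OF wronskian_constant_pos[OF x]])
    show "u0 x = (of_real x - of_real (b 1)) * sol 1 (upper x) - of_real (a 1) * sol 2 (upper x)"
      by (simp add: u0_def sol0_def upper_def)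
    show "\<Psi> x = u0 x / (2 * \<i> * of_real (sqrt (- x) * (H x)\<^sup>2))" by (simp add: \<Psi>_def)
    show "orth_poly a b n (of_real x) = \<Psi> x * cnj (sol n (upper x)) + cnj (\<Psi> x) * sol n (upper x)" if "n \<ge> 1" for n
      using x that by (rule P)
  qed
qed

end
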